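(* Let $s_1,\dots,s_J$ be all connected subsets of $G$ containing vertex $1$. Given IID observations $(\mathbf X_{i,\mathbf R_i},\mathbf R_i)$, $i=1,\dots,n$, and estimators $\hat{\mathcal O}_{s_j},\hat m_{s_j}$, define $$\hat\mu=\frac1n\sum_{i=1}^n \mathbf X_{i,1}\mathbf R_{i,1}+\sum_{j=1}^J\frac1n\sum_{i=1}^n\Big[\mathbf X_{i,1}\hat{\mathcal O}_{s_j}(\mathbf X_{i,N_G(s_j)})I(\mathbf R_{i,\bar N_G(s_j)}=1)+\hat m_{s_j}(\mathbf X_{i,N_G(s_j)})\Big(I(\psi(\bar{\mathbf R}_i)=s_j)-I(\mathbf R_{i,\bar N_G(s_j)}=1)\hat{\mathcal O}_{s_j}(\mathbf X_{i,N_G(s_j)})\Big)\Big].$$ Assume MMG and PAI hold and: (A1) for each $j$, $\hat{\mathcal O}_{s_j}$ lies in a uniformly bounded Donsker class $\mathcal F_j$ and $\hat m_{s_j}$ in a uniformly bounded Donsker class $\mathcal G_j$, and there are functions $\mathcal O^*_{s_j},m^*_{s_j}$ with $\|\hat{\mathcal O}_{s_j}-\mathcal O^*_{s_j}\|_{L_2(P)}=o_P(1)$ and $\|\hat m_{s_j}-m^*_{s_j}\|_{L_2(P)}=o_P(1)$; (A2) $X_1$, $\mathcal O_{s_j}$, $m_{s_j}$ are uniformly bounded by a constant $M>0$; (A3) $\sum_{j=1}^J\|\hat{\mathcal O}_{s_j}-\mathcal O_{s_j}\|_{L_2(P)}\|\hat m_{s_j}-m_{s_j}\|_{L_2(P)}=o_P(1)$;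 (A4) $\mathcal F_j$ and $\mathcal G_j$ satisfy the uniform entropy bound $\int_0^\infty\sup_Q\sqrt{\log N(\epsilon\|\bar F\|_{Q,2},\mathcal F,L^2(Q))}\,d\epsilon<\infty$, with the supremum over finitely discrete probability measures $Q$ and $\bar F$ an envelope with $P\bar F<\infty$. Then $\hat\mu\to\mathbb E[X_1]$ in probability.
   Context: $X=(X_1,\dots,X_d)$, $R\in\{0,1\}^d$ with $R_j=1$ iff $X_j$ observed; $P$ is the distribution of $(X,R)$ and $\|f\|_{L_2(P)}=(\int f^2dP)^{1/2}$. Binary vectors are identified with index sets; $\bar R=\mathbf 1_d-R$. $G$ is an undirected graph on $\{1,\dots,d\}$; for an index set $U$, $N_G(U)$ is the set of vertices outside $U$ adjacent to $U$ and $\bar N_G(U)=U\cup N_G(U)$; "$R_U=1$" means $R_k=1$ for all $k\in U$. For $v\in\{0,1\}^d$ with $v_1=1$, $\psi(v)$ is the vertex set of the connected component containing vertex $1$ in the subgraph of $G$ induced on $\{k:v_k=1\}$. True nuisance functions: $\mathcal O_{s_j}(x_{N_G(s_j)})=\dfrac{P(\psi(\bar R)=s_j\mid X_{N_G(s_j)}=x_{N_G(s_j)})}{P(R_{\bar N_G(s_j)}=1\mid X_{N_G(s_j)}=x_{N_G(s_j)})}$ and $m_{s_j}(x_{N_G(s_j)})=\mathbb E[X_1\mid X_{N_G(s_j)}=x_{N_G(s_j)},R_{\bar N_G(s_j)}=1]$. MMG and PAI: for each pattern $r$ with connected components $s_1,\dots,s_K$ of the missing set $\{k:r_k=0\}$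 in $G$, $p(x_{\bar r}\mid x_r,R=r)=\prod_k p(x_{s_k}\mid x_{N_G(s_k)},R=r)$ and $p(x_{s_k}\mid x_{N_G(s_k)},R=r)=p(x_{s_k}\mid x_{N_G(s_k)},R_{\bar N_G(s_k)}=1)$. $N(\epsilon,\mathcal F,L^2(Q))$ is the $\epsilon$-covering number in $L^2(Q)$ and $\|\bar F\|_{Q,2}$ the $L^2(Q)$ norm of the envelope. *)

theory Defs
  imports "HOL-Probability.Probability"
begin

section \<open>Graph notions (undirected graph given by a symmetric irreflexive relation adj)\<close>

definition ind_rel :: "('d \<Rightarrow> 'd \<Rightarrow> bool) \<Rightarrow> 'd set \<Rightarrow> ('d \<times> 'd) set" where
  "ind_rel adj U = {(a,b). a \<in> U \<and> b \<in> U \<and> adj a b}"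

text \<open>U is a connected subset: nonempty and the induced subgraph on U is connected.\<close>
definition gconn :: "('d \<Rightarrow> 'd \<Rightarrow> bool) \<Rightarrow> 'd set \<Rightarrow> bool" where
  "gconn adj U \<longleftrightarrow> U \<noteq> {} \<and> (\<forall>a\<in>U. \<forall>b\<in>U. (a,b) \<in> (ind_rel adj U)\<^sup>*)"

text \<open>N_G(U): vertices outside U adjacent to U; closed neighbourhood \<open>U \<union> N_G(U)\<close>.\<close>
definition nbr :: "('d \<Rightarrow> 'd \<Rightarrow> bool) \<Rightarrow> 'd set \<Rightarrow> 'd set" where
  "nbr adj U = {k. k \<notin> U \<and> (\<exists>u\<in>U. adj u k)}"

definition cnbr :: "('d \<Rightarrow> 'd \<Rightarrow> bool) \<Rightarrow> 'd set \<Rightarrow> 'd set" where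
  "cnbr adj U = U \<union> nbr adj U"

text \<open>Connected component containing a in the subgraph induced on U.\<close>
definition comp_of :: "('d \<Rightarrow> 'd \<Rightarrow> bool) \<Rightarrow> 'd set \<Rightarrow> 'd \<Rightarrow> 'd set" where
  "comp_of adj U a = {b \<in> U. (a,b) \<in> (ind_rel adj U)\<^sup>*}"

text \<open>psi(v): component of vertex v1 in the subgraph induced on {k. v k} (empty if v v1 fails,
  in which case psi is undefined in the paper; all s_j are nonempty so the indicator is then 0).\<close>
definition psi :: "('d \<Rightarrow> 'd \<Rightarrow> bool) \<Rightarrow> 'd \<Rightarrow> ('d \<Rightarrow> bool) \<Rightarrow> 'd set" where
  "psi adj v1 v = (if v v1 then comp_of adj {k. v k} v1 else {})"

text \<open>Connected components of the missing set of pattern r.\<close>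
definition comps :: "('d \<Rightarrow> 'd \<Rightarrow> bool) \<Rightarrow> ('d \<Rightarrow> bool) \<Rightarrow> 'd set set" where
  "comps adj r = {comp_of adj {k. \<not> r k} a | a. \<not> r a}"

text \<open>The index set {s_1,...,s_J}: all connected subsets containing vertex 1 (= v1).\<close>
definition Jset :: "('d \<Rightarrow> 'd \<Rightarrow> bool) \<Rightarrow> 'd \<Rightarrow> 'd set set" where
  "Jset adj v1 = {s. gconn adj s \<and> v1 \<in> s}"

section \<open>Data spaces\<close>

text \<open>x_U is represented by the full vector with coordinates outside U set to 0.\<close>
definition restr :: "'d set \<Rightarrow> ('d \<Rightarrow> real) \<Rightarrow> ('d \<Rightarrow> real)" where
  "restr U x = (\<lambda>k. if k \<in> U then x k else 0)"

definition allobs :: "'d set \<Rightarrow> ('d \<Rightarrow> bool) \<Rightarrow> bool" where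
  "allobs U r \<longleftrightarrow> (\<forall>k\<in>U. r k)"

definition Xsp :: "('d \<Rightarrow> real) measure" where
  "Xsp = PiM UNIV (\<lambda>_. borel)"

definition Dsp :: "(('d \<Rightarrow> real) \<times> ('d \<Rightarrow> bool)) measure" where
  "Dsp = Xsp \<Otimes>\<^sub>M count_space UNIV"

section \<open>MMG and PAI (via conditional distributions / kernels)\<close>

definition assemble :: "('d \<Rightarrow> 'd \<Rightarrow> bool) \<Rightarrow> ('d \<Rightarrow> bool) \<Rightarrow> ('d \<Rightarrow> real) \<Rightarrow> ('d set \<Rightarrow> 'd \<Rightarrow> real) \<Rightarrow> ('d \<Rightarrow> real)" where
  "assemble adj r x w = (\<lambda>k. if r k then x k else w (comp_of adj {k'. \<not> r k'} k) k)"

text \<open>MMG: for every pattern r, the conditional law of X_{rbar} given X_r and R = r is the product,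
  over the components s of the missing set, of kernels Kr r s depending on x_{N_G(s)} only.\<close>
definition MMG :: "(('d \<Rightarrow> real) \<times> ('d \<Rightarrow> bool)) measure \<Rightarrow> ('d \<Rightarrow> 'd \<Rightarrow> bool)
     \<Rightarrow> (('d \<Rightarrow> bool) \<Rightarrow> 'd set \<Rightarrow> ('d \<Rightarrow> real) \<Rightarrow> ('d \<Rightarrow> real) measure) \<Rightarrow> bool" where
  "MMG P adj Kr \<longleftrightarrow>
     (\<forall>r. \<forall>s\<in>comps adj r. Kr r s \<in> measurable Xsp (prob_algebra Xsp)) \<and>
     (\<forall>r. \<forall>A\<in>sets Xsp.
        measure P {z\<in>space P. fst z \<in> A \<and> snd z = r} =
        (\<integral>z. indicator {z. snd z = r} z *
              measure (PiM (comps adj r) (\<lambda>s. Kr r s (restr (nbr adj s) (fst z))))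
                {w \<in> space (PiM (comps adj r) (\<lambda>s. Kr r s (restr (nbr adj s) (fst z)))).
                   assemble adj r (fst z) w \<in> A} \<partial>P))"

text \<open>PAI: each factor Kr r s is (a version of) the conditional law of X_s given X_{N_G(s)}
  on the event R_{Nbar_G(s)} = 1.\<close>
definition PAI :: "(('d \<Rightarrow> real) \<times> ('d \<Rightarrow> bool)) measure \<Rightarrow> ('d \<Rightarrow> 'd \<Rightarrow> bool)
     \<Rightarrow> (('d \<Rightarrow> bool) \<Rightarrow> 'd set \<Rightarrow> ('d \<Rightarrow> real) \<Rightarrow> ('d \<Rightarrow> real) measure) \<Rightarrow> bool" where
  "PAI P adj Kr \<longleftrightarrow>
     (\<forall>r. \<forall>s\<in>comps adj r. \<forall>A\<in>sets Xsp. \<forall>B\<in>sets Xsp.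
        measure P {z\<in>space P. restr (nbr adj s) (fst z) \<in> A \<and> restr s (fst z) \<in> B
                              \<and> allobs (cnbr adj s) (snd z)} =
        (\<integral>z. indicator {z. restr (nbr adj s) (fst z) \<in> A \<and> allobs (cnbr adj s) (snd z)} z *
              measure (Kr r s (restr (nbr adj s) (fst z))) {y \<in> space Xsp. restr s y \<in> B} \<partial>P))"

section \<open>Conditional expectation as a function of the conditioning variable\<close>

text \<open>g is a version of x \<mapsto> E[Y | Z = x].\<close>
definition cond_exp_fn :: "'a measure \<Rightarrow> ('a \<Rightarrow> real) \<Rightarrow> ('a \<Rightarrow> 'b) \<Rightarrow> 'b measure \<Rightarrow> ('b \<Rightarrow> real) \<Rightarrow> bool" where
  "cond_exp_fn P Y Z N g \<longleftrightarrow> g \<in> borel_measurable N \<and> integrable P (\<lambda>z. g (Z z)) \<and>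
     (\<forall>A\<in>sets N. (\<integral>z. indicator A (Z z) * Y z \<partial>P) = (\<integral>z. indicator A (Z z) * g (Z z) \<partial>P))"

section \<open>L2 norms and o_P(1)\<close>

definition L2n :: "'a measure \<Rightarrow> ('a \<Rightarrow> real) \<Rightarrow> ennreal" where
  "L2n P g = (let I = (\<integral>\<^sup>+z. ennreal ((g z)\<^sup>2) \<partial>P) in
              if I = \<top> then \<top> else ennreal (sqrt (enn2real I)))"

definition oP1 :: "'w measure \<Rightarrow> (nat \<Rightarrow> 'w \<Rightarrow> ennreal) \<Rightarrow> bool" where
  "oP1 M Y \<longleftrightarrow> (\<forall>e>0. (\<lambda>n. measure M {\<omega>\<in>space M. Y n \<omega> > ennreal e}) \<longlonglongrightarrow> 0)"

section \<open>Donsker classes (Hoffmann-Jorgensen weak convergence in l-infinity(F))\<close>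

definition lset :: "('x \<Rightarrow> real) set \<Rightarrow> (('x \<Rightarrow> real) \<Rightarrow> real) set" where
  "lset F = {g. (\<exists>B. \<forall>f\<in>F. \<bar>g f\<bar> \<le> B) \<and> (\<forall>f. f \<notin> F \<longrightarrow> g f = 0)}"

definition supdist :: "('x \<Rightarrow> real) set \<Rightarrow> (('x \<Rightarrow> real) \<Rightarrow> real) \<Rightarrow> (('x \<Rightarrow> real) \<Rightarrow> real) \<Rightarrow> real" where
  "supdist F g h = (SUP f\<in>F. \<bar>g f - h f\<bar>)"

definition lopen :: "('x \<Rightarrow> real) set \<Rightarrow> (('x \<Rightarrow> real) \<Rightarrow> real) set \<Rightarrow> bool" where
  "lopen F U \<longleftrightarrow> U \<subseteq> lset F \<and> (\<forall>g\<in>U. \<exists>e>0. \<forall>h\<in>lset F. supdist F g h < e \<longrightarrow> h \<in> U)"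

definition lborel_alg :: "('x \<Rightarrow> real) set \<Rightarrow> (('x \<Rightarrow> real) \<Rightarrow> real) measure" where
  "lborel_alg F = sigma (lset F) {U. lopen F U}"

definition lcompact :: "('x \<Rightarrow> real) set \<Rightarrow> (('x \<Rightarrow> real) \<Rightarrow> real) set \<Rightarrow> bool" where
  "lcompact F K \<longleftrightarrow> K \<subseteq> lset F \<and>
     (\<forall>\<sigma>::nat \<Rightarrow> (('x \<Rightarrow> real) \<Rightarrow> real). (\<forall>n. \<sigma> n \<in> K) \<longrightarrow>
        (\<exists>g\<in>K. \<exists>r::nat \<Rightarrow> nat. strict_mono r \<and> (\<lambda>n. supdist F (\<sigma> (r n)) g) \<longlonglongrightarrow> 0))"

definition lbcont :: "('x \<Rightarrow> real) set \<Rightarrow> ((('x \<Rightarrow> real) \<Rightarrow> real) \<Rightarrow> real) \<Rightarrow> bool" where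
  "lbcont F h \<longleftrightarrow> (\<exists>B. \<forall>g\<in>lset F. \<bar>h g\<bar> \<le> B) \<and>
     (\<forall>g\<in>lset F. \<forall>e>0. \<exists>\<delta>>0. \<forall>g'\<in>lset F. supdist F g g' < \<delta> \<longrightarrow> \<bar>h g - h g'\<bar> < e)"

definition emp_proc :: "'x measure \<Rightarrow> ('x \<Rightarrow> real) set \<Rightarrow> nat \<Rightarrow> (nat \<Rightarrow> 'x) \<Rightarrow> (('x \<Rightarrow> real) \<Rightarrow> real)" where
  "emp_proc Q F n \<omega> = (\<lambda>f. if f \<in> F then sqrt (real n) * ((\<Sum>i<n. f (\<omega> i)) / real n - (\<integral>x. f x \<partial>Q)) else 0)"

definition outer_exp :: "'w measure \<Rightarrow> ('w \<Rightarrow> real) \<Rightarrow> real" where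
  "outer_exp M Y = Inf {(\<integral>\<omega>. U \<omega> \<partial>M) | U. U \<in> borel_measurable M \<and> integrable M U \<and>
                                          (\<forall>\<omega>\<in>space M. Y \<omega> \<le> U \<omega>)}"

text \<open>F is Q-Donsker: the empirical process on the canonical iid product space converges weakly
  (outer expectations of bounded continuous functionals) to a tight Borel law on l-infinity(F).\<close>
definition donsker :: "'x measure \<Rightarrow> ('x \<Rightarrow> real) set \<Rightarrow> bool" where
  "donsker Q F \<longleftrightarrow> (\<forall>f\<in>F. integrable Q f) \<and>
     (\<exists>L. prob_space L \<and> space L = lset F \<and> sets L = sets (lborel_alg F) \<and>
        (\<forall>e>0. \<exists>K. lcompact F K \<and> K \<in> sets L \<and> measure L K \<ge> 1 - e) \<and>
        (\<forall>h. lbcont F h \<and> h \<in> borel_measurable L \<longrightarrow>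
           (\<lambda>n. outer_exp (PiM UNIV (\<lambda>_::nat. Q)) (\<lambda>\<omega>. h (emp_proc Q F n \<omega>)))
             \<longlonglongrightarrow> (\<integral>g. h g \<partial>L)))"

definition unif_bounded :: "('x \<Rightarrow> real) set \<Rightarrow> bool" where
  "unif_bounded F \<longleftrightarrow> (\<exists>B. \<forall>f\<in>F. \<forall>x. \<bar>f x\<bar> \<le> B)"

section \<open>Uniform entropy\<close>

definition L2Q :: "'x pmf \<Rightarrow> ('x \<Rightarrow> real) \<Rightarrow> real" where
  "L2Q Q g = sqrt (\<Sum>x\<in>set_pmf Q. pmf Q x * (g x)\<^sup>2)"

text \<open>Covering number N(e, F, L2(Q)) (infinite if no finite cover).\<close>
definition cover_num :: "'x pmf \<Rightarrow> ('x \<Rightarrow> real) set \<Rightarrow> real \<Rightarrow> ennreal" where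
  "cover_num Q F e = Inf {of_nat (card C) | C. finite C \<and> (\<forall>f\<in>F. \<exists>c\<in>C. L2Q Q (\<lambda>x. f x - c x) < e)}"

definition sqrt_log :: "ennreal \<Rightarrow> ennreal" where
  "sqrt_log N = (if N = \<top> then \<top> else ennreal (sqrt (ln (enn2real N))))"

text \<open>Uniform entropy bound with envelope Fb, Fb integrable under Q.\<close>
definition unif_entropy :: "'x measure \<Rightarrow> ('x \<Rightarrow> real) set \<Rightarrow> ('x \<Rightarrow> real) \<Rightarrow> bool" where
  "unif_entropy P F Fb \<longleftrightarrow> (\<forall>f\<in>F. \<forall>x. \<bar>f x\<bar> \<le> Fb x) \<and> Fb \<in> borel_measurable P \<and>
     (\<integral>\<^sup>+x. ennreal (Fb x) \<partial>P) < \<top> \<and>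
     (\<integral>\<^sup>+e. indicator {0<..} e *
        (SUP Q\<in>{Q :: 'x pmf. finite (set_pmf Q) \<and> L2Q Q Fb > 0}. sqrt_log (cover_num Q F (e * L2Q Q Fb)))
      \<partial>lborel) < \<top>"

section \<open>The estimator\<close>

definition ind :: "bool \<Rightarrow> real" where "ind b = (if b then 1 else 0)"

definition muhat :: "('d \<Rightarrow> 'd \<Rightarrow> bool) \<Rightarrow> 'd \<Rightarrow> (nat \<Rightarrow> 'w \<Rightarrow> ('d \<Rightarrow> real) \<times> ('d \<Rightarrow> bool))
   \<Rightarrow> (nat \<Rightarrow> 'd set \<Rightarrow> 'w \<Rightarrow> ('d \<Rightarrow> real) \<Rightarrow> real) \<Rightarrow> (nat \<Rightarrow> 'd set \<Rightarrow> 'w \<Rightarrow> ('d \<Rightarrow> real) \<Rightarrow> real)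
   \<Rightarrow> nat \<Rightarrow> 'w \<Rightarrow> real" where
  "muhat adj v1 Z Ohat mhat n \<omega> =
     (\<Sum>i<n. fst (Z i \<omega>) v1 * ind (snd (Z i \<omega>) v1)) / real n +
     (\<Sum>s\<in>Jset adj v1. (\<Sum>i<n.
        let x = fst (Z i \<omega>); r = snd (Z i \<omega>); xn = restr (nbr adj s) x;
            a = ind (allobs (cnbr adj s) r); ob = Ohat n s \<omega> xn
        in x v1 * ob * a + mhat n s \<omega> xn * (ind (psi adj v1 (\<lambda>k. \<not> r k) = s) - a * ob)) / real n)"

end

theory Submission
  imports Defs
begin

text \<open>
  With \<open>O = p1 / p2\<close> and \<open>m = q / p2\<close>, MMG and PAI give \<open>E[X\<^sub>1 I(\<psi> = s)] = E[m I(\<psi> = s)]\<close>, and the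
  bias of the \<open>s\<close>-summand at fixed \<open>(f, g)\<close> in place of the estimators equals
  \<open>- E[I(R = 1 on the closed neighbourhood) (f - O) (g - m)]\<close>, which the product rate condition makes
  vanish by Cauchy--Schwarz.

  What remains is to replace the estimators by fixed limits inside the empirical mean. Since the
  scores are Lipschitz in \<open>(f, g)\<close>, it suffices that \<open>P\<^sub>n \<bar>f - f0\<bar>\<close> is small uniformly over those \<open>f\<close> in
  the class with \<open>P \<bar>f - f0\<bar>\<close> small. The Donsker property only controls \<open>(P\<^sub>n - P)(f - f0)\<close>, in outer
  probability. The absolute value is handled by resampling: let \<open>I\<close> be the set of sample points where
  \<open>f - f0\<close> has the dominating sign. After drawing the points outside \<open>I\<close> afresh, the mean of \<open>f - f0\<close> is
  still large, except with probability \<open>4 ^ (- n)\<close>, so the new sample lies in the exceptional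
  set of the Glivenko--Cantelli property; a union bound over the \<open>2 ^ n\<close> sets \<open>I\<close> concludes.
  Symmetrization is avoided, because it would need measurability of suprema over the class.
\<close>

section \<open>Smallness in outer probability\<close>

text \<open>The estimators are fitted to the very sample that is averaged, so the law of large
  numbers applies only once fixed functions have taken their place. Those limits need not be the
  true nuisances; therefore the bias is computed at the realised estimators, integrated over an
  independent data point, where only their product distance from the truth enters.

  The absolute value is forced by the weights of the score, which multiply \<open>f - f0\<close> by
  data-dependent factors of either sign; control of a signed mean would not survive them.

  Resampling gets around the dependence of the offending \<open>f\<close> on the sample: with
  \<open>x\<close> held fixed, \<open>f\<close> and the mask \<open>I\<close> are fixed too, and the
  tail bound for the fresh points \<open>y\<close> concerns one single function. Only the masks and
  a measurable cover \<open>C\<close> of the exceptional set remain, so no supremum over the class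
  is ever measured. The price is one event for each mask, which is why closeness in mean must be
  converted into an exponential rate, by taking the radius \<delta> small.\<close>

text \<open>Outer probability is needed because events of the form ``some member of the class
  deviates'' need not be measurable.\<close>
definition osmall :: "'w measure \<Rightarrow> (nat \<Rightarrow> 'w set) \<Rightarrow> bool" where
  "osmall M W \<longleftrightarrow> (\<forall>\<epsilon>>0. \<forall>\<^sub>F n in sequentially. \<exists>A\<in>sets M. measure M A \<le> \<epsilon> \<and> W n \<inter> space M \<subseteq> A)"

lemma osmallD:
  "osmall M W \<Longrightarrow> 0 < \<epsilon> \<Longrightarrow> \<forall>\<^sub>F n in sequentially. \<exists>A\<in>sets M. measure M A \<le> \<epsilon> \<and> W n \<inter> space M \<subseteq> A"
  unfolding osmall_def by blast

lemma osmall_mono: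
  assumes "osmall M W" "\<forall>\<^sub>F n in sequentially. V n \<inter> space M \<subseteq> W n"
  shows "osmall M V"
  unfolding osmall_def
proof (intro allI impI)
  fix \<epsilon> :: real assume "\<epsilon> > 0"
  from osmallD[OF assms(1) this] assms(2)
  show "\<forall>\<^sub>F n in sequentially. \<exists>A\<in>sets M. measure M A \<le> \<epsilon> \<and> V n \<inter> space M \<subseteq> A"
    by eventually_elim blast
qed

lemma osmallI:
  assumes "\<forall>\<^sub>F n in sequentially. A n \<in> sets M" "(\<lambda>n. measure M (A n)) \<longlonglongrightarrow> 0"
    "\<forall>\<^sub>F n in sequentially. W n \<inter> space M \<subseteq> A n"
  shows "osmall M W"
  unfolding osmall_def
proof (intro allI impI)
  fix \<epsilon> :: real assume "\<epsilon> > 0"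
  then have "\<forall>\<^sub>F n in sequentially. measure M (A n) < \<epsilon>"
    using assms(2) by (rule order_tendstoD(2)[rotated])
  with assms(1,3) show "\<forall>\<^sub>F n in sequentially. \<exists>A\<in>sets M. measure M A \<le> \<epsilon> \<and> W n \<inter> space M \<subseteq> A"
    by eventually_elim (meson less_imp_le)
qed

context finite_measure
begin

lemma osmall_Un:
  assumes "osmall M W" "osmall M V"
  shows "osmall M (\<lambda>n. W n \<union> V n)"
  unfolding osmall_def
proof (intro allI impI)
  fix \<epsilon> :: real assume "\<epsilon> > 0"
  then have "\<epsilon>/2 > 0" by simp
  from osmallD[OF assms(1) this] osmallD[OF assms(2) this]
  show "\<forall>\<^sub>F n in sequentially. \<exists>A\<in>sets M. measure M A \<le> \<epsilon> \<and> (W n \<union> V n) \<inter> space M \<subseteq> A"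
  proof eventually_elim
    case (elim n)
    then obtain A B where AB: "A \<in> sets M" "measure M A \<le> \<epsilon>/2" "W n \<inter> space M \<subseteq> A"
      "B \<in> sets M" "measure M B \<le> \<epsilon>/2" "V n \<inter> space M \<subseteq> B" by blast
    then have "measure M (A \<union> B) \<le> \<epsilon>"
      using measure_Un_le[of A M B] by linarith
    with AB show ?case by (intro bexI[of _ "A \<union> B"]) auto
  qed
qed

text \<open>Works without measurability of \<open>W n\<close>: a nonmeasurable set has
  \<open>measure\<close> 0, so its \<open>measure\<close> never exceeds that of a measurable cover.
  In this way the final event about \<open>muhat\<close> is reached from its cover alone.\<close>

lemma osmall_measure_tendsto:
  assumes "osmall M W" "\<And>n. W n \<subseteq> space M"
  shows "(\<lambda>n. measure M (W n)) \<longlonglongrightarrow> 0"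
proof (rule tendstoI)
  fix e :: real assume "e > 0"
  then have "e/2 > 0" by simp
  from osmallD[OF assms(1) this] show "\<forall>\<^sub>F n in sequentially. dist (measure M (W n)) 0 < e"
  proof eventually_elim
    case (elim n)
    then obtain A where "A \<in> sets M" "measure M A \<le> e/2" "W n \<subseteq> A" using assms(2)[of n] by blast
    then have "measure M (W n) \<le> e/2" using finite_measure_mono order_trans by blast
    with \<open>e > 0\<close> show ?case by simp
  qed
qed

lemma osmall_null_set:
  assumes "AE \<omega> in M. Q \<omega>"
  shows "osmall M (\<lambda>n. {\<omega>. \<not> Q \<omega>})"
proof -
  from assms obtain N where N: "{\<omega>\<in>space M. \<not> Q \<omega>} \<subseteq> N" "emeasure M N = 0" "N \<in> sets M"
    by (rule AE_E)
  then show ?thesis by (intro osmallI[of "\<lambda>_. N"]) (auto simp: measure_def)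
qed

end

text \<open>Preimages of measurable covers are measurable covers of the same measure when
  \<open>T\<close> carries \<open>M\<close> to \<open>L\<close>. This moves outer bounds from the
  canonical sequence space, where Donsker classes are defined, to the space of the
  observations.\<close>

lemma osmall_vimage:
  assumes T: "T \<in> measurable M L" and L: "distr M L T = L" and W: "osmall L W"
    and V: "\<And>n \<omega>. \<omega> \<in> space M \<Longrightarrow> \<omega> \<in> V n \<Longrightarrow> T \<omega> \<in> W n"
  shows "osmall M V"
  unfolding osmall_def
proof (intro allI impI)
  fix \<epsilon> :: real assume "\<epsilon> > 0"
  from osmallD[OF W this]
  show "\<forall>\<^sub>F n in sequentially. \<exists>A\<in>sets M. measure M A \<le> \<epsilon> \<and> V n \<inter> space M \<subseteq> A"
  proof eventually_elim
    case (elim n)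
    then obtain A where A: "A \<in> sets L" "measure L A \<le> \<epsilon>" "W n \<inter> space L \<subseteq> A" by blast
    have "measure M (T -` A \<inter> space M) = measure (distr M L T) A"
      using T A by (simp add: measure_distr)
    moreover have "V n \<inter> space M \<subseteq> T -` A \<inter> space M"
      using A(3) V measurable_space[OF T] by blast
    ultimately show ?case
      using A T L by (intro bexI[of _ "T -` A \<inter> space M"]) auto
  qed
qed

text \<open>Convergence to 0 in outer probability, so that empirical distances at the estimators can
  be handled without showing them measurable.\<close>

definition vop :: "'w measure \<Rightarrow> (nat \<Rightarrow> 'w \<Rightarrow> real) \<Rightarrow> bool" where
  "vop M Y \<longleftrightarrow> (\<forall>e>0. osmall M (\<lambda>n. {\<omega>. e < \<bar>Y n \<omega>\<bar>}))"

context finite_measure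
begin

lemma vop_add:
  assumes "vop M X" "vop M Y"
  shows "vop M (\<lambda>n \<omega>. X n \<omega> + Y n \<omega>)"
  unfolding vop_def
proof (intro allI impI)
  fix e :: real assume "e > 0"
  then have "osmall M (\<lambda>n. {\<omega>. e/2 < \<bar>X n \<omega>\<bar>} \<union> {\<omega>. e/2 < \<bar>Y n \<omega>\<bar>})"
    using assms half_gt_zero[of e] unfolding vop_def by (intro osmall_Un) blast+
  then show "osmall M (\<lambda>n. {\<omega>. e < \<bar>X n \<omega> + Y n \<omega>\<bar>})"
    by (rule osmall_mono) (auto intro!: always_eventually)
qed

lemma vop_cmult:
  assumes "vop M X"
  shows "vop M (\<lambda>n \<omega>. c * X n \<omega>)"
  unfolding vop_def
proof (intro allI impI)
  fix e :: real assume "e > 0"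
  then have "osmall M (\<lambda>n. {\<omega>. e/(\<bar>c\<bar>+1) < \<bar>X n \<omega>\<bar>})"
    using assms by (auto simp: vop_def)
  moreover have "e / (\<bar>c\<bar>+1) < \<bar>x\<bar>" if "e < \<bar>c * x\<bar>" for x
  proof -
    have "\<bar>c * x\<bar> \<le> (\<bar>c\<bar>+1) * \<bar>x\<bar>" by (simp add: abs_mult mult_right_mono)
    with that have "e < (\<bar>c\<bar>+1) * \<bar>x\<bar>" by linarith
    then show ?thesis by (simp add: pos_divide_less_eq mult.commute)
  qed
  ultimately show "osmall M (\<lambda>n. {\<omega>. e < \<bar>c * X n \<omega>\<bar>})"
    by (elim osmall_mono) (auto intro!: always_eventually)
qed

lemma vop_zero: "vop M (\<lambda>n \<omega>. 0)"
  by (auto simp: vop_def osmall_def intro!: always_eventually bexI[of _ "{}"])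

lemma vop_sum:
  assumes "finite I" "\<And>i. i \<in> I \<Longrightarrow> vop M (X i)"
  shows "vop M (\<lambda>n \<omega>. \<Sum>i\<in>I. X i n \<omega>)"
  using assms by (induction I) (auto intro: vop_add vop_zero)

text \<open>The index \<open>n = 0\<close> is exempt because an average over an empty sample is just
  the default value 0 of division, for which the intended domination can fail.\<close>

lemma vop_dominated:
  assumes "vop M Y" "AE \<omega> in M. \<forall>n>0. \<bar>X n \<omega>\<bar> \<le> \<bar>Y n \<omega>\<bar>"
  shows "vop M X"
  unfolding vop_def
proof (intro allI impI)
  fix e :: real assume "e > 0"
  then have "osmall M (\<lambda>n. {\<omega>. e < \<bar>Y n \<omega>\<bar>} \<union> {\<omega>. \<not> (\<forall>n>0. \<bar>X n \<omega>\<bar> \<le> \<bar>Y n \<omega>\<bar>)})"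
    using assms by (intro osmall_Un osmall_null_set) (auto simp: vop_def)
  then show "osmall M (\<lambda>n. {\<omega>. e < \<bar>X n \<omega>\<bar>})"
    by (rule osmall_mono) (force intro: eventually_mono[OF eventually_gt_at_top[of 0]])
qed

end

section \<open>Independent identically distributed sequences\<close>

locale iid_seq = prob_space M for M :: "'w measure" +
  fixes Z :: "nat \<Rightarrow> 'w \<Rightarrow> 'x" and P :: "'x measure"
  assumes Z_meas [measurable]: "\<And>i. Z i \<in> measurable M P"
    and Z_indep: "indep_vars (\<lambda>_. P) Z UNIV"
    and Z_distr: "\<And>i. distr M P (Z i) = P"
begin

lemma prob_space_law: "prob_space P"
  by (subst Z_distr[symmetric, of 0]) (rule prob_space_distr[OF Z_meas])

lemma iid_seq_compose:
  assumes [measurable]: "g \<in> measurable P N"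
  shows "iid_seq M (\<lambda>i \<omega>. g (Z i \<omega>)) (distr P N g)"
proof unfold_locales
  fix i
  show "(\<lambda>\<omega>. g (Z i \<omega>)) \<in> measurable M (distr P N g)"
    by simp
  have "distr M N (\<lambda>\<omega>. g (Z i \<omega>)) = distr (distr M P (Z i)) N g"
    by (subst distr_distr) (auto simp: comp_def)
  then show "distr M (distr P N g) (\<lambda>\<omega>. g (Z i \<omega>)) = distr P N g"
    by (simp add: Z_distr cong: distr_cong)
next
  have "indep_vars (\<lambda>_. N) (\<lambda>i \<omega>. g (Z i \<omega>)) UNIV"
    by (rule indep_vars_compose2[OF Z_indep]) simp
  then show "indep_vars (\<lambda>_. distr P N g) (\<lambda>i \<omega>. g (Z i \<omega>)) UNIV"
    by (simp add: indep_vars_def)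
qed

text \<open>Identifies the law of the sample path with the canonical product measure that occurs in
  \<open>donsker\<close>.\<close>

lemma distr_sequence: "distr M (PiM UNIV (\<lambda>_. P)) (\<lambda>\<omega> i. Z i \<omega>) = PiM UNIV (\<lambda>_. P)"
  using iffD1[OF indep_vars_iff_distr_eq_PiM[where I = UNIV and M' = "\<lambda>_. P" and X = Z] Z_indep]
  by (simp add: Z_distr restrict_UNIV)

lemma nn_integral_prod_iid:
  assumes [measurable]: "h \<in> borel_measurable P" and h: "\<And>x. 0 \<le> h x"
  shows "(\<integral>\<^sup>+\<omega>. (\<Prod>i<n. ennreal (h (Z i \<omega>))) \<partial>M) = (\<integral>\<^sup>+x. ennreal (h x) \<partial>P) ^ n"
proof -
  have "indep_vars (\<lambda>_. borel) (\<lambda>i \<omega>. ennreal (h (Z i \<omega>))) {..<n}"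
    by (rule indep_vars_compose2[OF indep_vars_subset[OF Z_indep]]) auto
  then have "(\<integral>\<^sup>+\<omega>. (\<Prod>i<n. ennreal (h (Z i \<omega>))) \<partial>M) = (\<Prod>i<n. \<integral>\<^sup>+\<omega>. ennreal (h (Z i \<omega>)) \<partial>M)"
    by (intro indep_vars_nn_integral) auto
  also have "\<dots> = (\<Prod>i<n. \<integral>\<^sup>+x. ennreal (h x) \<partial>P)"
  proof (intro prod.cong refl)
    fix i show "(\<integral>\<^sup>+\<omega>. ennreal (h (Z i \<omega>)) \<partial>M) = (\<integral>\<^sup>+x. ennreal (h x) \<partial>P)"
      using nn_integral_distr[OF Z_meas[of i], of "\<lambda>x. ennreal (h x)"] by (simp add: Z_distr)
  qed
  finally show ?thesis by simp
qed

text \<open>Hoeffding's inequality gives a geometrically decaying bound for the deviation event,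
  which is itself the measurable cover.\<close>

lemma lln_bounded:
  assumes [measurable]: "h \<in> borel_measurable P" and b: "AE x in P. \<bar>h x\<bar> \<le> b"
  shows "vop M (\<lambda>n \<omega>. (\<Sum>i<n. h (Z i \<omega>)) / real n - (\<integral>x. h x \<partial>P))"
  unfolding vop_def
proof (intro allI impI)
  fix e :: real assume e: "e > 0"
  \<comment> \<open>Strictly positive whatever \<open>b\<close> is, so that the interval
    \<open>{-c..c}\<close> in Hoeffding's inequality has positive length.\<close>
  define c where "c = \<bar>b\<bar> + 1"
  have c: "c > 0" by (simp add: c_def)
  define \<mu> where "\<mu> = (\<integral>x. h x \<partial>P)"
  have ind: "indep_vars (\<lambda>_. borel) (\<lambda>i \<omega>. h (Z i \<omega>)) {..<n}" for n
    by (rule indep_vars_compose2[OF indep_vars_subset[OF Z_indep]]) auto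
  have dst: "distr M borel (\<lambda>\<omega>. h (Z i \<omega>)) = distr P borel h" for i
  proof -
    have "distr (distr M P (Z i)) borel h = distr M borel (\<lambda>\<omega>. h (Z i \<omega>))"
      by (subst distr_distr) (auto simp: comp_def)
    then show ?thesis by (simp add: Z_distr)
  qed
  have AE: "AE \<omega> in M. h (Z 0 \<omega>) \<in> {-c..c}"
  proof -
    have "AE x in distr M P (Z 0). \<bar>h x\<bar> \<le> b" using b by (subst Z_distr)
    then have "AE \<omega> in M. \<bar>h (Z 0 \<omega>)\<bar> \<le> b" by (rule AE_distrD[OF Z_meas])
    then show ?thesis by eventually_elim (auto simp: c_def)
  qed
  have mu: "expectation (\<lambda>\<omega>. h (Z 0 \<omega>)) = \<mu>"
    using integral_distr[OF Z_meas[of 0], of h] by (simp add: Z_distr \<mu>_def)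
  have hf: "prob {\<omega>\<in>space M. \<bar>(\<Sum>i<n. h (Z i \<omega>)) / real n - \<mu>\<bar> \<ge> e} \<le> 2 * exp (- 2 * real n * e\<^sup>2 / (2*c)\<^sup>2)"
    if "n > 0" for n
  proof -
    interpret H: Hoeffding_ineq_iid M "{..<n}" "\<lambda>i \<omega>. h (Z i \<omega>)" "\<lambda>\<omega>. h (Z 0 \<omega>)" "-c" c \<mu>
    proof unfold_locales
      show "indep_vars (\<lambda>_. borel) (\<lambda>i \<omega>. h (Z i \<omega>)) {..<n}" by (rule ind)
      show "\<mu> \<equiv> expectation (\<lambda>\<omega>. h (Z 0 \<omega>))" using mu by (rule eq_reflection[OF sym])
      show "AE \<omega> in M. h (Z 0 \<omega>) \<in> {-c..c}" by (rule AE)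
    qed (simp_all only: dst finite_lessThan, measurable)
    have "c - - c = 2 * c" by simp
    with H.Hoeffding_ineq_abs_ge'[of e] e c that show ?thesis
      by (simp only: card_lessThan) auto
  qed
  show "osmall M (\<lambda>n. {\<omega>. e < \<bar>(\<Sum>i<n. h (Z i \<omega>)) / real n - (\<integral>x. h x \<partial>P)\<bar>})"
  proof (rule osmallI[where A = "\<lambda>n. {\<omega>\<in>space M. \<bar>(\<Sum>i<n. h (Z i \<omega>)) / real n - \<mu>\<bar> \<ge> e}"])
    define k where "k = 2 * e\<^sup>2 / (2*c)\<^sup>2"
    have "k > 0" using e c by (simp add: k_def)
    have "exp (- 2 * real n * e\<^sup>2 / (2*c)\<^sup>2) = exp (-k) ^ n" for n
      by (simp add: k_def mult_ac flip: exp_of_nat_mult)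
    then have "(\<lambda>n. 2 * exp (- 2 * real n * e\<^sup>2 / (2*c)\<^sup>2)) \<longlonglongrightarrow> 2 * 0"
      using \<open>k > 0\<close> by (simp only:) (intro tendsto_mult tendsto_const LIMSEQ_power_zero, simp)
    then have up: "(\<lambda>n. 2 * exp (- 2 * real n * e\<^sup>2 / (2*c)\<^sup>2)) \<longlonglongrightarrow> 0" by simp
    have "\<forall>\<^sub>F n in sequentially. prob {\<omega>\<in>space M. \<bar>(\<Sum>i<n. h (Z i \<omega>)) / real n - \<mu>\<bar> \<ge> e}
        \<le> 2 * exp (- 2 * real n * e\<^sup>2 / (2*c)\<^sup>2)"
      using eventually_gt_at_top[of "0::nat"] by eventually_elim (rule hf)
    then show "(\<lambda>n. prob {\<omega>\<in>space M. \<bar>(\<Sum>i<n. h (Z i \<omega>)) / real n - \<mu>\<bar> \<ge> e}) \<longlonglongrightarrow> 0"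
      by (rule tendsto_sandwich[OF always_eventually _ tendsto_const up, rotated]) simp
    show "\<forall>\<^sub>F n in sequentially. {\<omega>\<in>space M. \<bar>(\<Sum>i<n. h (Z i \<omega>)) / real n - \<mu>\<bar> \<ge> e} \<in> events"
      by (intro always_eventually allI) measurable
    show "\<forall>\<^sub>F n in sequentially. {\<omega>. e < \<bar>(\<Sum>i<n. h (Z i \<omega>)) / real n - (\<integral>x. h x \<partial>P)\<bar>} \<inter> space M
        \<subseteq> {\<omega>\<in>space M. \<bar>(\<Sum>i<n. h (Z i \<omega>)) / real n - \<mu>\<bar> \<ge> e}"
      unfolding \<mu>_def by (intro always_eventually allI subsetI) simp
  qed
qed

text \<open>The rate has to beat the number \<open>2 ^ n\<close> of subsets of the sample.\<close>
lemma exponential_tail: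
  fixes b \<eta> :: real
  assumes "b > 0" "\<eta> > 0"
  defines "l \<equiv> ln 8 / \<eta>"
  assumes h[measurable]: "h \<in> borel_measurable P" and hb: "\<And>x. 0 \<le> h x" "\<And>x. h x \<le> b"
    and small: "(\<integral>x. h x \<partial>P) \<le> 1 / (l * exp (l * b))"
  shows "prob {\<omega>\<in>space M. (\<Sum>i<n. h (Z i \<omega>)) \<ge> \<eta> * n} \<le> (1/4) ^ n"
proof -
  interpret P: prob_space P by (rule prob_space_law)
  have l: "l > 0" unfolding l_def using assms(2) by simp
  have intg: "integrable P h"
    by (rule P.integrable_const_bound[of _ b]) (use hb in auto)
  \<comment> \<open>From \<open>1 - u \<le> exp (- u)\<close> one gets
    \<open>exp u \<le> 1 + u * exp u\<close>; bounding the inner exponential by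
    \<open>exp (l * b)\<close> leaves an expression linear in \<open>h\<close>, so that the mean of
    \<open>h\<close> alone controls its exponential moment.\<close>
  have pw: "exp (l * h x) \<le> 1 + l * exp (l*b) * h x" for x
  proof -
    have "exp u \<le> 1 + u * exp u" for u :: real
    proof -
      have "exp u * (1 - u) \<le> exp u * exp (-u)"
        using exp_ge_add_one_self[of "-u"] by (intro mult_left_mono) auto
      then show ?thesis by (simp add: exp_minus algebra_simps)
    qed
    from this[of "l * h x"] have "exp (l * h x) \<le> 1 + l * h x * exp (l * h x)" .
    also have "\<dots> \<le> 1 + l * h x * exp (l * b)"
      using l hb by (intro add_left_mono mult_left_mono) auto
    finally show ?thesis by (simp add: mult_ac)
  qed
  have "(\<integral>\<^sup>+x. ennreal (exp (l * h x)) \<partial>P) \<le> (\<integral>\<^sup>+x. ennreal (1 + l * exp (l*b) * h x) \<partial>P)"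
    by (intro nn_integral_mono ennreal_leI pw)
  also have "\<dots> = ennreal (\<integral>x. 1 + l * exp (l*b) * h x \<partial>P)"
    using l hb intg by (intro nn_integral_eq_integral) auto
  also have "(\<integral>x. 1 + l * exp (l*b) * h x \<partial>P) = 1 + l * exp (l*b) * (\<integral>x. h x \<partial>P)"
    using intg by (simp add: P.prob_space)
  \<comment> \<open>The bound on the mean is exactly what makes the second summand at most
    1.\<close>
  also have "\<dots> \<le> 2"
    using small l by (simp add: field_simps)
  finally have mgf: "(\<integral>\<^sup>+x. ennreal (exp (l * h x)) \<partial>P) \<le> 2"
    by (simp add: ennreal_leI)
  \<comment> \<open>Chernoff's bound. The choice of \<open>l\<close> gives
    \<open>exp (- l * \<eta> * n) = (1/8) ^ n\<close>, the exponential moment of the sum is at most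
    \<open>2 ^ n\<close>, and together they leave \<open>(1/4) ^ n\<close>.\<close>
  have "emeasure M {\<omega>\<in>space M. (\<Sum>i<n. h (Z i \<omega>)) \<ge> \<eta> * n}
      = emeasure M ({\<omega>\<in>space M. 1 \<le> ennreal ((1/8)^n) * (\<Prod>i<n. ennreal (exp (l * h (Z i \<omega>))))} \<inter> space M)"
  proof (rule arg_cong[where f = "emeasure M"], rule set_eqI)
    fix \<omega>
    have "ennreal ((1/8)^n) * (\<Prod>i<n. ennreal (exp (l * h (Z i \<omega>)))) = ennreal ((1/8)^n * exp (l * (\<Sum>i<n. h (Z i \<omega>))))"
      by (simp add: prod_ennreal exp_sum sum_distrib_left ennreal_mult prod_nonneg)
    moreover have "(1/8::real)^n = exp (- (l * \<eta> * n))"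
    proof -
      have "(1/8::real)^n = exp (- ln 8) ^ n" by (simp add: exp_minus)
      also have "\<dots> = exp (- (ln 8 * n))" by (simp flip: exp_of_nat_mult)
      finally show ?thesis using assms(2) by (simp add: l_def)
    qed
    ultimately have "ennreal ((1/8)^n) * (\<Prod>i<n. ennreal (exp (l * h (Z i \<omega>))))
        = ennreal (exp (l * ((\<Sum>i<n. h (Z i \<omega>)) - \<eta> * n)))"
      by (simp add: algebra_simps flip: exp_add)
    then have "1 \<le> ennreal ((1/8)^n) * (\<Prod>i<n. ennreal (exp (l * h (Z i \<omega>)))) \<longleftrightarrow>
       \<eta> * n \<le> (\<Sum>i<n. h (Z i \<omega>))"
      using l by (simp add: zero_le_mult_iff)
    then show "\<omega> \<in> {\<omega>\<in>space M. (\<Sum>i<n. h (Z i \<omega>)) \<ge> \<eta> * n} \<longleftrightarrow> \<omega> \<in>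
      {\<omega>\<in>space M. 1 \<le> ennreal ((1/8)^n) * (\<Prod>i<n. ennreal (exp (l * h (Z i \<omega>))))} \<inter> space M" by auto
  qed
  also have "\<dots> \<le> ennreal ((1/8)^n) * (\<integral>\<^sup>+\<omega>. (\<Prod>i<n. ennreal (exp (l * h (Z i \<omega>)))) * indicator (space M) \<omega> \<partial>M)"
    by (rule order_trans[OF _ nn_integral_Markov_inequality]) (auto intro!: emeasure_mono)
  also have "(\<integral>\<^sup>+\<omega>. (\<Prod>i<n. ennreal (exp (l * h (Z i \<omega>)))) * indicator (space M) \<omega> \<partial>M)
      = (\<integral>\<^sup>+\<omega>. (\<Prod>i<n. ennreal (exp (l * h (Z i \<omega>)))) \<partial>M)"
    by (rule nn_integral_cong) simp
  also have "\<dots> = (\<integral>\<^sup>+x. ennreal (exp (l * h x)) \<partial>P) ^ n"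
    by (rule nn_integral_prod_iid) auto
  also have "ennreal ((1/8)^n) * \<dots> \<le> ennreal ((1/8)^n) * 2 ^ n"
    by (intro mult_left_mono power_mono mgf) auto
  also have "\<dots> = ennreal ((1/8)^n * 2^n)"
    by (subst ennreal_mult) (auto simp flip: ennreal_power)
  also have "(1/8::real)^n * 2^n = (1/4)^n"
    by (simp flip: power_mult_distrib)
  finally show ?thesis by (simp add: emeasure_eq_measure)
qed

end

text \<open>Makes the law of large numbers and the exponential tail available on the canonical
  sequence space itself.\<close>

lemma iid_seq_coordinates:
  assumes "prob_space Q"
  shows "iid_seq (PiM UNIV (\<lambda>_::nat. Q)) (\<lambda>i x. x i) Q"
proof -
  interpret S: product_prob_space "\<lambda>_::nat. Q" UNIV
    by (intro product_prob_spaceI assms)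
  have c: "distr (PiM UNIV (\<lambda>_::nat. Q)) Q (\<lambda>x. x i) = Q" for i
    using S.PiM_component[of i] by simp
  show ?thesis
  proof unfold_locales
    show "S.indep_vars (\<lambda>_. Q) (\<lambda>i x. x i) UNIV"
      by (subst S.indep_vars_iff_distr_eq_PiM) (auto simp: c restrict_UNIV distr_id2)
  qed (auto simp: c)
qed

section \<open>From Donsker classes to the Glivenko--Cantelli property\<close>

definition outer_gc :: "'x measure \<Rightarrow> ('x \<Rightarrow> real) set \<Rightarrow> bool" where
  "outer_gc Q F \<longleftrightarrow> (\<forall>e>0. osmall (PiM UNIV (\<lambda>_::nat. Q))
     (\<lambda>n. {x. \<exists>f\<in>F. e < \<bar>(\<Sum>i<n. f (x i)) / real n - (\<integral>y. f y \<partial>Q)\<bar>}))"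

lemma lset_bdd_above: "g \<in> lset F \<Longrightarrow> h \<in> lset F \<Longrightarrow> bdd_above ((\<lambda>f. \<bar>g f - h f\<bar>) ` F)"
proof -
  assume "g \<in> lset F" "h \<in> lset F"
  then obtain A B where "\<And>f. f \<in> F \<Longrightarrow> \<bar>g f\<bar> \<le> A" "\<And>f. f \<in> F \<Longrightarrow> \<bar>h f\<bar> \<le> B"
    unfolding lset_def by blast
  then have "\<bar>g f - h f\<bar> \<le> A + B" if "f \<in> F" for f
    using that by (smt (verit))
  then show ?thesis by (rule bdd_aboveI2)
qed

lemma zero_in_lset: "(\<lambda>_. 0) \<in> lset F"
  by (auto simp: lset_def)

lemma supdist_upper: "g \<in> lset F \<Longrightarrow> h \<in> lset F \<Longrightarrow> f \<in> F \<Longrightarrow> \<bar>g f - h f\<bar> \<le> supdist F g h"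
  unfolding supdist_def by (rule cSUP_upper[OF _ lset_bdd_above])

text \<open>Reverse triangle inequality for the supremum norm; it provides the continuity of the
  truncated norm used as test functional.\<close>

lemma supdist_zero_lipschitz:
  assumes F: "F \<noteq> {}" and g: "g \<in> lset F" and h: "h \<in> lset F"
  shows "\<bar>supdist F g (\<lambda>_. 0) - supdist F h (\<lambda>_. 0)\<bar> \<le> supdist F g h"
proof -
  have *: "supdist F a (\<lambda>_. 0) \<le> supdist F b (\<lambda>_. 0) + supdist F g h"
    if "a \<in> lset F" "b \<in> lset F" "\<And>f. f \<in> F \<Longrightarrow> \<bar>a f - b f\<bar> \<le> supdist F g h" for a b
  proof (subst supdist_def, rule cSUP_least[OF F])
    fix f assume f: "f \<in> F"
    show "\<bar>a f - 0\<bar> \<le> supdist F b (\<lambda>_. 0) + supdist F g h"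
      using that(3)[OF f] supdist_upper[OF that(2) zero_in_lset f] by linarith
  qed
  show ?thesis
    using *[OF g h supdist_upper[OF g h]] *[OF h g] supdist_upper[OF g h]
    by (simp add: abs_minus_commute abs_le_iff)
qed

text \<open>Preimages of open sets under a continuous functional are \<open>lopen\<close>, and these
  sets generate \<open>lborel_alg\<close>. Weak convergence may thus be applied to every continuous
  bounded functional.\<close>

lemma lbcont_measurable:
  assumes "lbcont F h" "space L = lset F" "sets L = sets (lborel_alg F)"
  shows "h \<in> borel_measurable L"
proof (rule borel_measurableI)
  fix S :: "real set" assume S: "open S"
  have "lopen F (h -` S \<inter> lset F)"
    unfolding lopen_def
  proof (intro conjI ballI)
    fix g assume g: "g \<in> h -` S \<inter> lset F"
    then obtain e where e: "e > 0" "ball (h g) e \<subseteq> S"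
      using S openE by blast
    obtain d where "d > 0" "\<forall>g'\<in>lset F. supdist F g g' < d \<longrightarrow> \<bar>h g - h g'\<bar> < e"
      using assms(1) g e(1) unfolding lbcont_def by blast
    with e show "\<exists>e>0. \<forall>h'\<in>lset F. supdist F g h' < e \<longrightarrow> h' \<in> h -` S \<inter> lset F"
      by (intro exI[of _ d]) (auto simp: dist_real_def)
  qed simp
  then have "h -` S \<inter> lset F \<in> sets (sigma (lset F) {U. lopen F U})"
    by (subst sets_measure_of) (auto simp: lopen_def)
  then show "h -` S \<inter> space L \<in> sets L"
    using assms(2,3) by (simp add: lborel_alg_def)
qed

text \<open>A deviation \<open>e\<close> of the means is a deviation \<open>sqrt n * e\<close> of
  the empirical process. The limit law lives on bounded functions, so it gives little mass to norms
  beyond a large \<open>K\<close>; by weak convergence the empirical process does so too, in outer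
  expectation, while \<open>sqrt n * e\<close> eventually passes \<open>K + 1\<close>.\<close>

lemma donsker_outer_gc:
  fixes F :: "('x \<Rightarrow> real) set"
  assumes Q: "prob_space Q" and D: "donsker Q F" and bd: "unif_bounded F"
  shows "outer_gc Q F"
proof (cases "F = {}")
  case True
  then show ?thesis
    by (auto simp: outer_gc_def osmall_def intro!: always_eventually bexI[of _ "{}"])
next
  case F: False
  define \<Omega> where "\<Omega> = PiM UNIV (\<lambda>_::nat. Q)"
  interpret Q: prob_space Q by fact
  interpret S: product_prob_space "\<lambda>_::nat. Q" UNIV
    by (intro product_prob_spaceI Q)
  interpret \<Omega>: prob_space \<Omega> unfolding \<Omega>_def by (rule S.P.prob_space_axioms)
  obtain L where L: "prob_space L" "space L = lset F" "sets L = sets (lborel_alg F)" and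
    wc: "\<And>h. lbcont F h \<Longrightarrow> h \<in> borel_measurable L \<Longrightarrow>
       (\<lambda>n. outer_exp \<Omega> (\<lambda>\<omega>. h (emp_proc Q F n \<omega>))) \<longlonglongrightarrow> (\<integral>g. h g \<partial>L)"
    using D unfolding donsker_def \<Omega>_def by blast
  interpret L: prob_space L by fact
  define N where "N g = supdist F g (\<lambda>_. 0)" for g
  \<comment> \<open>A ramp in the norm: 0 up to \<open>K\<close>, 1 from \<open>K + 1\<close> on. It
    is a continuous substitute for the indicator of a large norm, which weak convergence could not
    test directly.\<close>
  define h where "h K g = min 1 (max 0 (N g - real K))" for K :: nat and g
  have h01: "0 \<le> h K g" "h K g \<le> 1" for K g by (auto simp: h_def)
  have hc: "lbcont F (h K)" for K
    unfolding lbcont_def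
  proof (intro conjI ballI allI impI)
    show "\<exists>B. \<forall>g\<in>lset F. \<bar>h K g\<bar> \<le> B"
      using h01 by (intro exI[of _ 1]) (auto simp: abs_le_iff intro: order_trans[OF _ h01(1)])
    fix g and e :: real assume "g \<in> lset F" "e > 0"
    have "\<bar>h K g - h K g'\<bar> < e" if "g' \<in> lset F" "supdist F g g' < e" for g'
      using supdist_zero_lipschitz[OF F \<open>g \<in> lset F\<close> that(1)] that(2)
      by (auto simp: h_def N_def)
    with \<open>e > 0\<close> show "\<exists>\<delta>>0. \<forall>g'\<in>lset F. supdist F g g' < \<delta> \<longrightarrow> \<bar>h K g - h K g'\<bar> < e"
      by blast
  qed
  have hm: "h K \<in> borel_measurable L" for K
    by (rule lbcont_measurable[OF hc L(2,3)])
  have "(\<lambda>K. \<integral>g. h K g \<partial>L) \<longlonglongrightarrow> (\<integral>g. 0 \<partial>L)"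
  proof (rule integral_dominated_convergence[where w = "\<lambda>_. 1"])
    show "AE g in L. (\<lambda>K. h K g) \<longlonglongrightarrow> 0"
    proof (intro AE_I2)
      fix g
      obtain K0 where "N g \<le> real K0" using real_arch_simple by blast
      then have "\<forall>\<^sub>F K in sequentially. h K g = 0"
        by (intro eventually_mono[OF eventually_ge_at_top[of K0]]) (auto simp: h_def)
      then show "(\<lambda>K. h K g) \<longlonglongrightarrow> 0" by (rule tendsto_eventually)
    qed
  qed (use hm h01 in auto)
  then have hlim: "(\<lambda>K. \<integral>g. h K g \<partial>L) \<longlonglongrightarrow> 0" by simp
  obtain B where B: "\<And>f x. f \<in> F \<Longrightarrow> \<bar>f x\<bar> \<le> B" using bd unfolding unif_bounded_def by blast
  have emp: "emp_proc Q F n x \<in> lset F" for n x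
  proof -
    have "\<bar>emp_proc Q F n x f\<bar> \<le> sqrt (real n) * (B + B)" if f: "f \<in> F" for f
    proof -
      have "B \<ge> 0" using B[OF f, of undefined] by linarith
      have "\<bar>\<Sum>i<n. f (x i)\<bar> \<le> (\<Sum>i<n. B)"
        by (rule order_trans[OF sum_abs sum_mono]) (use B f in auto)
      then have "\<bar>(\<Sum>i<n. f (x i)) / real n\<bar> \<le> B"
        using \<open>B \<ge> 0\<close> by (cases "n = 0") (auto simp: field_simps)
      moreover have "\<bar>\<integral>y. f y \<partial>Q\<bar> \<le> B"
      proof -
        have "integrable Q f" using D f unfolding donsker_def by blast
        then have "(\<integral>y. \<bar>f y\<bar> \<partial>Q) \<le> B"
          using B[OF f] by (intro Q.integral_le_const integrable_abs) auto
        with integral_abs_bound[of Q f] show ?thesis by linarith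
      qed
      ultimately have "\<bar>(\<Sum>i<n. f (x i)) / real n - (\<integral>y. f y \<partial>Q)\<bar> \<le> B + B" by linarith
      then show ?thesis using f by (simp add: emp_proc_def abs_mult mult_left_mono)
    qed
    then show ?thesis by (auto simp: lset_def emp_proc_def)
  qed
  show ?thesis unfolding outer_gc_def \<Omega>_def[symmetric] osmall_def
  proof (intro allI impI)
    fix e \<epsilon> :: real assume "e > 0" "\<epsilon> > 0"
    then obtain K where K: "(\<integral>g. h K g \<partial>L) < \<epsilon>"
      using eventually_happens'[OF sequentially_bot order_tendstoD(2)[OF hlim, of \<epsilon>]] by blast
    have ev1: "\<forall>\<^sub>F n in sequentially. outer_exp \<Omega> (\<lambda>\<omega>. h K (emp_proc Q F n \<omega>)) < \<epsilon>"
      by (rule order_tendstoD(2)[OF wc[OF hc hm] K])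
    have "filterlim (\<lambda>n. sqrt (real n)) at_top sequentially"
      by (rule filterlim_compose[OF sqrt_at_top filterlim_real_sequentially])
    then have ev2: "\<forall>\<^sub>F n in sequentially. sqrt (real n) \<ge> (real K + 1) / e"
      by (simp add: filterlim_at_top)
    show "\<forall>\<^sub>F n in sequentially. \<exists>A\<in>sets \<Omega>. measure \<Omega> A \<le> \<epsilon> \<and>
       {x. \<exists>f\<in>F. e < \<bar>(\<Sum>i<n. f (x i)) / real n - (\<integral>y. f y \<partial>Q)\<bar>} \<inter> space \<Omega> \<subseteq> A"
      using ev1 ev2
    proof eventually_elim
      case (elim n)
      let ?S = "{(\<integral>\<omega>. U \<omega> \<partial>\<Omega>) | U. U \<in> borel_measurable \<Omega> \<and> integrable \<Omega> U \<and>
                   (\<forall>\<omega>\<in>space \<Omega>. h K (emp_proc Q F n \<omega>) \<le> U \<omega>)}"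
      \<comment> \<open>The constant 1 is an integrable majorant; the set being nonempty, a bound on
        its infimum yields an actual majorant \<open>U\<close>.\<close>
      have "(\<integral>\<omega>. 1 \<partial>\<Omega>) \<in> ?S"
        using h01 by (intro CollectI exI[of _ "\<lambda>_. 1"]) auto
      then have "?S \<noteq> {}" by blast
      moreover have "Inf ?S < \<epsilon>" using elim(1) by (simp add: outer_exp_def)
      ultimately obtain U where U: "U \<in> borel_measurable \<Omega>" "integrable \<Omega> U"
        "\<And>\<omega>. \<omega> \<in> space \<Omega> \<Longrightarrow> h K (emp_proc Q F n \<omega>) \<le> U \<omega>" "(\<integral>\<omega>. U \<omega> \<partial>\<Omega>) < \<epsilon>"
        using cInf_lessD[of ?S \<epsilon>] by blast
      have Upos: "0 \<le> U x" if "x \<in> space \<Omega>" for x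
        using h01(1) U(3)[OF that] by (rule order_trans)
      \<comment> \<open>Markov's inequality is applied to the measurable majorant \<open>U\<close>,
        since the functional of the empirical process need not be measurable. The set where
        \<open>U\<close> reaches 1 is the required cover.\<close>
      have "measure \<Omega> {x\<in>space \<Omega>. 1 \<le> U x} \<le> (\<integral>\<omega>. U \<omega> \<partial>\<Omega>) / 1"
        by (rule integral_Markov_inequality_measure[where A = "{}"]) (use U Upos in auto)
      moreover have "1 \<le> U x" if x: "x \<in> space \<Omega>" and f: "f \<in> F"
        and dev: "e < \<bar>(\<Sum>i<n. f (x i)) / real n - (\<integral>y. f y \<partial>Q)\<bar>" for x f
      proof -
        have "real K + 1 \<le> sqrt (real n) * e"
          using elim(2) \<open>e > 0\<close> by (simp add: field_simps)
        also have "\<dots> \<le> sqrt (real n) * \<bar>(\<Sum>i<n. f (x i)) / real n - (\<integral>y. f y \<partial>Q)\<bar>"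
          using dev by (intro mult_left_mono) auto
        also have "\<dots> = \<bar>emp_proc Q F n x f - 0\<bar>"
          using f by (simp add: emp_proc_def abs_mult)
        also have "\<dots> \<le> N (emp_proc Q F n x)"
          unfolding N_def by (rule supdist_upper[OF emp zero_in_lset f])
        finally have "h K (emp_proc Q F n x) = 1" by (simp add: h_def)
        then show ?thesis using U(3)[OF x] by simp
      qed
      ultimately show ?case using U
        by (intro bexI[of _ "{x\<in>space \<Omega>. 1 \<le> U x}"]) auto
    qed
  qed
qed

section \<open>Resampling a part of the sample\<close>

definition merge_seq :: "nat set \<Rightarrow> (nat \<Rightarrow> 'x) \<Rightarrow> (nat \<Rightarrow> 'x) \<Rightarrow> nat \<Rightarrow> 'x" where
  "merge_seq I x y = (\<lambda>i. if i \<in> I then x i else y i)"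

lemma merge_seq_apply [simp]:
  "i \<in> I \<Longrightarrow> merge_seq I x y i = x i" "i \<notin> I \<Longrightarrow> merge_seq I x y i = y i"
  by (auto simp: merge_seq_def)

lemma merge_seq_merge_seq [simp]: "merge_seq I (merge_seq I x y) z = merge_seq I x z"
  by (auto simp: merge_seq_def)

context
  fixes Q :: "'x measure" and \<Omega> :: "(nat \<Rightarrow> 'x) measure"
  assumes Q: "prob_space Q"
  defines "\<Omega> \<equiv> PiM UNIV (\<lambda>_::nat. Q)"
begin

lemma prob_space_sequences: "prob_space \<Omega>"
  unfolding \<Omega>_def by (intro prob_space_PiM Q)

lemma merge_seq_measurable [measurable]: "(\<lambda>(x, y). merge_seq I x y) \<in> measurable (\<Omega> \<Otimes>\<^sub>M \<Omega>) \<Omega>"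
  unfolding \<Omega>_def
proof (rule measurable_PiM_single')
  fix i :: nat
  have 1: "(\<lambda>\<omega>. fst \<omega> i) \<in> measurable (PiM UNIV (\<lambda>_. Q) \<Otimes>\<^sub>M PiM UNIV (\<lambda>_. Q)) Q"
    by (rule measurable_compose[OF measurable_fst measurable_component_singleton]) simp
  have 2: "(\<lambda>\<omega>. snd \<omega> i) \<in> measurable (PiM UNIV (\<lambda>_. Q) \<Otimes>\<^sub>M PiM UNIV (\<lambda>_. Q)) Q"
    by (rule measurable_compose[OF measurable_snd measurable_component_singleton]) simp
  show "(\<lambda>\<omega>. (case \<omega> of (x, y) \<Rightarrow> merge_seq I x y) i)
      \<in> measurable (PiM UNIV (\<lambda>_. Q) \<Otimes>\<^sub>M PiM UNIV (\<lambda>_. Q)) Q"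
    using 1 2 by (cases "i \<in> I") (simp_all add: case_prod_unfold)
next
  show "(\<lambda>\<omega>. case \<omega> of (x, y) \<Rightarrow> merge_seq I x y)
      \<in> space (PiM UNIV (\<lambda>_. Q) \<Otimes>\<^sub>M PiM UNIV (\<lambda>_. Q)) \<rightarrow> (\<Pi>\<^sub>E i\<in>UNIV. space Q)"
    by (auto simp: space_PiM space_pair_measure merge_seq_def PiE_iff)
qed

text \<open>Each coordinate is taken from exactly one of two independent copies. Hence a cylinder
  over \<open>J\<close> pulls back to the rectangle of a cylinder over \<open>J \<inter> I\<close>
  and one over \<open>J - I\<close>, and the product of their probabilities is the old one.\<close>

lemma distr_merge_seq: "distr (\<Omega> \<Otimes>\<^sub>M \<Omega>) \<Omega> (\<lambda>(x, y). merge_seq I x y) = \<Omega>"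
proof -
  interpret S: product_prob_space "\<lambda>_::nat. Q" UNIV
    by (intro product_prob_spaceI Q)
  interpret W: prob_space \<Omega> by (rule prob_space_sequences)
  interpret W2: pair_prob_space \<Omega> \<Omega> ..
  have "distr (\<Omega> \<Otimes>\<^sub>M \<Omega>) \<Omega> (\<lambda>(x, y). merge_seq I x y) = PiM UNIV (\<lambda>_. Q)"
  proof (rule S.PiM_eq)
    fix J :: "nat set" and F assume J: "finite J" "\<And>j. j \<in> J \<Longrightarrow> F j \<in> sets Q"
    let ?E = "\<lambda>K. prod_emb UNIV (\<lambda>_. Q) K (Pi\<^sub>E K F)"
    have E: "?E K \<in> sets \<Omega>" "emeasure \<Omega> (?E K) = (\<Prod>j\<in>K. emeasure Q (F j))" if "K \<subseteq> J" for K
    proof -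
      have K: "finite K" "\<And>j. j \<in> K \<Longrightarrow> F j \<in> sets Q"
        using that J finite_subset by blast+
      then show "?E K \<in> sets \<Omega>" unfolding \<Omega>_def by (intro sets_PiM_I) auto
      show "emeasure \<Omega> (?E K) = (\<Prod>j\<in>K. emeasure Q (F j))"
        unfolding \<Omega>_def using K by (intro S.emeasure_PiM_emb) auto
    qed
    have mem_E: "x \<in> ?E K \<longleftrightarrow> (\<forall>i. x i \<in> space Q) \<and> (\<forall>j\<in>K. x j \<in> F j)" for x K
      by (auto simp: prod_emb_def space_PiM PiE_iff)
    have mem_pair: "(x, y) \<in> space (\<Omega> \<Otimes>\<^sub>M \<Omega>) \<longleftrightarrow> (\<forall>i. x i \<in> space Q) \<and> (\<forall>i. y i \<in> space Q)" for x y
      unfolding \<Omega>_def by (auto simp: space_pair_measure space_PiM PiE_iff)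
    have "(\<lambda>(x, y). merge_seq I x y) -` ?E J \<inter> space (\<Omega> \<Otimes>\<^sub>M \<Omega>) = ?E (J \<inter> I) \<times> ?E (J - I)"
    proof (rule set_eqI)
      fix w :: "(nat \<Rightarrow> 'x) \<times> (nat \<Rightarrow> 'x)"
      obtain x y where w: "w = (x, y)" by force
      show "w \<in> (\<lambda>(x, y). merge_seq I x y) -` ?E J \<inter> space (\<Omega> \<Otimes>\<^sub>M \<Omega>) \<longleftrightarrow> w \<in> ?E (J \<inter> I) \<times> ?E (J - I)"
        unfolding w by (simp only: vimage_eq Int_iff mem_Sigma_iff prod.case mem_E mem_pair)
          (auto simp: merge_seq_def)
    qed
    then have "emeasure (distr (\<Omega> \<Otimes>\<^sub>M \<Omega>) \<Omega> (\<lambda>(x, y). merge_seq I x y)) (?E J)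
        = emeasure (\<Omega> \<Otimes>\<^sub>M \<Omega>) (?E (J \<inter> I) \<times> ?E (J - I))"
      using E[of J] by (simp add: emeasure_distr)
    also have "\<dots> = (\<Prod>j\<in>J \<inter> I. emeasure Q (F j)) * (\<Prod>j\<in>J - I. emeasure Q (F j))"
      using E[of "J \<inter> I"] E[of "J - I"] by (subst W.emeasure_pair_measure_Times) auto
    also have "\<dots> = (\<Prod>j\<in>J. emeasure Q (F j))"
      using J(1) by (subst prod.union_disjoint[symmetric]) (auto intro!: prod.cong)
    finally show "emeasure (distr (\<Omega> \<Otimes>\<^sub>M \<Omega>) \<Omega> (\<lambda>(x, y). merge_seq I x y)) (?E J) = \<dots>" .
  qed (simp add: \<Omega>_def)
  then show ?thesis by (simp add: \<Omega>_def)
qed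

text \<open>\<open>H\<close> collects the samples that land in \<open>C\<close> after resampling, up
  to probability \<open>t\<close>. Since a merged sample has the same law as \<open>x\<close>, the
  probability of \<open>H - C\<close> is that of the merged sample being in \<open>H\<close> but
  outside \<open>C\<close>, and by Fubini this is at most \<open>t\<close>.\<close>

lemma resampling_excess:
  fixes I :: "nat set" and t :: real
  assumes C [measurable]: "C \<in> sets \<Omega>" and t: "t \<ge> 0"
  defines "H \<equiv> {x\<in>space \<Omega>. measure \<Omega> {y\<in>space \<Omega>. merge_seq I x y \<notin> C} \<le> t}"
  shows "H \<in> sets \<Omega>" "measure \<Omega> (H - C) \<le> t"
proof -
  interpret W: prob_space \<Omega> by (rule prob_space_sequences)
  interpret W2: pair_prob_space \<Omega> \<Omega> ..
  have [measurable]: "(\<lambda>x. measure \<Omega> {y\<in>space \<Omega>. merge_seq I x y \<notin> C}) \<in> borel_measurable \<Omega>"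
    by (rule W.measurable_measure) measurable
  show H [measurable]: "H \<in> sets \<Omega>" unfolding H_def by measurable
  have mem: "merge_seq I x y \<in> space \<Omega>" if "x \<in> space \<Omega>" "y \<in> space \<Omega>" for x y
    using that unfolding \<Omega>_def by (auto simp: space_PiM merge_seq_def PiE_iff)
  \<comment> \<open>Membership in \<open>H\<close> depends only on the coordinates in
    \<open>I\<close>, because a second merge overwrites everything else; resampling therefore cannot
    leave or enter \<open>H\<close>.\<close>
  have Hinv: "merge_seq I x y \<in> H \<longleftrightarrow> x \<in> H" if "x \<in> space \<Omega>" "y \<in> space \<Omega>" for x y
    using that mem[OF that] by (simp add: H_def)
  have "emeasure \<Omega> (H - C) = emeasure (distr (\<Omega> \<Otimes>\<^sub>M \<Omega>) \<Omega> (\<lambda>(x, y). merge_seq I x y)) (H - C)"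
    by (simp add: distr_merge_seq)
  also have "\<dots> = emeasure (\<Omega> \<Otimes>\<^sub>M \<Omega>) ((\<lambda>(x, y). merge_seq I x y) -` (H - C) \<inter> space (\<Omega> \<Otimes>\<^sub>M \<Omega>))"
    by (rule emeasure_distr) measurable
  also have "\<dots> = (\<integral>\<^sup>+x. emeasure \<Omega> (Pair x -` ((\<lambda>(x, y). merge_seq I x y) -` (H - C) \<inter> space (\<Omega> \<Otimes>\<^sub>M \<Omega>))) \<partial>\<Omega>)"
    by (rule W.emeasure_pair_measure_alt) measurable
  also have "\<dots> \<le> (\<integral>\<^sup>+x. ennreal t \<partial>\<Omega>)"
  proof (rule nn_integral_mono)
    fix x assume x: "x \<in> space \<Omega>"
    have eq: "Pair x -` ((\<lambda>(x, y). merge_seq I x y) -` (H - C) \<inter> space (\<Omega> \<Otimes>\<^sub>M \<Omega>))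
       = (if x \<in> H then {y\<in>space \<Omega>. merge_seq I x y \<notin> C} else {})"
      using x Hinv by (auto simp: space_pair_measure)
    show "emeasure \<Omega> (Pair x -` ((\<lambda>(x, y). merge_seq I x y) -` (H - C) \<inter> space (\<Omega> \<Otimes>\<^sub>M \<Omega>))) \<le> ennreal t"
      unfolding eq using t by (auto simp: H_def W.emeasure_eq_measure ennreal_leI)
  qed
  also have "\<dots> = ennreal t" by (simp add: W.emeasure_space_1)
  finally show "measure \<Omega> (H - C) \<le> t" using t by (simp add: W.emeasure_eq_measure)
qed

text \<open>The sup over \<open>f\<close> and the choice of mask are both hidden in the inclusion of
  the bad event in finitely many sets \<open>H I\<close>. Each of these is defined through
  \<open>C\<close> alone, without reference to the class, hence is measurable.\<close>

lemma gc_local_absolute: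
  fixes F :: "('x \<Rightarrow> real) set" and g :: "'x \<Rightarrow> real" and B \<eta> :: real
  assumes gc: "outer_gc Q F" and Fm: "\<And>f. f \<in> F \<Longrightarrow> f \<in> borel_measurable Q"
    and FB: "\<And>f x. f \<in> F \<Longrightarrow> \<bar>f x\<bar> \<le> B"
    and g [measurable]: "g \<in> borel_measurable Q" and gB: "\<And>x. \<bar>g x\<bar> \<le> B" and "\<eta> > 0"
  obtains \<delta> where "\<delta> > 0" "osmall \<Omega> (\<lambda>n. {x. \<exists>f\<in>F. (\<integral>y. \<bar>f y - g y\<bar> \<partial>Q) \<le> \<delta> \<and>
     \<eta> < (\<Sum>i<n. \<bar>f (x i) - g (x i)\<bar>) / real n})"
proof -
  interpret W: prob_space \<Omega> by (rule prob_space_sequences)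
  interpret Q: prob_space Q by fact
  interpret iid: iid_seq \<Omega> "\<lambda>i x. x i" Q
    unfolding \<Omega>_def by (rule iid_seq_coordinates[OF Q])
  define b where "b = 2 * \<bar>B\<bar> + 1"
  have b: "b > 0" by (simp add: b_def)
  \<comment> \<open>Half of the excess is \<open>6 * \<theta> * n\<close>. Off the exceptional set
    the merged sum of \<open>f - g\<close> is at most \<open>3 * \<theta> * n\<close> (deviation of
    \<open>f\<close>, deviation of \<open>g\<close>, difference of means) and the fresh points
    contribute less than \<open>2 * \<theta> * n\<close>; five is less than six.\<close>
  define \<theta> where "\<theta> = \<eta> / 12"
  have \<theta>: "\<theta> > 0" using \<open>\<eta> > 0\<close> by (simp add: \<theta>_def)
  define l where "l = ln 8 / (2 * \<theta>)"
  have l: "l > 0" using \<theta> by (simp add: l_def)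
  \<comment> \<open>The first bound keeps the difference of the means below \<theta>, the second is
    the hypothesis of the exponential tail at level \<open>2 * \<theta>\<close>.\<close>
  define \<delta> where "\<delta> = min \<theta> (1 / (l * exp (l * b)))"
  have \<delta>: "\<delta> > 0" using \<theta> l by (simp add: \<delta>_def)
  define G where "G n = {x. \<exists>f\<in>F. \<theta> < \<bar>(\<Sum>i<n. f (x i)) / real n - (\<integral>y. f y \<partial>Q)\<bar>}
     \<union> {x. \<theta> < \<bar>(\<Sum>i<n. g (x i)) / real n - (\<integral>y. g y \<partial>Q)\<bar>}" for n
  have G: "osmall \<Omega> G"
    unfolding G_def
  proof (rule W.osmall_Un)
    show "osmall \<Omega> (\<lambda>n. {x. \<exists>f\<in>F. \<theta> < \<bar>(\<Sum>i<n. f (x i)) / real n - (\<integral>y. f y \<partial>Q)\<bar>})"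
      using gc \<theta> unfolding outer_gc_def \<Omega>_def by blast
    have "vop \<Omega> (\<lambda>n x. (\<Sum>i<n. g (x i)) / real n - (\<integral>y. g y \<partial>Q))"
      using iid.lln_bounded[of g B] gB by simp
    then show "osmall \<Omega> (\<lambda>n. {x. \<theta> < \<bar>(\<Sum>i<n. g (x i)) / real n - (\<integral>y. g y \<partial>Q)\<bar>})"
      using \<theta> unfolding vop_def by blast
  qed
  define V where "V n = {x. \<exists>f\<in>F. (\<integral>y. \<bar>f y - g y\<bar> \<partial>Q) \<le> \<delta> \<and>
     \<eta> < (\<Sum>i<n. \<bar>f (x i) - g (x i)\<bar>) / real n}" for n
  have "osmall \<Omega> V"
    unfolding osmall_def
  proof (intro allI impI)
    fix \<epsilon> :: real assume "\<epsilon> > 0"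
    then have "\<epsilon>/2 > 0" by simp
    have "(\<lambda>n. (1/2::real) ^ n) \<longlonglongrightarrow> 0" by (rule LIMSEQ_power_zero) simp
    then have "\<forall>\<^sub>F n in sequentially. (1/2::real) ^ n < \<epsilon>/2"
      by (rule order_tendstoD(2)) fact
    with osmallD[OF G \<open>\<epsilon>/2 > 0\<close>] eventually_gt_at_top[of 0]
    show "\<forall>\<^sub>F n in sequentially. \<exists>A\<in>sets \<Omega>. measure \<Omega> A \<le> \<epsilon> \<and> V n \<inter> space \<Omega> \<subseteq> A"
    proof eventually_elim
      case (elim n)
      then obtain C where C [measurable]: "C \<in> sets \<Omega>" and C': "measure \<Omega> C \<le> \<epsilon>/2" "G n \<inter> space \<Omega> \<subseteq> C"
        by blast
      have n: "n > 0" using elim by simp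
      define H where "H I = {x\<in>space \<Omega>. measure \<Omega> {y\<in>space \<Omega>. merge_seq I x y \<notin> C} \<le> (1/4)^n}" for I
      have H: "H I \<in> sets \<Omega>" "measure \<Omega> (H I - C) \<le> (1/4)^n" for I
        unfolding H_def by (rule resampling_excess[OF C]; simp)+
      \<comment> \<open>Union over all masks: \<open>2 ^ n\<close> sets of measure at most
        \<open>(1/4) ^ n\<close> each add up to at most \<open>(1/2) ^ n\<close>.\<close>
      define A where "A = C \<union> (\<Union>I\<in>Pow {..<n}. H I - C)"
      have "measure \<Omega> (\<Union>I\<in>Pow {..<n}. H I - C) \<le> (\<Sum>I\<in>Pow {..<n}. measure \<Omega> (H I - C))"
        using H(1) by (intro W.finite_measure_subadditive_finite) auto
      also have "\<dots> \<le> (\<Sum>I\<in>Pow {..<n}. (1/4)^n)"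
        by (intro sum_mono H)
      also have "\<dots> = (1/2)^n"
        by (simp add: card_Pow flip: power_mult_distrib)
      finally have "measure \<Omega> (\<Union>I\<in>Pow {..<n}. H I - C) \<le> \<epsilon>/2" using elim by simp
      moreover have "measure \<Omega> A \<le> measure \<Omega> C + measure \<Omega> (\<Union>I\<in>Pow {..<n}. H I - C)"
        unfolding A_def using H(1) by (intro measure_Un_le C sets.finite_UN sets.Diff) auto
      ultimately have "measure \<Omega> A \<le> \<epsilon>" using C'(1) by linarith
      moreover have "A \<in> sets \<Omega>" unfolding A_def using H(1) by (intro sets.Un sets.finite_UN sets.Diff C) auto
      moreover have "V n \<inter> space \<Omega> \<subseteq> A"
      proof
        fix x assume "x \<in> V n \<inter> space \<Omega>"
        then obtain f where x: "x \<in> space \<Omega>" and f: "f \<in> F" and fd: "(\<integral>y. \<bar>f y - g y\<bar> \<partial>Q) \<le> \<delta>"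
          and big: "\<eta> < (\<Sum>i<n. \<bar>f (x i) - g (x i)\<bar>) / real n"
          unfolding V_def by blast
        note [measurable] = Fm[OF f]
        define d where "d y = f y - g y" for y
        have [measurable]: "d \<in> borel_measurable Q" unfolding d_def by measurable
        have db: "\<bar>d y\<bar> \<le> b" for y
          using FB[OF f, of y] gB[of y] by (auto simp: d_def b_def)
        have big': "\<eta> * n < (\<Sum>i<n. \<bar>d (x i)\<bar>)"
          using big n by (simp add: d_def field_simps)
        \<comment> \<open>The absolute sum splits into the points with \<open>d \<ge> 0\<close> and
          those with \<open>d < 0\<close>; one of the two carries at least half, and no cancellation
          occurs inside it.\<close>
        have "\<exists>I\<subseteq>{..<n}. \<eta> * n / 2 \<le> \<bar>\<Sum>i\<in>I. d (x i)\<bar>"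
        proof -
          let ?I = "{i\<in>{..<n}. d (x i) \<ge> 0}" and ?J = "{i\<in>{..<n}. d (x i) < 0}"
          have "(\<Sum>i<n. \<bar>d (x i)\<bar>) = (\<Sum>i\<in>?I. \<bar>d (x i)\<bar>) + (\<Sum>i\<in>?J. \<bar>d (x i)\<bar>)"
            by (subst sum.union_disjoint[symmetric]) (auto intro!: sum.cong)
          moreover have "(\<Sum>i\<in>?I. \<bar>d (x i)\<bar>) = (\<Sum>i\<in>?I. d (x i))" by (rule sum.cong) auto
          moreover have "(\<Sum>i\<in>?J. \<bar>d (x i)\<bar>) = - (\<Sum>i\<in>?J. d (x i))"
            by (subst sum_negf[symmetric], rule sum.cong) auto
          ultimately have "\<eta> * n / 2 \<le> \<bar>\<Sum>i\<in>?I. d (x i)\<bar> \<or> \<eta> * n / 2 \<le> \<bar>\<Sum>i\<in>?J. d (x i)\<bar>"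
            using big' by linarith
          then show ?thesis
          proof
            assume "\<eta> * n / 2 \<le> \<bar>\<Sum>i\<in>?I. d (x i)\<bar>"
            then show ?thesis by (intro exI[of _ ?I] conjI) auto
          next
            assume "\<eta> * n / 2 \<le> \<bar>\<Sum>i\<in>?J. d (x i)\<bar>"
            then show ?thesis by (intro exI[of _ ?J] conjI) auto
          qed
        qed
        then obtain I where I: "I \<subseteq> {..<n}" "\<eta> * n / 2 \<le> \<bar>\<Sum>i\<in>I. d (x i)\<bar>" by blast
        \<comment> \<open>Here \<open>f\<close> was picked from \<open>x\<close>, but the
          probability is over the independent \<open>y\<close> only, so a bound for one fixed
          function suffices.\<close>
        have tail: "measure \<Omega> {y\<in>space \<Omega>. (\<Sum>i<n. \<bar>d (y i)\<bar>) \<ge> 2 * \<theta> * n} \<le> (1/4)^n"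
        proof (rule iid.exponential_tail[where b = b])
          show "(\<integral>y. \<bar>d y\<bar> \<partial>Q) \<le> 1 / (ln 8 / (2 * \<theta>) * exp (ln 8 / (2 * \<theta>) * b))"
            using fd by (simp add: d_def \<delta>_def l_def)
        qed (use b db \<theta> in auto)
        \<comment> \<open>If the merged sample misses \<open>C\<close>, its sum of
          \<open>f - g\<close> is small although the kept points contribute a large amount; only a
          large contribution of the fresh points can compensate for it.\<close>
        have "{y\<in>space \<Omega>. merge_seq I x y \<notin> C} \<subseteq> {y\<in>space \<Omega>. (\<Sum>i<n. \<bar>d (y i)\<bar>) \<ge> 2 * \<theta> * n}"
        proof safe
          fix y assume y: "y \<in> space \<Omega>" and nC: "merge_seq I x y \<notin> C"
          let ?z = "merge_seq I x y"
          show "(\<Sum>i<n. \<bar>d (y i)\<bar>) \<ge> 2 * \<theta> * n"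
          proof (rule ccontr)
            assume "\<not> ?thesis"
            then have small: "(\<Sum>i<n. \<bar>d (y i)\<bar>) < 2 * \<theta> * n" by simp
            have zs: "?z \<in> space \<Omega>" using x y unfolding \<Omega>_def by (auto simp: space_PiM merge_seq_def PiE_iff)
            with nC C'(2) have nG: "?z \<notin> G n" by blast
            have fi: "\<bar>(\<Sum>i<n. f (?z i)) / real n - (\<integral>y. f y \<partial>Q)\<bar> \<le> \<theta>"
              using nG f unfolding G_def by force
            have gi: "\<bar>(\<Sum>i<n. g (?z i)) / real n - (\<integral>y. g y \<partial>Q)\<bar> \<le> \<theta>"
              using nG unfolding G_def by force
            have int: "integrable Q f" "integrable Q g"
              by (rule Q.integrable_const_bound[of _ B]; use FB f gB in auto)+
            then have "\<bar>(\<integral>y. f y \<partial>Q) - (\<integral>y. g y \<partial>Q)\<bar> = \<bar>\<integral>y. d y \<partial>Q\<bar>"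
              by (simp add: d_def)
            also have "\<dots> \<le> \<theta>"
              by (rule order_trans[OF integral_abs_bound]) (use fd in \<open>simp add: d_def \<delta>_def\<close>)
            finally have mean: "\<bar>(\<integral>y. f y \<partial>Q) - (\<integral>y. g y \<partial>Q)\<bar> \<le> \<theta>" .
            have "(\<Sum>i<n. d (?z i)) / real n = (\<Sum>i<n. f (?z i)) / real n - (\<Sum>i<n. g (?z i)) / real n"
              by (simp add: d_def sum_subtractf diff_divide_distrib)
            with fi gi mean have "\<bar>(\<Sum>i<n. d (?z i)) / real n\<bar> \<le> 3 * \<theta>" by linarith
            then have "\<bar>\<Sum>i<n. d (?z i)\<bar> \<le> 3 * \<theta> * n" using n by (simp add: field_simps)
            moreover have "(\<Sum>i<n. d (?z i)) = (\<Sum>i\<in>I. d (x i)) + (\<Sum>i\<in>{..<n} - I. d (y i))"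
              using I(1) by (subst sum.subset_diff[of I "{..<n}"]) auto
            moreover have "\<bar>\<Sum>i\<in>{..<n} - I. d (y i)\<bar> \<le> (\<Sum>i<n. \<bar>d (y i)\<bar>)"
              by (rule order_trans[OF sum_abs sum_mono2]) auto
            ultimately have "\<bar>\<Sum>i\<in>I. d (x i)\<bar> < 5 * \<theta> * n" using small by linarith
            moreover have "\<eta> * n / 2 = 6 * \<theta> * n" by (simp add: \<theta>_def)
            moreover have "5 * \<theta> * n < 6 * \<theta> * n" using \<theta> n by simp
            ultimately show False using I(2) by linarith
          qed
        qed
        then have "measure \<Omega> {y\<in>space \<Omega>. merge_seq I x y \<notin> C} \<le> (1/4)^n"
          by (intro order_trans[OF W.finite_measure_mono tail]) auto
        then have "x \<in> H I" using x by (simp add: H_def)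
        with I(1) show "x \<in> A" unfolding A_def by blast
      qed
      ultimately show ?case by blast
    qed
  qed
  with \<delta> show thesis by (intro that) (auto simp: V_def[abs_def])
qed

end

text \<open>Uniformity over the class absorbs the dependence of \<open>fhat\<close> on the sample:
  all that is used of it is membership in \<open>F\<close> and closeness to \<open>g\<close> in
  mean.\<close>

lemma (in iid_seq) empirical_L1_vanishes:
  fixes F :: "('x \<Rightarrow> real) set" and g :: "'x \<Rightarrow> real" and B :: real
  assumes D: "donsker P F" and FB: "\<And>f x. f \<in> F \<Longrightarrow> \<bar>f x\<bar> \<le> B"
    and g [measurable]: "g \<in> borel_measurable P" and gB: "\<And>x. \<bar>g x\<bar> \<le> B"
    and fhat: "\<And>n \<omega>. \<omega> \<in> space M \<Longrightarrow> fhat n \<omega> \<in> F"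
    and L1: "vop M (\<lambda>n \<omega>. \<integral>y. \<bar>fhat n \<omega> y - g y\<bar> \<partial>P)"
  shows "vop M (\<lambda>n \<omega>. (\<Sum>i<n. \<bar>fhat n \<omega> (Z i \<omega>) - g (Z i \<omega>)\<bar>) / real n)"
  unfolding vop_def
proof (intro allI impI)
  fix e :: real assume "e > 0"
  have gc: "outer_gc P F"
    by (rule donsker_outer_gc[OF prob_space_law D]) (use FB in \<open>auto simp: unif_bounded_def\<close>)
  have Fm: "f \<in> borel_measurable P" if "f \<in> F" for f
    using D that unfolding donsker_def by blast
  obtain \<delta> where "\<delta> > 0" and W: "osmall (PiM UNIV (\<lambda>_::nat. P)) (\<lambda>n. {x. \<exists>f\<in>F. (\<integral>y. \<bar>f y - g y\<bar> \<partial>P) \<le> \<delta> \<and>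
     e < (\<Sum>i<n. \<bar>f (x i) - g (x i)\<bar>) / real n})"
    by (rule gc_local_absolute[OF prob_space_law gc _ _ g gB \<open>e > 0\<close>]) (use Fm FB in blast)+
  define V where "V n = {\<omega>\<in>space M. (\<integral>y. \<bar>fhat n \<omega> y - g y\<bar> \<partial>P) \<le> \<delta> \<and>
     e < (\<Sum>i<n. \<bar>fhat n \<omega> (Z i \<omega>) - g (Z i \<omega>)\<bar>) / real n}" for n
  have "osmall M V"
  proof (rule osmall_vimage[OF _ distr_sequence W])
    show "(\<lambda>\<omega> i. Z i \<omega>) \<in> measurable M (PiM UNIV (\<lambda>_. P))"
      by (rule measurable_PiM_single') (auto simp: measurable_space[OF Z_meas])
  qed (use fhat in \<open>auto simp: V_def\<close>)
  moreover have "osmall M (\<lambda>n. {\<omega>. \<delta> < \<bar>\<integral>y. \<bar>fhat n \<omega> y - g y\<bar> \<partial>P\<bar>})"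
    using L1 \<open>\<delta> > 0\<close> unfolding vop_def by blast
  ultimately have "osmall M (\<lambda>n. V n \<union> {\<omega>. \<delta> < \<bar>\<integral>y. \<bar>fhat n \<omega> y - g y\<bar> \<partial>P\<bar>})"
    by (rule osmall_Un)
  then show "osmall M (\<lambda>n. {\<omega>. e < \<bar>(\<Sum>i<n. \<bar>fhat n \<omega> (Z i \<omega>) - g (Z i \<omega>)\<bar>) / real n\<bar>})"
  proof (rule osmall_mono)
    have "(\<Sum>i<n. \<bar>fhat n \<omega> (Z i \<omega>) - g (Z i \<omega>)\<bar>) / real n \<ge> 0" for n \<omega>
      by (intro divide_nonneg_nonneg sum_nonneg) auto
    then show "\<forall>\<^sub>F n in sequentially. {\<omega>. e < \<bar>(\<Sum>i<n. \<bar>fhat n \<omega> (Z i \<omega>) - g (Z i \<omega>)\<bar>) / real n\<bar>} \<inter> space M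
       \<subseteq> V n \<union> {\<omega>. \<delta> < \<bar>\<integral>y. \<bar>fhat n \<omega> y - g y\<bar> \<partial>P\<bar>}"
      by (intro always_eventually allI) (auto simp: V_def)
  qed
qed

section \<open>The \<open>L\<^sup>2\<close> norm\<close>

lemma (in prob_space) L2n_bounded:
  assumes [measurable]: "u \<in> borel_measurable M" and "\<And>x. \<bar>u x\<bar> \<le> B"
  shows "L2n M u = ennreal (sqrt (\<integral>x. (u x)\<^sup>2 \<partial>M))"
proof -
  have "(u x)\<^sup>2 \<le> B\<^sup>2" for x
    using assms(2)[of x] by (metis abs_ge_zero power2_abs power_mono)
  then have "integrable M (\<lambda>x. (u x)\<^sup>2)"
    by (intro integrable_const_bound[of _ "B\<^sup>2"]) auto
  then have "(\<integral>\<^sup>+x. ennreal ((u x)\<^sup>2) \<partial>M) = ennreal (\<integral>x. (u x)\<^sup>2 \<partial>M)"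
    by (rule nn_integral_eq_integral) simp
  then show ?thesis by (simp add: L2n_def integral_nonneg_AE)
qed

text \<open>Cauchy-Schwarz, in \<open>ennreal\<close> so as to match the product rate
  condition.\<close>

lemma (in prob_space) integral_mult_le_L2n:
  assumes [measurable]: "u \<in> borel_measurable M" "v \<in> borel_measurable M"
    and u: "\<And>x. \<bar>u x\<bar> \<le> A" and v: "\<And>x. \<bar>v x\<bar> \<le> B"
  shows "ennreal (\<integral>x. \<bar>u x\<bar> * \<bar>v x\<bar> \<partial>M) \<le> L2n M u * L2n M v"
proof -
  define a where "a = sqrt (\<integral>x. (u x)\<^sup>2 \<partial>M)"
  define b where "b = sqrt (\<integral>x. (v x)\<^sup>2 \<partial>M)"
  have ab: "a \<ge> 0" "b \<ge> 0" by (auto simp: a_def b_def integral_nonneg_AE)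
  have a2: "a\<^sup>2 = (\<integral>x. (u x)\<^sup>2 \<partial>M)" and b2: "b\<^sup>2 = (\<integral>x. (v x)\<^sup>2 \<partial>M)"
    by (auto simp: a_def b_def integral_nonneg_AE)
  have sq: "(u x)\<^sup>2 \<le> A\<^sup>2" "(v x)\<^sup>2 \<le> B\<^sup>2" for x
    using u[of x] v[of x] by (metis abs_ge_zero power2_abs power_mono)+
  have int: "integrable M (\<lambda>x. (u x)\<^sup>2)" "integrable M (\<lambda>x. (v x)\<^sup>2)"
    by (rule integrable_const_bound[of _ "A\<^sup>2"] integrable_const_bound[of _ "B\<^sup>2"]; use sq in auto)+
  have "(\<integral>x. \<bar>u x\<bar> * \<bar>v x\<bar> \<partial>M) \<le> a * b"
  proof (cases "a = 0 \<or> b = 0")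
    case True
    then have "(AE x in M. (u x)\<^sup>2 = 0) \<or> (AE x in M. (v x)\<^sup>2 = 0)"
      using int a2 b2 by (auto simp: integral_nonneg_eq_0_iff_AE)
    then have "AE x in M. \<bar>u x\<bar> * \<bar>v x\<bar> = 0" by (auto elim: eventually_mono)
    then have "(\<integral>x. \<bar>u x\<bar> * \<bar>v x\<bar> \<partial>M) = 0" by (rule integral_eq_zero_AE)
    with ab show ?thesis by simp
  next
    case False
    with ab have pos: "a > 0" "b > 0" by auto
    \<comment> \<open>Weighted arithmetic-geometric mean; the weights are balanced so that each of
      the two terms integrates to \<open>a * b / 2\<close>.\<close>
    have "(\<integral>x. \<bar>u x\<bar> * \<bar>v x\<bar> \<partial>M) \<le> (\<integral>x. (b / (2*a)) * (u x)\<^sup>2 + (a / (2*b)) * (v x)\<^sup>2 \<partial>M)"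
    proof (rule integral_mono_AE')
      show "AE x in M. \<bar>u x\<bar> * \<bar>v x\<bar> \<le> (b / (2*a)) * (u x)\<^sup>2 + (a / (2*b)) * (v x)\<^sup>2"
      proof (intro AE_I2)
        fix x
        have "0 \<le> (b * \<bar>u x\<bar> - a * \<bar>v x\<bar>)\<^sup>2" by simp
        then have "2 * (a * b) * (\<bar>u x\<bar> * \<bar>v x\<bar>) \<le> b\<^sup>2 * (u x)\<^sup>2 + a\<^sup>2 * (v x)\<^sup>2"
          by (simp add: power2_diff power_mult_distrib algebra_simps)
        then have "\<bar>u x\<bar> * \<bar>v x\<bar> \<le> (b\<^sup>2 * (u x)\<^sup>2 + a\<^sup>2 * (v x)\<^sup>2) / (2 * (a * b))"
          using pos by (simp add: pos_le_divide_eq mult_ac)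
        also have "\<dots> = (b / (2*a)) * (u x)\<^sup>2 + (a / (2*b)) * (v x)\<^sup>2"
          using pos by (simp add: field_simps power2_eq_square)
        finally show "\<bar>u x\<bar> * \<bar>v x\<bar> \<le> \<dots>" .
      qed
    qed (use int pos in auto)
    also have "\<dots> = (b / (2*a)) * a\<^sup>2 + (a / (2*b)) * b\<^sup>2"
      using int a2 b2 by simp
    also have "\<dots> = a * b" using pos by (simp add: field_simps power2_eq_square)
    finally show ?thesis .
  qed
  then have "ennreal (\<integral>x. \<bar>u x\<bar> * \<bar>v x\<bar> \<partial>M) \<le> ennreal a * ennreal b"
    using ab by (simp flip: ennreal_mult add: ennreal_leI)
  then show ?thesis
    using L2n_bounded[of u A] L2n_bounded[of v B] u v by (simp add: a_def b_def)
qed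

lemma (in prob_space) integral_abs_le_L2n:
  assumes "u \<in> borel_measurable M" "\<And>x. \<bar>u x\<bar> \<le> A"
  shows "ennreal (\<integral>x. \<bar>u x\<bar> \<partial>M) \<le> L2n M u"
  using integral_mult_le_L2n[of u "\<lambda>_. 1" A 1] L2n_bounded[of "\<lambda>_. 1" 1] assms by (simp add: prob_space)

lemma L2n_measurable:
  assumes "prob_space P" and [measurable]: "(\<lambda>(\<omega>, z). u \<omega> z) \<in> borel_measurable (M \<Otimes>\<^sub>M P)"
  shows "(\<lambda>\<omega>. L2n P (u \<omega>)) \<in> borel_measurable M"
proof -
  interpret prob_space P by fact
  have [measurable]: "(\<lambda>\<omega>. \<integral>\<^sup>+z. ennreal ((u \<omega> z)\<^sup>2) \<partial>P) \<in> borel_measurable M"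
    by (rule borel_measurable_nn_integral) measurable
  show ?thesis unfolding L2n_def Let_def by measurable
qed

lemma L2n_mono:
  assumes "\<And>z. \<bar>u z\<bar> \<le> \<bar>v z\<bar>"
  shows "L2n P u \<le> L2n P v"
proof -
  have "(\<integral>\<^sup>+z. ennreal ((u z)\<^sup>2) \<partial>P) \<le> (\<integral>\<^sup>+z. ennreal ((v z)\<^sup>2) \<partial>P)"
    by (intro nn_integral_mono ennreal_leI) (use assms in \<open>simp add: abs_le_square_iff\<close>)
  then show ?thesis
    by (auto simp: L2n_def Let_def top_unique less_top[symmetric] intro!: ennreal_leI enn2real_mono)
qed

text \<open>\<open>oP1\<close> speaks about \<open>measure\<close>, which is 0 on nonmeasurable
  sets; measurability of \<open>Y n\<close> turns its events into genuine covers, while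
  \<open>X n\<close> may be arbitrary below \<open>Y n\<close>.\<close>

lemma oP1_imp_vop:
  assumes "oP1 M Y" "\<And>n. Y n \<in> borel_measurable M"
    and le: "\<And>n \<omega>. \<omega> \<in> space M \<Longrightarrow> ennreal \<bar>X n \<omega>\<bar> \<le> Y n \<omega>"
  shows "vop M X"
  unfolding vop_def
proof (intro allI impI)
  fix e :: real assume e: "e > 0"
  show "osmall M (\<lambda>n. {\<omega>. e < \<bar>X n \<omega>\<bar>})"
  proof (rule osmallI[where A = "\<lambda>n. {\<omega>\<in>space M. Y n \<omega> > ennreal e}"])
    show "(\<lambda>n. measure M {\<omega>\<in>space M. Y n \<omega> > ennreal e}) \<longlonglongrightarrow> 0"
      using assms(1) e by (simp add: oP1_def)
    have "ennreal e < Y n \<omega>" if "\<omega> \<in> space M" "e < \<bar>X n \<omega>\<bar>" for n \<omega>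
      using le[OF that(1), of n] that(2) e by (auto simp: ennreal_less_iff intro: less_le_trans[rotated])
    then show "\<forall>\<^sub>F n in sequentially. {\<omega>. e < \<bar>X n \<omega>\<bar>} \<inter> space M \<subseteq> {\<omega>\<in>space M. Y n \<omega> > ennreal e}"
      by (intro always_eventually allI) auto
  qed (use assms(2) in \<open>auto intro!: always_eventually\<close>)
qed

section \<open>Conditional expectations and kernels\<close>

text \<open>The defining identity, known for indicators, says that \<open>g (W z)\<close> is a
  version of the conditional expectation given the sigma-algebra generated by \<open>W\<close>. The
  general theory then extends it to bounded functions of \<open>W\<close>.\<close>

lemma (in prob_space) cond_exp_fn_integral:
  assumes ce: "cond_exp_fn M Y W N g" and Y: "integrable M Y" and W [measurable]: "W \<in> measurable M N"
    and f [measurable]: "f \<in> borel_measurable N" and fB: "\<And>x. \<bar>f x\<bar> \<le> B"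
  shows "integrable M (\<lambda>z. f (W z) * g (W z))"
    "(\<integral>z. f (W z) * g (W z) \<partial>M) = (\<integral>z. f (W z) * Y z \<partial>M)"
proof -
  have g [measurable]: "g \<in> borel_measurable N" and gi: "integrable M (\<lambda>z. g (W z))"
    and eq: "\<And>A. A \<in> sets N \<Longrightarrow> (\<integral>z. indicator A (W z) * Y z \<partial>M) = (\<integral>z. indicator A (W z) * g (W z) \<partial>M)"
    using ce unfolding cond_exp_fn_def by blast+
  define S where "S = vimage_algebra (space M) W N"
  have Wf: "W \<in> space M \<rightarrow> space N" using measurable_space[OF W] by blast
  have sub: "subalgebra M S"
    unfolding subalgebra_def S_def sets_vimage_algebra2[OF Wf] using measurable_sets[OF W] by auto
  interpret S: finite_measure_subalgebra M S by unfold_locales (rule sub)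
  have WS [measurable]: "W \<in> measurable S N"
    unfolding S_def by (rule measurable_vimage_algebra1[OF Wf])
  have ae: "AE z in M. real_cond_exp M S Y z = g (W z)"
  proof (rule S.real_cond_exp_charact)
    fix A assume "A \<in> sets S"
    then obtain C where C: "C \<in> sets N" "A = W -` C \<inter> space M"
      unfolding S_def sets_vimage_algebra2[OF Wf] by blast
    have "(\<integral>z\<in>A. u z \<partial>M) = (\<integral>z. indicator C (W z) * u z \<partial>M)" for u :: "'a \<Rightarrow> real"
      unfolding set_lebesgue_integral_def C(2)
      by (intro Bochner_Integration.integral_cong) (auto simp: indicator_def)
    then show "(\<integral>z\<in>A. Y z \<partial>M) = (\<integral>z\<in>A. g (W z) \<partial>M)"
      using eq[OF C(1)] by simp
  qed (use Y gi in auto)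
  have [measurable]: "Y \<in> borel_measurable M" using Y by auto
  have "integrable M (\<lambda>z. f (W z) * Y z)"
    by (rule Bochner_Integration.integrable_bound[of _ "\<lambda>z. B * Y z"])
      (use Y fB in \<open>auto simp: abs_mult intro!: mult_right_mono order_trans[OF fB]\<close>)
  from S.real_cond_exp_intg[OF this] have
    "integrable M (\<lambda>z. f (W z) * real_cond_exp M S Y z)"
    "(\<integral>z. f (W z) * real_cond_exp M S Y z \<partial>M) = (\<integral>z. f (W z) * Y z \<partial>M)" by auto
  moreover have "AE z in M. f (W z) * real_cond_exp M S Y z = f (W z) * g (W z)"
    using ae by eventually_elim simp
  ultimately show "integrable M (\<lambda>z. f (W z) * g (W z))"
    "(\<integral>z. f (W z) * g (W z) \<partial>M) = (\<integral>z. f (W z) * Y z \<partial>M)"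
    using integrable_cong_AE[of "\<lambda>z. f (W z) * real_cond_exp M S Y z" M "\<lambda>z. f (W z) * g (W z)"]
      integral_cong_AE[of "\<lambda>z. f (W z) * real_cond_exp M S Y z" M "\<lambda>z. f (W z) * g (W z)"] by auto
qed

text \<open>The hypothesis on sets says that the law of \<open>X\<close> under \<open>M\<close>
  restricted to \<open>E\<close> is the mixture of the kernel \<open>K\<close> over that
  restriction. Integrating a function against a mixture gives the iterated integral.\<close>

lemma (in prob_space) kernel_integral:
  fixes X :: "'a \<Rightarrow> real" and \<phi> :: "real \<Rightarrow> real"
  assumes X [measurable]: "X \<in> borel_measurable M" and E [measurable]: "E \<in> sets M"
    and K [measurable]: "K \<in> measurable M (prob_algebra borel)"
    and eq: "\<And>C. C \<in> sets borel \<Longrightarrow>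
      measure M {z\<in>space M. z \<in> E \<and> X z \<in> C} = (\<integral>z. indicator E z * measure (K z) C \<partial>M)"
    and \<phi> [measurable]: "\<phi> \<in> borel_measurable borel" and \<phi>B: "\<And>x. \<bar>\<phi> x\<bar> \<le> B"
  shows "(\<integral>z. indicator E z * \<phi> (X z) \<partial>M) = (\<integral>z. indicator E z * (\<integral>y. \<phi> y \<partial>K z) \<partial>M)"
    "(\<lambda>z. \<integral>y. \<phi> y \<partial>K z) \<in> borel_measurable M"
proof -
  have B: "0 \<le> B" using \<phi>B[of 0] by linarith
  have K' [measurable]: "K \<in> measurable M (subprob_algebra borel)"
    by (rule measurable_prob_algebraD[OF K])
  have Kp: "prob_space (K z)" "sets (K z) = sets borel" if "z \<in> space M" for z
    using measurable_space[OF K that] by (auto simp: space_prob_algebra)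
  have Kint: "integrable (K z) \<phi>" if z: "z \<in> space M" for z
  proof -
    have "\<phi> \<in> borel_measurable (K z)"
      using \<phi> by (simp add: measurable_cong_sets[OF Kp(2)[OF z] refl])
    then show ?thesis
      using \<phi>B by (intro finite_measure.integrable_const_bound[OF prob_space.finite_measure[OF Kp(1)[OF z]], of _ B]) auto
  qed
  show km [measurable]: "(\<lambda>z. \<integral>y. \<phi> y \<partial>K z) \<in> borel_measurable M"
    by measurable
  define D where "D = density M (indicator E)"
  have D [measurable_cong]: "sets D = sets M" "space D = space M" by (auto simp: D_def)
  have KD: "K \<in> measurable D (subprob_algebra borel)" by measurable
  have law: "distr D borel X = D \<bind> K"
  proof (rule measure_eqI)
    have ne: "space D \<noteq> {}" using not_empty by (simp add: D)
    show sets_eq: "sets (distr D borel X) = sets (D \<bind> K)"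
      using sets_bind[OF _ ne, of K borel] Kp(2) by (simp add: D(2))
    fix C assume "C \<in> sets (distr D borel X)"
    then have C [measurable]: "C \<in> sets borel" by simp
    have "emeasure (distr D borel X) C = emeasure M {z\<in>space M. z \<in> E \<and> X z \<in> C}"
      by (subst emeasure_distr) (auto simp: D_def emeasure_density_const emeasure_restricted Int_def
          conj_ac intro!: arg_cong[where f = "emeasure M"])
    also have "\<dots> = ennreal (\<integral>z. indicator E z * measure (K z) C \<partial>M)"
      by (simp add: emeasure_eq_measure eq[OF C])
    also have "\<dots> = (\<integral>\<^sup>+z. ennreal (indicator E z * measure (K z) C) \<partial>M)"
    proof (rule nn_integral_eq_integral[symmetric])
      show "integrable M (\<lambda>z. indicator E z * measure (K z) C)"
        by (rule integrable_const_bound[of _ 1])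
          (auto intro!: AE_I2 mult_le_one prob_space.prob_le_1 Kp simp: indicator_def)
    qed auto
    also have "\<dots> = (\<integral>\<^sup>+z. indicator E z * emeasure (K z) C \<partial>M)"
      by (intro nn_integral_cong)
        (auto simp: indicator_def finite_measure.emeasure_eq_measure[OF prob_space.finite_measure[OF Kp(1)]])
    also have "\<dots> = (\<integral>\<^sup>+z. emeasure (K z) C \<partial>D)"
      unfolding D_def by (subst nn_integral_density) auto
    also have "\<dots> = emeasure (D \<bind> K) C"
      by (rule emeasure_bind[OF ne KD C, symmetric])
    finally show "emeasure (distr D borel X) C = emeasure (D \<bind> K) C" .
  qed
  \<comment> \<open>Adding \<open>B\<close> makes the integrand nonnegative, as the integral against
    a mixture is taken in \<open>ennreal\<close>.\<close>
  have nn: "(\<integral>\<^sup>+z. indicator E z * ennreal (\<phi> (X z) + B) \<partial>M) = (\<integral>\<^sup>+z. indicator E z * ennreal ((\<integral>y. \<phi> y \<partial>K z) + B) \<partial>M)"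
  proof -
    have "(\<integral>\<^sup>+z. indicator E z * ennreal (\<phi> (X z) + B) \<partial>M) = (\<integral>\<^sup>+z. ennreal (\<phi> (X z) + B) \<partial>D)"
      unfolding D_def by (subst nn_integral_density) auto
    also have "\<dots> = (\<integral>\<^sup>+y. ennreal (\<phi> y + B) \<partial>distr D borel X)"
      by (subst nn_integral_distr) auto
    also have "\<dots> = (\<integral>\<^sup>+z. \<integral>\<^sup>+y. ennreal (\<phi> y + B) \<partial>K z \<partial>D)"
      unfolding law by (rule nn_integral_bind[OF _ KD]) measurable
    also have "\<dots> = (\<integral>\<^sup>+z. ennreal ((\<integral>y. \<phi> y \<partial>K z) + B) \<partial>D)"
    proof (rule nn_integral_cong)
      fix z assume "z \<in> space D"
      then have z: "z \<in> space M" by (simp add: D)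
      interpret Kz: prob_space "K z" by (rule Kp(1)[OF z])
      note i = Kint[OF z]
      have "(\<integral>\<^sup>+y. ennreal (\<phi> y + B) \<partial>K z) = ennreal (\<integral>y. \<phi> y + B \<partial>K z)"
      proof (rule nn_integral_eq_integral)
        have "0 \<le> \<phi> y + B" for y using \<phi>B[of y] by linarith
        then show "AE y in K z. 0 \<le> \<phi> y + B" by simp
      qed (use i in auto)
      also have "(\<integral>y. \<phi> y + B \<partial>K z) = (\<integral>y. \<phi> y \<partial>K z) + B"
        using i by (simp add: Kz.prob_space)
      finally show "(\<integral>\<^sup>+y. ennreal (\<phi> y + B) \<partial>K z) = ennreal ((\<integral>y. \<phi> y \<partial>K z) + B)" .
    qed
    also have "\<dots> = (\<integral>\<^sup>+z. indicator E z * ennreal ((\<integral>y. \<phi> y \<partial>K z) + B) \<partial>M)"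
      unfolding D_def by (subst nn_integral_density) auto
    finally show ?thesis .
  qed
  \<comment> \<open>The shift contributes \<open>B * measure M E\<close> to both sides;
    nonnegativity of the shifted real integrals allows passing back from
    \<open>ennreal\<close>.\<close>
  have *: "(\<integral>\<^sup>+z. indicator E z * ennreal (u z + B) \<partial>M) = ennreal ((\<integral>z. indicator E z * u z \<partial>M) + B * measure M E)"
    "0 \<le> (\<integral>z. indicator E z * u z \<partial>M) + B * measure M E"
    if [measurable]: "u \<in> borel_measurable M" and u: "\<And>z. z \<in> space M \<Longrightarrow> \<bar>u z\<bar> \<le> B" for u
  proof -
    have i: "integrable M (\<lambda>z. indicator E z * u z)"
      by (rule integrable_const_bound[of _ B])
        (use u B in \<open>auto intro!: AE_I2 simp: indicator_def\<close>)
    have i2: "integrable M (\<lambda>z. indicator E z * B)" by (simp add: emeasure_eq_measure)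
    have eq: "(\<integral>z. indicator E z * u z + indicator E z * B \<partial>M) = (\<integral>z. indicator E z * u z \<partial>M) + B * measure M E"
      using i i2 by simp
    have nonneg: "0 \<le> indicator E z * u z + indicator E z * B" if "z \<in> space M" for z
      using u[OF that] by (auto simp: indicator_def)
    have "(\<integral>\<^sup>+z. indicator E z * ennreal (u z + B) \<partial>M) = (\<integral>\<^sup>+z. ennreal (indicator E z * u z + indicator E z * B) \<partial>M)"
      by (intro nn_integral_cong) (auto simp: indicator_def)
    also have "\<dots> = ennreal (\<integral>z. indicator E z * u z + indicator E z * B \<partial>M)"
      using i i2 nonneg by (intro nn_integral_eq_integral AE_I2) auto
    finally show "(\<integral>\<^sup>+z. indicator E z * ennreal (u z + B) \<partial>M) = ennreal ((\<integral>z. indicator E z * u z \<partial>M) + B * measure M E)"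
      by (simp only: eq)
    show "0 \<le> (\<integral>z. indicator E z * u z \<partial>M) + B * measure M E"
      unfolding eq[symmetric] using nonneg by (intro integral_nonneg_AE AE_I2) auto
  qed
  have kB: "\<bar>\<integral>y. \<phi> y \<partial>K z\<bar> \<le> B" if z: "z \<in> space M" for z
  proof -
    interpret Kz: prob_space "K z" by (rule Kp(1)[OF z])
    have "(\<integral>y. \<bar>\<phi> y\<bar> \<partial>K z) \<le> B"
      using \<phi>B Kint[OF z] by (intro Kz.integral_le_const integrable_abs) auto
    with integral_abs_bound[of "K z" \<phi>] show ?thesis by linarith
  qed
  show "(\<integral>z. indicator E z * \<phi> (X z) \<partial>M) = (\<integral>z. indicator E z * (\<integral>y. \<phi> y \<partial>K z) \<partial>M)"
    using nn *[of "\<lambda>z. \<phi> (X z)"] *[of "\<lambda>z. \<integral>y. \<phi> y \<partial>K z"] \<phi>B kB by simp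
qed

section \<open>Identification of the mean\<close>

lemma ind_simps [simp]: "ind True = 1" "ind False = 0" "0 \<le> ind b" "ind b \<le> 1" "\<bar>ind b\<bar> = ind b"
  by (auto simp: ind_def)

lemma space_Xsp [simp]: "space Xsp = UNIV"
  by (auto simp: Xsp_def space_PiM)

lemma measurable_Xsp_component [measurable]: "(\<lambda>x. x k) \<in> borel_measurable Xsp"
  unfolding Xsp_def by measurable

lemma restr_measurable [measurable]: "restr U \<in> measurable Xsp Xsp"
proof -
  have "(\<lambda>x. restr U x) \<in> measurable Xsp (PiM UNIV (\<lambda>_. borel))"
  proof (rule measurable_PiM_single')
    fix k show "(\<lambda>x. restr U x k) \<in> borel_measurable Xsp"
      by (cases "k \<in> U") (simp_all add: restr_def)
  qed auto
  then show ?thesis by (simp add: Xsp_def)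
qed

section \<open>The data law and its coordinate maps\<close>

locale missing_data = prob_space P for P :: "(('d::finite \<Rightarrow> real) \<times> ('d \<Rightarrow> bool)) measure" +
  fixes adj :: "'d \<Rightarrow> 'd \<Rightarrow> bool" and v1 :: 'd and Mb :: real
  assumes sets_P: "sets P = sets Dsp"
    and X_bounded: "AE z in P. \<bar>fst z v1\<bar> \<le> Mb"
begin

lemma fst_measurable [measurable]: "fst \<in> measurable P Xsp"
  and snd_measurable [measurable]: "snd \<in> measurable P (count_space UNIV)"
  by (simp_all add: measurable_cong_sets[OF sets_P refl] Dsp_def)

lemma space_P [simp]: "space P = UNIV"
  using sets_eq_imp_space_eq[OF sets_P] by (simp add: Dsp_def space_pair_measure)

lemma X_measurable [measurable]: "(\<lambda>z. fst z k) \<in> borel_measurable P"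
  by (rule measurable_compose[OF fst_measurable measurable_Xsp_component])

lemma R_measurable [measurable]: "(\<lambda>z. h (snd z)) \<in> borel_measurable P"
  for h :: "('d \<Rightarrow> bool) \<Rightarrow> real"
  by (rule measurable_compose[OF snd_measurable]) simp

lemma R_sets [measurable]: "{z. h (snd z)} \<in> sets P"
  using measurable_sets[OF snd_measurable, of "{r. h r}"] by (simp add: vimage_def)

lemma nb_measurable [measurable]: "(\<lambda>z. restr U (fst z)) \<in> measurable P Xsp"
  by (rule measurable_compose[OF fst_measurable restr_measurable])

lemma X_integrable: "integrable P (\<lambda>z. fst z v1)"
  by (rule integrable_const_bound[of _ Mb]) (use X_bounded in auto)

lemma X_bounded_integrable:
  assumes [measurable]: "h \<in> borel_measurable P" and "\<And>z. \<bar>h z\<bar> \<le> B"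
  shows "integrable P (\<lambda>z. fst z v1 * h z)"
proof (rule Bochner_Integration.integrable_bound[of _ "\<lambda>z. fst z v1 * B"])
  have "\<bar>x * h z\<bar> \<le> \<bar>x * B\<bar>" for x z
    using assms(2)[of z] unfolding abs_mult by (intro mult_left_mono) auto
  then show "AE z in P. norm (fst z v1 * h z) \<le> norm (fst z v1 * B)" by simp
qed (use X_integrable in auto)

end

text \<open>A path from \<open>a\<close> inside \<open>U\<close> visits only vertices reachable from
  \<open>a\<close>, so it already runs inside the component. By symmetry any two vertices are then
  joined through \<open>a\<close>.\<close>

lemma gconn_comp_of:
  assumes adj_sym: "\<forall>a b. adj a b \<longrightarrow> adj b a" and a: "a \<in> U"
  shows "gconn adj (comp_of adj U a)"
proof -
  let ?C = "comp_of adj U a"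
  have aC: "a \<in> ?C" using a by (auto simp: comp_of_def)
  have path: "(a, b) \<in> (ind_rel adj ?C)\<^sup>*" if "(a, b) \<in> (ind_rel adj U)\<^sup>*" for b
    using that
  proof (induction rule: rtrancl_induct)
    case (step b c)
    then have "b \<in> U" "c \<in> U" "adj b c" by (auto simp: ind_rel_def)
    then have "(b, c) \<in> ind_rel adj ?C"
      using step(1,2) by (auto simp: ind_rel_def comp_of_def intro: rtrancl_into_rtrancl)
    with step.IH show ?case by (rule rtrancl_into_rtrancl)
  qed simp
  have "sym (ind_rel adj ?C)" using adj_sym by (auto simp: sym_def ind_rel_def)
  then have s: "sym ((ind_rel adj ?C)\<^sup>*)" by (rule sym_rtrancl)
  show ?thesis unfolding gconn_def
  proof (intro conjI ballI)
    fix b c assume "b \<in> ?C" "c \<in> ?C"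
    then have "(a, b) \<in> (ind_rel adj ?C)\<^sup>*" "(a, c) \<in> (ind_rel adj ?C)\<^sup>*"
      using path by (auto simp: comp_of_def)
    then show "(b, c) \<in> (ind_rel adj ?C)\<^sup>*" using s by (meson rtrancl_trans symD)
  qed (use aC in blast)
qed

text \<open>If the first vertex is missing, its component is one of the indexed sets, so exactly one
  summand is 1. Otherwise \<open>psi\<close> takes the default value \<open>{}\<close>, which no
  indexed set equals. This splits the mean of \<open>X_1\<close> over the possible
  components.\<close>

lemma sum_ind_psi:
  fixes adj :: "'d::finite \<Rightarrow> 'd \<Rightarrow> bool"
  assumes "\<forall>a b. adj a b \<longrightarrow> adj b a"
  shows "(\<Sum>s\<in>Jset adj v1. ind (psi adj v1 v = s)) = ind (v v1)"
proof (cases "v v1")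
  case True
  then have "psi adj v1 v \<in> Jset adj v1"
    using gconn_comp_of[OF assms, of v1 "{k. v k}"] by (auto simp: psi_def Jset_def comp_of_def)
  then have "(\<Sum>s\<in>Jset adj v1. ind (psi adj v1 v = s)) = (\<Sum>s\<in>Jset adj v1. if psi adj v1 v = s then 1 else 0)"
    by (intro sum.cong) (auto simp: ind_def)
  also have "\<dots> = 1" using \<open>psi adj v1 v \<in> Jset adj v1\<close> by (subst sum.delta') auto
  finally show ?thesis using True by simp
next
  case False
  then have "psi adj v1 v \<notin> Jset adj v1" by (auto simp: psi_def Jset_def)
  then have "(\<Sum>s\<in>Jset adj v1. ind (psi adj v1 v = s)) = 0" by (intro sum.neutral) (auto simp: ind_def)
  with False show ?thesis by simp
qed

text \<open>One connected set is fixed. Conditioning on the neighbourhood being observed amounts to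
  dividing by its conditional probability \<open>p2\<close>; hence the regression among those units
  is the ratio \<open>q / p2\<close>.\<close>

locale nuisance = missing_data P adj v1 Mb
  for P :: "(('d::finite \<Rightarrow> real) \<times> ('d \<Rightarrow> bool)) measure" and adj v1 Mb +
  fixes s :: "'d set" and p1 p2 q :: "('d \<Rightarrow> real) \<Rightarrow> real"
  assumes s: "s \<in> Jset adj v1"
    and p1_ver: "cond_exp_fn P (\<lambda>z. ind (psi adj v1 (\<lambda>k. \<not> snd z k) = s))
                   (\<lambda>z. restr (nbr adj s) (fst z)) Xsp p1"
    and p2_ver: "cond_exp_fn P (\<lambda>z. ind (allobs (cnbr adj s) (snd z)))
                   (\<lambda>z. restr (nbr adj s) (fst z)) Xsp p2"
    and q_ver: "cond_exp_fn P (\<lambda>z. fst z v1 * ind (allobs (cnbr adj s) (snd z)))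
                   (\<lambda>z. restr (nbr adj s) (fst z)) Xsp q"
    and p2_pos: "\<And>x. p2 x > 0"
    and nuis_bounded: "\<And>x. \<bar>p1 x / p2 x\<bar> \<le> Mb" "\<And>x. \<bar>q x / p2 x\<bar> \<le> Mb"
begin

abbreviation xN :: "('d \<Rightarrow> real) \<times> ('d \<Rightarrow> bool) \<Rightarrow> 'd \<Rightarrow> real" where
  "xN z \<equiv> restr (nbr adj s) (fst z)"
abbreviation obs :: "('d \<Rightarrow> real) \<times> ('d \<Rightarrow> bool) \<Rightarrow> real" where
  "obs z \<equiv> ind (allobs (cnbr adj s) (snd z))"
abbreviation mis :: "('d \<Rightarrow> real) \<times> ('d \<Rightarrow> bool) \<Rightarrow> real" where
  "mis z \<equiv> ind (psi adj v1 (\<lambda>k. \<not> snd z k) = s)"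
abbreviation "odds x \<equiv> p1 x / p2 x"
abbreviation "reg x \<equiv> q x / p2 x"

lemma nuis_measurable [measurable]:
  "p1 \<in> borel_measurable Xsp" "p2 \<in> borel_measurable Xsp" "q \<in> borel_measurable Xsp"
  using p1_ver p2_ver q_ver by (auto simp: cond_exp_fn_def)

lemma integrable_bounded:
  "u \<in> borel_measurable P \<Longrightarrow> (\<And>z. \<bar>u z\<bar> \<le> B) \<Longrightarrow> integrable P u" for u :: "_ \<Rightarrow> real"
  by (rule integrable_const_bound[of _ B]) auto

lemma cond_exp_bounded:
  assumes "f \<in> borel_measurable Xsp" "\<And>x. \<bar>f x\<bar> \<le> B"
  shows "(\<integral>z. f (xN z) * mis z \<partial>P) = (\<integral>z. f (xN z) * p1 (xN z) \<partial>P)"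
    and "(\<integral>z. f (xN z) * obs z \<partial>P) = (\<integral>z. f (xN z) * p2 (xN z) \<partial>P)"
    and "(\<integral>z. f (xN z) * (fst z v1 * obs z) \<partial>P) = (\<integral>z. f (xN z) * q (xN z) \<partial>P)"
    and "integrable P (\<lambda>z. f (xN z) * p2 (xN z))"
    and "integrable P (\<lambda>z. f (xN z) * q (xN z))"
proof -
  have i: "integrable P mis" "integrable P obs"
    by (rule integrable_bounded[where B = 1]; simp)+
  have i2: "integrable P (\<lambda>z. fst z v1 * obs z)"
    by (rule X_bounded_integrable[where B = 1]) auto
  note c1 = cond_exp_fn_integral[OF p1_ver i(1) nb_measurable assms]
  note c2 = cond_exp_fn_integral[OF p2_ver i(2) nb_measurable assms]
  note c3 = cond_exp_fn_integral[OF q_ver i2 nb_measurable assms]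
  show "(\<integral>z. f (xN z) * mis z \<partial>P) = (\<integral>z. f (xN z) * p1 (xN z) \<partial>P)" using c1(2) by simp
  show "(\<integral>z. f (xN z) * obs z \<partial>P) = (\<integral>z. f (xN z) * p2 (xN z) \<partial>P)" using c2(2) by simp
  show "(\<integral>z. f (xN z) * (fst z v1 * obs z) \<partial>P) = (\<integral>z. f (xN z) * q (xN z) \<partial>P)" using c3(2) by simp
  show "integrable P (\<lambda>z. f (xN z) * p2 (xN z))" by (rule c2(1))
  show "integrable P (\<lambda>z. f (xN z) * q (xN z))" by (rule c3(1))
qed

text \<open>\<open>X\<^sub>1\<close> is bounded only almost surely, and its kernels may charge unbounded sets on a null set.\<close>
definition clip :: "real \<Rightarrow> real" where "clip x = max (- \<bar>Mb\<bar>) (min \<bar>Mb\<bar> x)"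

lemma clip_bounded: "\<bar>clip x\<bar> \<le> \<bar>Mb\<bar>"
  by (auto simp: clip_def)

lemma clip_measurable [measurable]: "clip \<in> borel_measurable borel"
  unfolding clip_def by measurable

lemma AE_clip: "AE z in P. clip (fst z v1) = fst z v1"
  using X_bounded by eventually_elim (auto simp: clip_def)

text \<open>MMG and PAI share the kernel \<open>Kr r s\<close>. Through MMG its mean
  \<open>k\<close> predicts \<open>X_1\<close> on the pattern \<open>r\<close>; through PAI it
  predicts \<open>X_1\<close> among the units with observed neighbourhood, so that
  \<open>k * p2\<close> is a version of \<open>q\<close>. Thus \<open>k\<close> is the regression,
  although the kernel may vary with \<open>r\<close>.\<close>

lemma imputation_pattern:
  assumes MMG: "MMG P adj Kr" and PAI: "PAI P adj Kr" and r: "psi adj v1 (\<lambda>k. \<not> r k) = s"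
  shows "(\<integral>z. indicator {z. snd z = r} z * fst z v1 \<partial>P) = (\<integral>z. indicator {z. snd z = r} z * reg (xN z) \<partial>P)"
proof -
  have v1s: "v1 \<in> s" using s by (simp add: Jset_def)
  then have rv: "\<not> r v1" using r by (auto simp: psi_def split: if_splits)
  then have sc: "s = comp_of adj {k. \<not> r k} v1" using r by (simp add: psi_def)
  then have sr: "s \<in> comps adj r" using rv unfolding comps_def by blast
  define K where "K z = distr (Kr r s (xN z)) borel (\<lambda>y. y v1)" for z
  have Kr: "Kr r t \<in> measurable Xsp (prob_algebra Xsp)" if "t \<in> comps adj r" for t
    using MMG that unfolding MMG_def by blast
  have Krp: "prob_space (Kr r t x)" "sets (Kr r t x) = sets Xsp" "space (Kr r t x) = UNIV"
    if "t \<in> comps adj r" for t x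
    using measurable_space[OF Kr[OF that], of x] sets_eq_imp_space_eq[of "Kr r t x" Xsp]
    by (auto simp: space_prob_algebra)
  have comp_meas: "(\<lambda>y. y v1) \<in> borel_measurable (Kr r s x)" for x
    by (simp add: measurable_cong_sets[OF Krp(2)[OF sr] refl] measurable_Xsp_component)
  have K: "K \<in> measurable P (prob_algebra borel)"
    unfolding K_def
    by (rule measurable_compose[OF measurable_compose[OF nb_measurable Kr[OF sr]]
          measurable_distr_prob_space[OF measurable_Xsp_component]])
  have mK: "measure (K z) C = measure (Kr r s (xN z)) {y. y v1 \<in> C}" if "C \<in> sets borel" for C z
    unfolding K_def using that Krp(3)[OF sr] by (subst measure_distr[OF comp_meas]) (auto simp: vimage_def)
  have pre: "{x. x v1 \<in> C} \<in> sets Xsp" if "C \<in> sets borel" for C :: "real set"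
    using measurable_sets[OF measurable_Xsp_component that] by (simp add: vimage_def)

  \<comment> \<open>Under \<open>r\<close> the first coordinate is missing and belongs to the
    component \<open>s\<close>, so \<open>assemble\<close> reads it off the factor
    \<open>w s\<close>. Its marginal under the product measure is the single kernel for
    \<open>s\<close>.\<close>
  have eq1: "measure P {z\<in>space P. z \<in> {z. snd z = r} \<and> fst z v1 \<in> C}
      = (\<integral>z. indicator {z. snd z = r} z * measure (K z) C \<partial>P)" if C: "C \<in> sets borel" for C
  proof -
    have "measure (PiM (comps adj r) (\<lambda>t. Kr r t (restr (nbr adj t) (fst z))))
        {w \<in> space (PiM (comps adj r) (\<lambda>t. Kr r t (restr (nbr adj t) (fst z)))). assemble adj r (fst z) w \<in> {x. x v1 \<in> C}}
      = measure (K z) C" for z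
    proof -
      let ?Pi = "PiM (comps adj r) (\<lambda>t. Kr r t (restr (nbr adj t) (fst z)))"
      have "distr ?Pi (Kr r s (xN z)) (\<lambda>w. w s) = Kr r s (xN z)"
        by (rule distr_PiM_component[OF _ sr]) (rule Krp(1))
      then have "measure (Kr r s (xN z)) {y. y v1 \<in> C} = measure (distr ?Pi (Kr r s (xN z)) (\<lambda>w. w s)) {y. y v1 \<in> C}"
        by simp
      also have "\<dots> = measure ?Pi ((\<lambda>w. w s) -` {y. y v1 \<in> C} \<inter> space ?Pi)"
        by (rule measure_distr) (use sr pre[OF C] Krp(2)[OF sr] in auto)
      also have "(\<lambda>w. w s) -` {y. y v1 \<in> C} \<inter> space ?Pi = {w \<in> space ?Pi. assemble adj r (fst z) w \<in> {x. x v1 \<in> C}}"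
        using rv by (auto simp: assemble_def sc[symmetric])
      finally show ?thesis using mK[OF C] by simp
    qed
    moreover have "measure P {z\<in>space P. fst z \<in> {x. x v1 \<in> C} \<and> snd z = r} =
        (\<integral>z. indicator {z. snd z = r} z * measure (PiM (comps adj r) (\<lambda>t. Kr r t (restr (nbr adj t) (fst z))))
        {w \<in> space (PiM (comps adj r) (\<lambda>t. Kr r t (restr (nbr adj t) (fst z)))). assemble adj r (fst z) w \<in> {x. x v1 \<in> C}} \<partial>P)"
      using MMG pre[OF C] unfolding MMG_def by blast
    ultimately show ?thesis by (simp add: conj_commute)
  qed

  \<comment> \<open>\<open>v1 \<in> s\<close>, so restricting to \<open>s\<close> keeps the first
    coordinate; PAI specialises to a statement about the same kernel \<open>K\<close>.\<close>
  have eq2: "measure P {z\<in>space P. z \<in> {z. xN z \<in> A \<and> allobs (cnbr adj s) (snd z)} \<and> fst z v1 \<in> C}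
      = (\<integral>z. indicator {z. xN z \<in> A \<and> allobs (cnbr adj s) (snd z)} z * measure (K z) C \<partial>P)"
    if A: "A \<in> sets Xsp" and C: "C \<in> sets borel" for A C
  proof -
    have rs: "restr s y \<in> {x. x v1 \<in> C} \<longleftrightarrow> y v1 \<in> C" for y
      using v1s by (simp add: restr_def)
    have "measure P {z\<in>space P. xN z \<in> A \<and> restr s (fst z) \<in> {x. x v1 \<in> C} \<and> allobs (cnbr adj s) (snd z)} =
      (\<integral>z. indicator {z. xN z \<in> A \<and> allobs (cnbr adj s) (snd z)} z *
              measure (Kr r s (xN z)) {y \<in> space Xsp. restr s y \<in> {x. x v1 \<in> C}} \<partial>P)"
      using PAI sr A pre[OF C] unfolding PAI_def by blast
    then show ?thesis unfolding rs using mK[OF C] by (simp add: conj_ac)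
  qed

  define k where "k x = (\<integral>y. clip (y v1) \<partial>Kr r s x)" for x
  have kK: "(\<integral>y. clip y \<partial>K z) = k (xN z)" for z
    unfolding K_def k_def by (rule integral_distr[OF comp_meas]) simp
  have k [measurable]: "k \<in> borel_measurable Xsp"
  proof -
    have [measurable]: "Kr r s \<in> measurable Xsp (subprob_algebra Xsp)"
      by (rule measurable_prob_algebraD[OF Kr[OF sr]])
    show ?thesis unfolding k_def by measurable
  qed
  have kB: "\<bar>k x\<bar> \<le> \<bar>Mb\<bar>" for x
  proof -
    interpret Kx: prob_space "Kr r s x" by (rule Krp(1)[OF sr])
    have "integrable (Kr r s x) (\<lambda>y. clip (y v1))"
      by (rule Kx.integrable_const_bound[of _ "\<bar>Mb\<bar>"])
        (use clip_bounded measurable_compose[OF comp_meas clip_measurable] in auto)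
    then have "(\<integral>y. \<bar>clip (y v1)\<bar> \<partial>Kr r s x) \<le> \<bar>Mb\<bar>"
      using clip_bounded by (intro Kx.integral_le_const integrable_abs) auto
    with integral_abs_bound[of "Kr r s x" "\<lambda>y. clip (y v1)"] show ?thesis unfolding k_def by linarith
  qed

  have pai: "(\<integral>z. indicator A (xN z) * q (xN z) \<partial>P) = (\<integral>z. (indicator A (xN z) * k (xN z)) * p2 (xN z) \<partial>P)"
    if A [measurable]: "A \<in> sets Xsp" for A
  proof -
    let ?E = "{z. xN z \<in> A \<and> allobs (cnbr adj s) (snd z)}"
    have "?E = ((\<lambda>z. xN z) -` A \<inter> space P) \<inter> {z. allobs (cnbr adj s) (snd z)}" by auto
    also have "\<dots> \<in> sets P" by (intro sets.Int measurable_sets[OF nb_measurable A] R_sets)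
    finally have E: "?E \<in> sets P" .
    have indE: "indicator ?E z = (indicator A (xN z) * obs z :: real)" for z
      by (auto simp: indicator_def ind_def)
    have "(\<integral>z. indicator A (xN z) * q (xN z) \<partial>P) = (\<integral>z. indicator A (xN z) * (fst z v1 * obs z) \<partial>P)"
      by (rule cond_exp_bounded(3)[symmetric, of _ 1]) auto
    also have "\<dots> = (\<integral>z. indicator ?E z * clip (fst z v1) \<partial>P)"
      by (rule integral_cong_AE) (use AE_clip E in \<open>auto simp: indE mult_ac elim!: eventually_mono\<close>)
    also have "\<dots> = (\<integral>z. indicator ?E z * (\<integral>y. clip y \<partial>K z) \<partial>P)"
      by (rule kernel_integral(1)[OF X_measurable E K eq2[OF A] clip_measurable clip_bounded])
    also have "\<dots> = (\<integral>z. (indicator A (xN z) * k (xN z)) * obs z \<partial>P)"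
      by (simp only: kK indE mult_ac)
    also have "\<dots> = (\<integral>z. (indicator A (xN z) * k (xN z)) * p2 (xN z) \<partial>P)"
      using kB by (intro cond_exp_bounded(2)[of "\<lambda>x. indicator A x * k x" "\<bar>Mb\<bar>"]) (auto simp: indicator_def)
    finally show ?thesis .
  qed
  \<comment> \<open>In \<open>pai\<close> the indicator of an observed neighbourhood has been
    exchanged for \<open>p2\<close>. Hence \<open>d\<close> will vanish almost surely on the whole
    space and not only on observed neighbourhoods, which permits its use on the event
    \<open>snd z = r\<close>.\<close>
  define d where "d x = q x - k x * p2 x" for x
  have [measurable]: "d \<in> borel_measurable Xsp" unfolding d_def by measurable
  have d0: "(\<integral>z. indicator A (xN z) * d (xN z) \<partial>P) = 0" and di: "integrable P (\<lambda>z. indicator A (xN z) * d (xN z))"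
    if A [measurable]: "A \<in> sets Xsp" for A
  proof -
    have i1: "integrable P (\<lambda>z. indicator A (xN z) * q (xN z))"
      by (rule cond_exp_bounded(5)[of _ 1]) auto
    have i2: "integrable P (\<lambda>z. (indicator A (xN z) * k (xN z)) * p2 (xN z))"
      using kB by (intro cond_exp_bounded(4)[of "\<lambda>x. indicator A x * k x" "\<bar>Mb\<bar>"]) (auto simp: indicator_def)
    have e: "indicator A (xN z) * d (xN z) = indicator A (xN z) * q (xN z) - (indicator A (xN z) * k (xN z)) * p2 (xN z)" for z
      by (simp add: d_def algebra_simps)
    show "integrable P (\<lambda>z. indicator A (xN z) * d (xN z))" unfolding e using i1 i2 by simp
    show "(\<integral>z. indicator A (xN z) * d (xN z) \<partial>P) = 0"
      unfolding e using i1 i2 pai[OF A] by simp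
  qed
  \<comment> \<open>Testing against the sets where \<open>d\<close> is positive and where it is
    negative leaves integrands of constant sign with integral 0.\<close>
  have "AE z in P. d (xN z) = 0"
  proof -
    have "{x\<in>space Xsp. d x > 0} \<in> sets Xsp" "{x\<in>space Xsp. d x < 0} \<in> sets Xsp"
      by measurable
    then have pos: "{x. d x > 0} \<in> sets Xsp" and neg: "{x. d x < 0} \<in> sets Xsp" by simp_all
    have "AE z in P. indicator {x. d x > 0} (xN z) * d (xN z) = 0"
      using d0[OF pos] di[OF pos] by (subst (asm) integral_nonneg_eq_0_iff_AE) (auto simp: indicator_def)
    moreover have "AE z in P. - (indicator {x. d x < 0} (xN z) * d (xN z)) = 0"
      using d0[OF neg] di[OF neg] by (subst integral_nonneg_eq_0_iff_AE[symmetric]) (auto simp: indicator_def)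
    ultimately show ?thesis
      by eventually_elim (auto simp: indicator_def split: if_splits)
  qed
  then have kreg: "AE z in P. k (xN z) = reg (xN z)"
  proof eventually_elim
    case (elim z)
    then show ?case using p2_pos[of "xN z"] by (simp add: d_def field_simps)
  qed
  have Er: "{z. snd z = r} \<in> sets P" by (rule R_sets)
  have "(\<integral>z. indicator {z. snd z = r} z * fst z v1 \<partial>P) = (\<integral>z. indicator {z. snd z = r} z * clip (fst z v1) \<partial>P)"
    by (rule integral_cong_AE) (use AE_clip Er in \<open>auto elim!: eventually_mono\<close>)
  also have "\<dots> = (\<integral>z. indicator {z. snd z = r} z * k (xN z) \<partial>P)"
    using kernel_integral(1)[OF X_measurable Er K eq1 clip_measurable clip_bounded] by (simp only: kK)
  also have "\<dots> = (\<integral>z. indicator {z. snd z = r} z * reg (xN z) \<partial>P)"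
    by (rule integral_cong_AE) (use kreg Er in \<open>auto elim!: eventually_mono\<close>)
  finally show ?thesis .
qed

text \<open>The regression does not depend on the pattern, so the identities for the finitely many
  patterns with this component add up.\<close>

lemma imputation:
  assumes "MMG P adj Kr" "PAI P adj Kr"
  shows "(\<integral>z. fst z v1 * mis z \<partial>P) = (\<integral>z. reg (xN z) * mis z \<partial>P)"
proof -
  let ?R = "{r. psi adj v1 (\<lambda>k. \<not> r k) = s}"
  have m: "mis z = (\<Sum>r\<in>?R. indicator {z. snd z = r} z)" for z
    by (auto simp: indicator_def ind_def sum.delta)
  have "(\<integral>z. fst z v1 * mis z \<partial>P) = (\<Sum>r\<in>?R. \<integral>z. indicator {z. snd z = r} z * fst z v1 \<partial>P)"
  proof (subst Bochner_Integration.integral_sum[symmetric])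
    fix r
    have "{z :: ('d \<Rightarrow> real) \<times> ('d \<Rightarrow> bool). snd z = r} \<in> sets P" by (rule R_sets)
    then have "integrable P (\<lambda>z. fst z v1 * indicator {z. snd z = r} z)"
      by (intro X_bounded_integrable[where B = 1]) (auto simp: indicator_def)
    then show "integrable P (\<lambda>z. indicator {z. snd z = r} z * fst z v1)" by (simp add: mult.commute)
  qed (simp add: m sum_distrib_left mult.commute)
  also have "\<dots> = (\<Sum>r\<in>?R. \<integral>z. indicator {z. snd z = r} z * reg (xN z) \<partial>P)"
    by (intro sum.cong refl imputation_pattern[OF assms]) simp
  also have "\<dots> = (\<integral>z. reg (xN z) * mis z \<partial>P)"
  proof (subst Bochner_Integration.integral_sum[symmetric])
    fix r
    have "{z :: ('d \<Rightarrow> real) \<times> ('d \<Rightarrow> bool). snd z = r} \<in> sets P" by (rule R_sets)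
    moreover have "\<bar>reg x\<bar> \<le> \<bar>Mb\<bar>" for x using nuis_bounded(2)[of x] by linarith
    ultimately show "integrable P (\<lambda>z. indicator {z. snd z = r} z * reg (xN z))"
      by (intro integrable_bounded[where B = "\<bar>Mb\<bar>"]) (auto simp: indicator_def simp del: abs_divide)
  qed (simp add: m sum_distrib_left mult.commute)
  finally show ?thesis .
qed

text \<open>Inside integrals against bounded functions of \<open>xN\<close>,
  \<open>X_1 * obs\<close> may be replaced by \<open>reg * obs\<close> and \<open>mis\<close> by
  \<open>odds * obs\<close>. After these replacements all terms carry the factor \<open>obs\<close>,
  and the rest is the expanded product of the two estimation errors.\<close>

lemma double_robust_bias:
  assumes "MMG P adj Kr" "PAI P adj Kr"
    and f [measurable]: "f \<in> borel_measurable Xsp" and fB: "\<And>x. \<bar>f x\<bar> \<le> B"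
    and g [measurable]: "g \<in> borel_measurable Xsp" and gB: "\<And>x. \<bar>g x\<bar> \<le> C"
  shows "\<bar>(\<integral>z. fst z v1 * f (xN z) * obs z + g (xN z) * (mis z - obs z * f (xN z)) \<partial>P) - (\<integral>z. fst z v1 * mis z \<partial>P)\<bar>
    \<le> (\<integral>z. \<bar>f (xN z) - odds (xN z)\<bar> * \<bar>g (xN z) - reg (xN z)\<bar> \<partial>P)"
proof -
  have Mb: "Mb \<ge> 0" "B \<ge> 0" "C \<ge> 0"
    using nuis_bounded(1)[of undefined] fB[of undefined] gB[of undefined] by linarith+
  have bd: "\<bar>u x * v x\<bar> \<le> a * b" if "\<And>x. \<bar>u x\<bar> \<le> a" "\<And>x. \<bar>v x\<bar> \<le> b" for u v :: "('d \<Rightarrow> real) \<Rightarrow> real" and a b x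
    using that[of x] unfolding abs_mult by (intro mult_mono) (auto intro: order_trans[OF abs_ge_zero])
  have oi: "integrable P (\<lambda>z. u (xN z) * obs z)" "integrable P (\<lambda>z. u (xN z) * mis z)"
    if "u \<in> borel_measurable Xsp" "\<And>x. \<bar>u x\<bar> \<le> b" for u and b :: real
  proof -
    have [measurable]: "u \<in> borel_measurable Xsp" by fact
    have b0: "0 \<le> b" using that(2)[of undefined] by linarith
    have ob: "\<bar>u (xN z) * obs z\<bar> \<le> b" "\<bar>u (xN z) * mis z\<bar> \<le> b" for z
      using that(2)[of "xN z"] b0 by (simp_all add: ind_def)
    show "integrable P (\<lambda>z. u (xN z) * obs z)" "integrable P (\<lambda>z. u (xN z) * mis z)"
      by (rule integrable_bounded[OF _ ob(1)] integrable_bounded[OF _ ob(2)], measurable)+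
  qed
  have p2ne: "p2 x \<noteq> 0" for x using p2_pos[of x] by simp
  have i_fg: "integrable P (\<lambda>z. (f (xN z) * g (xN z)) * obs z)"
    by (rule oi(1)[of "\<lambda>x. f x * g x" "B * C"]) (measurable, rule bd[of f B g C, OF fB gB])
  have i_fm: "integrable P (\<lambda>z. (f (xN z) * reg (xN z)) * obs z)"
    by (rule oi(1)[of "\<lambda>x. f x * reg x" "B * Mb"]) (measurable, rule bd[of f B "reg" Mb, OF fB nuis_bounded(2)])
  have i_og: "integrable P (\<lambda>z. (odds (xN z) * g (xN z)) * obs z)"
    by (rule oi(1)[of "\<lambda>x. odds x * g x" "Mb * C"]) (measurable, rule bd[of "odds" Mb g C, OF nuis_bounded(1) gB])
  have i_om: "integrable P (\<lambda>z. (odds (xN z) * reg (xN z)) * obs z)"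
    by (rule oi(1)[of "\<lambda>x. odds x * reg x" "Mb * Mb"]) (measurable, rule bd[of "odds" Mb "reg" Mb, OF nuis_bounded])
  have i_gb: "integrable P (\<lambda>z. g (xN z) * mis z)" by (rule oi(2)[OF g gB])
  have i_xf: "integrable P (\<lambda>z. fst z v1 * (f (xN z) * obs z))"
    by (rule X_bounded_integrable[where B = B]) (use fB Mb in \<open>auto simp: ind_def\<close>)
  \<comment> \<open>Exchange \<open>obs\<close> for \<open>p2\<close>, cancel it against the
    denominator of the ratio, and return from \<open>q\<close> to the data. The identity
    \<open>e_og\<close> does the same with \<open>p1\<close>.\<close>
  have e_fm: "(\<integral>z. (f (xN z) * reg (xN z)) * obs z \<partial>P) = (\<integral>z. fst z v1 * (f (xN z) * obs z) \<partial>P)"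
  proof -
    have "(\<integral>z. (f (xN z) * reg (xN z)) * obs z \<partial>P) = (\<integral>z. (f (xN z) * reg (xN z)) * p2 (xN z) \<partial>P)"
      by (rule cond_exp_bounded(2)[of "\<lambda>x. f x * reg x" "B * Mb"]) (measurable, rule bd[of f B "reg" Mb, OF fB nuis_bounded(2)])
    also have "\<dots> = (\<integral>z. f (xN z) * q (xN z) \<partial>P)" using p2ne by simp
    also have "\<dots> = (\<integral>z. f (xN z) * (fst z v1 * obs z) \<partial>P)" by (rule cond_exp_bounded(3)[OF f fB, symmetric])
    finally show ?thesis by (simp add: mult_ac)
  qed
  have e_og: "(\<integral>z. (odds (xN z) * g (xN z)) * obs z \<partial>P) = (\<integral>z. g (xN z) * mis z \<partial>P)"
    if g [measurable]: "g \<in> borel_measurable Xsp" and gB: "\<And>x. \<bar>g x\<bar> \<le> C" for g and C :: real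
  proof -
    have "(\<integral>z. (odds (xN z) * g (xN z)) * obs z \<partial>P) = (\<integral>z. (odds (xN z) * g (xN z)) * p2 (xN z) \<partial>P)"
      by (rule cond_exp_bounded(2)[of "\<lambda>x. odds x * g x" "Mb * C"]) (measurable, rule bd[of "odds" Mb g C, OF nuis_bounded(1) gB])
    also have "\<dots> = (\<integral>z. g (xN z) * p1 (xN z) \<partial>P)" using p2ne by (simp add: mult_ac)
    also have "\<dots> = (\<integral>z. g (xN z) * mis z \<partial>P)" by (rule cond_exp_bounded(1)[OF g gB, symmetric])
    finally show ?thesis .
  qed
  \<comment> \<open>The case \<open>g = reg\<close> of \<open>e_og\<close>, followed by imputation.
    This is where MMG and PAI enter the bias.\<close>
  have e_om: "(\<integral>z. (odds (xN z) * reg (xN z)) * obs z \<partial>P) = (\<integral>z. fst z v1 * mis z \<partial>P)"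
    using e_og[of reg Mb] nuis_bounded(2) imputation[OF assms(1,2)] by simp
  have "(\<integral>z. fst z v1 * f (xN z) * obs z + g (xN z) * (mis z - obs z * f (xN z)) \<partial>P)
     = (\<integral>z. fst z v1 * (f (xN z) * obs z) + g (xN z) * mis z - (f (xN z) * g (xN z)) * obs z \<partial>P)"
    by (rule Bochner_Integration.integral_cong) (auto simp: algebra_simps)
  also have "\<dots> = (\<integral>z. fst z v1 * (f (xN z) * obs z) \<partial>P) + (\<integral>z. g (xN z) * mis z \<partial>P) - (\<integral>z. (f (xN z) * g (xN z)) * obs z \<partial>P)"
    using i_fg i_gb i_xf by simp
  finally have "(\<integral>z. fst z v1 * f (xN z) * obs z + g (xN z) * (mis z - obs z * f (xN z)) \<partial>P) - (\<integral>z. fst z v1 * mis z \<partial>P)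
    = - ((\<integral>z. (f (xN z) * g (xN z)) * obs z \<partial>P) - (\<integral>z. (f (xN z) * reg (xN z)) * obs z \<partial>P)
       - (\<integral>z. (odds (xN z) * g (xN z)) * obs z \<partial>P) + (\<integral>z. (odds (xN z) * reg (xN z)) * obs z \<partial>P))"
    using e_fm e_og[OF g gB] e_om by linarith
  also have "\<dots> = - (\<integral>z. (f (xN z) * g (xN z)) * obs z - (f (xN z) * reg (xN z)) * obs z
       - (odds (xN z) * g (xN z)) * obs z + (odds (xN z) * reg (xN z)) * obs z \<partial>P)"
    using i_fg i_fm i_og i_om by simp
  also have "\<dots> = - (\<integral>z. (f (xN z) - odds (xN z)) * (g (xN z) - reg (xN z)) * obs z \<partial>P)"
    by (intro arg_cong[where f = uminus] Bochner_Integration.integral_cong) (auto simp: algebra_simps)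
  finally have bias: "(\<integral>z. fst z v1 * f (xN z) * obs z + g (xN z) * (mis z - obs z * f (xN z)) \<partial>P) - (\<integral>z. fst z v1 * mis z \<partial>P)
    = - (\<integral>z. (f (xN z) - odds (xN z)) * (g (xN z) - reg (xN z)) * obs z \<partial>P)" .
  have "\<bar>\<integral>z. (f (xN z) - odds (xN z)) * (g (xN z) - reg (xN z)) * obs z \<partial>P\<bar> \<le> (\<integral>z. \<bar>(f (xN z) - odds (xN z)) * (g (xN z) - reg (xN z)) * obs z\<bar> \<partial>P)"
    by (rule integral_abs_bound)
  also have "\<dots> \<le> (\<integral>z. \<bar>f (xN z) - odds (xN z)\<bar> * \<bar>g (xN z) - reg (xN z)\<bar> \<partial>P)"
  proof (rule integral_mono)
    have fo: "\<bar>f x - odds x\<bar> \<le> B + Mb" "\<bar>g x - reg x\<bar> \<le> C + Mb" for x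
      by (rule order_trans[OF abs_triangle_ineq4 add_mono[OF fB nuis_bounded(1)]]
          order_trans[OF abs_triangle_ineq4 add_mono[OF gB nuis_bounded(2)]])+
    have prod_bd: "\<bar>(f x - odds x) * (g x - reg x)\<bar> \<le> (B + Mb) * (C + Mb)" for x
      by (rule bd[of "\<lambda>x. f x - odds x" "B + Mb" "\<lambda>x. g x - reg x" "C + Mb", OF fo])
    have le: "\<bar>(f (xN z) - odds (xN z)) * (g (xN z) - reg (xN z)) * obs z\<bar>
        \<le> \<bar>f (xN z) - odds (xN z)\<bar> * \<bar>g (xN z) - reg (xN z)\<bar>" for z
      unfolding abs_mult by (intro mult_left_le) simp_all
    then show "\<bar>(f (xN z) - odds (xN z)) * (g (xN z) - reg (xN z)) * obs z\<bar>
        \<le> \<bar>f (xN z) - odds (xN z)\<bar> * \<bar>g (xN z) - reg (xN z)\<bar>" for z .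
    show i: "integrable P (\<lambda>z. \<bar>f (xN z) - odds (xN z)\<bar> * \<bar>g (xN z) - reg (xN z)\<bar>)"
      unfolding abs_mult[symmetric] by (rule integrable_abs, rule integrable_bounded[OF _ prod_bd]) measurable
    show "integrable P (\<lambda>z. \<bar>(f (xN z) - odds (xN z)) * (g (xN z) - reg (xN z)) * obs z\<bar>)"
      by (rule Bochner_Integration.integrable_bound[OF i]) (measurable, use le in simp)
  qed
  finally show ?thesis unfolding bias abs_minus_cancel .
qed

end

section \<open>Consistency\<close>

lemma (in nuisance) joint_measurable:
  fixes h :: "('d \<Rightarrow> real) \<Rightarrow> real"
  assumes "(\<lambda>(\<omega>, x). fhat \<omega> x) \<in> borel_measurable (M \<Otimes>\<^sub>M Xsp)" "h \<in> borel_measurable Xsp"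
  shows "(\<lambda>(\<omega>, z). fhat \<omega> (xN z) - h (xN z)) \<in> borel_measurable (M \<Otimes>\<^sub>M P)"
proof -
  have "(\<lambda>w. (fst w, xN (snd w))) \<in> measurable (M \<Otimes>\<^sub>M P) (M \<Otimes>\<^sub>M Xsp)" by measurable
  from measurable_compose[OF this assms(1)]
  have m: "(\<lambda>w. fhat (fst w) (xN (snd w))) \<in> borel_measurable (M \<Otimes>\<^sub>M P)" by simp
  have h: "(\<lambda>w. h (xN (snd w))) \<in> borel_measurable (M \<Otimes>\<^sub>M P)"
    by (rule measurable_compose[OF measurable_snd measurable_compose[OF nb_measurable assms(2)]])
  show ?thesis unfolding case_prod_unfold by (rule borel_measurable_diff[OF m h])
qed

text \<open>The resampling bound requires a bounded centre, while \<open>fstar\<close> is only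
  measurable. Truncating it at the bound of the class brings it closer to every member of the class,
  so convergence to the truncated limit is inherited.\<close>

lemma (in nuisance) estimator_L1:
  fixes M :: "'w measure" and B :: real
  assumes iid: "iid_seq M Z P"
    and meas: "\<And>n. (\<lambda>(\<omega>, x). fhat n \<omega> x) \<in> borel_measurable (M \<Otimes>\<^sub>M Xsp)"
    and D: "donsker (distr P Xsp xN) F" and FB: "\<And>f x. f \<in> F \<Longrightarrow> \<bar>f x\<bar> \<le> B"
    and fhat: "\<And>n \<omega>. \<omega> \<in> space M \<Longrightarrow> fhat n \<omega> \<in> F"
    and fstar: "fstar \<in> borel_measurable Xsp"
    and lim: "oP1 M (\<lambda>n \<omega>. L2n P (\<lambda>z. fhat n \<omega> (xN z) - fstar (xN z)))"
  shows "\<exists>f0\<in>borel_measurable Xsp. (\<forall>x. \<bar>f0 x\<bar> \<le> B) \<and>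
    vop M (\<lambda>n \<omega>. \<integral>z. \<bar>fhat n \<omega> (xN z) - f0 (xN z)\<bar> \<partial>P) \<and>
    vop M (\<lambda>n \<omega>. (\<Sum>i<n. \<bar>fhat n \<omega> (xN (Z i \<omega>)) - f0 (xN (Z i \<omega>))\<bar>) / real n)"
proof -
  interpret iid: iid_seq M Z P by fact
  interpret X: iid_seq M "\<lambda>i \<omega>. xN (Z i \<omega>)" "distr P Xsp xN"
    by (rule iid.iid_seq_compose[OF nb_measurable])
  obtain \<omega>0 where "\<omega>0 \<in> space M" using iid.not_empty by blast
  then have B: "B \<ge> 0" using FB[OF fhat, of \<omega>0 0 undefined] by linarith
  define f0 where "f0 x = max (-B) (min B (fstar x))" for x
  have f0 [measurable]: "f0 \<in> borel_measurable Xsp" unfolding f0_def using fstar by measurable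
  have f0B: "\<bar>f0 x\<bar> \<le> B" for x using B by (auto simp: f0_def)
  \<comment> \<open>Truncation is the projection onto \<open>{-B..B}\<close>, and the projection
    onto an interval does not increase the distance to its points.\<close>
  have closer: "\<bar>a - f0 x\<bar> \<le> \<bar>a - fstar x\<bar>" if "\<bar>a\<bar> \<le> B" for a x
    using that by (auto simp: f0_def max_def min_def)
  have fm: "fhat n \<omega> \<in> borel_measurable Xsp" if "\<omega> \<in> space M" for n \<omega>
    using measurable_compose[OF measurable_Pair1'[OF that] meas[of n]] by simp
  have L1: "vop M (\<lambda>n \<omega>. \<integral>z. \<bar>fhat n \<omega> (xN z) - f0 (xN z)\<bar> \<partial>P)"
  proof (rule oP1_imp_vop[OF lim])
    show "(\<lambda>\<omega>. L2n P (\<lambda>z. fhat n \<omega> (xN z) - fstar (xN z))) \<in> borel_measurable M" for n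
      by (rule L2n_measurable[OF prob_space_axioms joint_measurable[OF meas fstar]])
    fix n \<omega> assume \<omega>: "\<omega> \<in> space M"
    note [measurable] = fm[OF \<omega>, of n]
    have "\<bar>fhat n \<omega> (xN z) - f0 (xN z)\<bar> \<le> B + B" for z
      using FB[OF fhat[OF \<omega>], of n "xN z"] f0B[of "xN z"] by linarith
    then have "ennreal (\<integral>z. \<bar>fhat n \<omega> (xN z) - f0 (xN z)\<bar> \<partial>P) \<le> L2n P (\<lambda>z. fhat n \<omega> (xN z) - f0 (xN z))"
      by (intro integral_abs_le_L2n[of _ "B + B"]) measurable
    also have "\<dots> \<le> L2n P (\<lambda>z. fhat n \<omega> (xN z) - fstar (xN z))"
      by (intro L2n_mono closer FB fhat \<omega>)
    finally show "ennreal \<bar>\<integral>z. \<bar>fhat n \<omega> (xN z) - f0 (xN z)\<bar> \<partial>P\<bar> \<le> L2n P (\<lambda>z. fhat n \<omega> (xN z) - fstar (xN z))"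
      by (simp add: integral_nonneg_AE)
  qed
  have "vop M (\<lambda>n \<omega>. \<integral>y. \<bar>fhat n \<omega> y - f0 y\<bar> \<partial>distr P Xsp xN)"
  proof (rule iid.vop_dominated[OF L1], rule AE_I2, intro allI impI)
    fix \<omega> and n :: nat assume \<omega>: "\<omega> \<in> space M"
    note [measurable] = fm[OF \<omega>, of n]
    show "\<bar>\<integral>y. \<bar>fhat n \<omega> y - f0 y\<bar> \<partial>distr P Xsp xN\<bar> \<le> \<bar>\<integral>z. \<bar>fhat n \<omega> (xN z) - f0 (xN z)\<bar> \<partial>P\<bar>"
      by (subst integral_distr) auto
  qed
  then have "vop M (\<lambda>n \<omega>. (\<Sum>i<n. \<bar>fhat n \<omega> (xN (Z i \<omega>)) - f0 (xN (Z i \<omega>))\<bar>) / real n)"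
    by (intro X.empirical_L1_vanishes[where F = F and B = B]) (use D FB f0B fhat in auto)
  with f0 f0B L1 show ?thesis by blast
qed

section \<open>Scores of a single connected set and their consistency\<close>

context nuisance
begin

text \<open>Summand of the estimator. Regrouped it reads
  \<open>g * mis + f * obs * (X_1 - g)\<close>: imputation by \<open>g\<close>, corrected by
  residuals of the observed units weighted with the odds \<open>f\<close>.\<close>

definition score :: "(('d \<Rightarrow> real) \<Rightarrow> real) \<Rightarrow> (('d \<Rightarrow> real) \<Rightarrow> real) \<Rightarrow> ('d \<Rightarrow> real) \<times> ('d \<Rightarrow> bool) \<Rightarrow> real" where
  "score f g z = fst z v1 * f (xN z) * obs z + g (xN z) * (mis z - obs z * f (xN z))"

lemma score_measurable [measurable]:
  assumes [measurable]: "f \<in> borel_measurable Xsp" "g \<in> borel_measurable Xsp"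
  shows "score f g \<in> borel_measurable P"
  unfolding score_def by measurable

lemma weight_bounded:
  assumes "\<bar>a\<bar> \<le> B"
  shows "\<bar>mis z - obs z * a\<bar> \<le> 1 + B"
proof -
  have "\<bar>obs z * a\<bar> \<le> 1 * \<bar>a\<bar>" unfolding abs_mult by (intro mult_right_mono) auto
  then have "\<bar>obs z * a\<bar> \<le> B" using assms by simp
  then show ?thesis using ind_simps(3,4)[of "psi adj v1 (\<lambda>k. \<not> snd z k) = s"] by linarith
qed

text \<open>The score is bilinear up to lower-order terms, so it is Lipschitz only on bounded sets.
  Bounds on \<open>f\<close> and on \<open>g'\<close> suffice, because the two arguments are changed
  one after the other.\<close>

lemma score_lipschitz:
  assumes x: "\<bar>fst z v1\<bar> \<le> Mb" and "\<bar>f (xN z)\<bar> \<le> B" "\<bar>g' (xN z)\<bar> \<le> C"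
  shows "\<bar>score f g z - score f' g' z\<bar> \<le> (Mb + C) * \<bar>f (xN z) - f' (xN z)\<bar> + (1 + B) * \<bar>g (xN z) - g' (xN z)\<bar>"
proof -
  define a b u v w where "a = f (xN z) - f' (xN z)" and "b = g (xN z) - g' (xN z)"
    and "u = fst z v1 * obs z" and "v = mis z - obs z * f (xN z)" and "w = g' (xN z) * obs z"
  have u: "\<bar>u\<bar> \<le> Mb" using x by (auto simp: u_def ind_def)
  have w: "\<bar>w\<bar> \<le> C" using assms(3) by (auto simp: w_def ind_def)
  have v: "\<bar>v\<bar> \<le> 1 + B" unfolding v_def by (rule weight_bounded) fact
  \<comment> \<open>Telescoping in the second part: \<open>g\<close> is replaced by
    \<open>g'\<close> with \<open>f\<close> in place, giving \<open>b * v\<close>, and then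
    \<open>f\<close> by \<open>f'\<close> with \<open>g'\<close> in place, giving
    \<open>- w * a\<close>.\<close>
  have "score f g z - score f' g' z = u * a + b * v - w * a"
    unfolding score_def a_def b_def u_def v_def w_def by (simp add: algebra_simps)
  also have "\<bar>\<dots>\<bar> \<le> \<bar>u\<bar> * \<bar>a\<bar> + \<bar>b\<bar> * \<bar>v\<bar> + \<bar>w\<bar> * \<bar>a\<bar>"
    unfolding abs_mult[symmetric] by linarith
  also have "\<dots> \<le> Mb * \<bar>a\<bar> + \<bar>b\<bar> * (1 + B) + C * \<bar>a\<bar>"
    by (intro add_mono mult_right_mono mult_left_mono u v w) auto
  finally show ?thesis by (simp add: a_def b_def algebra_simps)
qed

lemma score_bounded:
  assumes x: "\<bar>fst z v1\<bar> \<le> Mb" and "\<bar>f (xN z)\<bar> \<le> B" "\<bar>g (xN z)\<bar> \<le> C"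
  shows "\<bar>score f g z\<bar> \<le> Mb * B + C * (1 + B)"
proof -
  have "\<bar>score f g z\<bar> \<le> \<bar>fst z v1\<bar> * \<bar>f (xN z)\<bar> * \<bar>obs z\<bar> + \<bar>g (xN z)\<bar> * \<bar>mis z - obs z * f (xN z)\<bar>"
    unfolding score_def abs_mult[symmetric] by linarith
  also have "\<dots> \<le> Mb * B * 1 + C * (1 + B)"
    using assms by (intro add_mono mult_mono weight_bounded) (auto intro: order_trans[OF abs_ge_zero])
  finally show ?thesis by simp
qed

lemma abs_diff_integrable:
  fixes u v :: "('d \<Rightarrow> real) \<Rightarrow> real"
  assumes "u \<in> borel_measurable Xsp" "v \<in> borel_measurable Xsp"
    and b: "\<And>x. \<bar>u x\<bar> \<le> b" "\<And>x. \<bar>v x\<bar> \<le> b"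
  shows "integrable P (\<lambda>z. \<bar>u (xN z) - v (xN z)\<bar>)"
proof (rule integrable_abs, rule integrable_bounded)
  show "(\<lambda>z. u (xN z) - v (xN z)) \<in> borel_measurable P"
    by (intro borel_measurable_diff measurable_compose[OF nb_measurable] assms)
  show "\<bar>u (xN z) - v (xN z)\<bar> \<le> b + b" for z
    using b(1)[of "xN z"] b(2)[of "xN z"] by linarith
qed

text \<open>A detour through the fixed limits: the empirical score at the estimators is compared
  with that at \<open>f0\<close> and \<open>g0\<close>, then with its mean, and from there with the
  mean at the estimators. The bias at the estimators closes the chain, so \<open>f0\<close> and
  \<open>g0\<close> need not be correct.\<close>

lemma component_consistent:
  fixes M :: "'w measure" and B C :: real
  assumes iid: "iid_seq M Z P" and MP: "MMG P adj Kr" "PAI P adj Kr"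
    and fmeas: "\<And>n. (\<lambda>(\<omega>, x). fhat n \<omega> x) \<in> borel_measurable (M \<Otimes>\<^sub>M Xsp)"
    and gmeas: "\<And>n. (\<lambda>(\<omega>, x). ghat n \<omega> x) \<in> borel_measurable (M \<Otimes>\<^sub>M Xsp)"
    and F: "donsker (distr P Xsp xN) F" "\<And>f x. f \<in> F \<Longrightarrow> \<bar>f x\<bar> \<le> B" "\<And>n \<omega>. \<omega> \<in> space M \<Longrightarrow> fhat n \<omega> \<in> F"
    and G: "donsker (distr P Xsp xN) G" "\<And>g x. g \<in> G \<Longrightarrow> \<bar>g x\<bar> \<le> C" "\<And>n \<omega>. \<omega> \<in> space M \<Longrightarrow> ghat n \<omega> \<in> G"
    and fstar: "fstar \<in> borel_measurable Xsp" "oP1 M (\<lambda>n \<omega>. L2n P (\<lambda>z. fhat n \<omega> (xN z) - fstar (xN z)))"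
    and gstar: "gstar \<in> borel_measurable Xsp" "oP1 M (\<lambda>n \<omega>. L2n P (\<lambda>z. ghat n \<omega> (xN z) - gstar (xN z)))"
    and bias: "vop M (\<lambda>n \<omega>. \<integral>z. \<bar>fhat n \<omega> (xN z) - odds (xN z)\<bar> * \<bar>ghat n \<omega> (xN z) - reg (xN z)\<bar> \<partial>P)"
  shows "vop M (\<lambda>n \<omega>. (\<Sum>i<n. score (fhat n \<omega>) (ghat n \<omega>) (Z i \<omega>)) / real n - (\<integral>z. fst z v1 * mis z \<partial>P))"
proof -
  interpret iid: iid_seq M Z P by fact
  have "\<exists>f0\<in>borel_measurable Xsp. (\<forall>x. \<bar>f0 x\<bar> \<le> B) \<and>
    vop M (\<lambda>n \<omega>. \<integral>z. \<bar>fhat n \<omega> (xN z) - f0 (xN z)\<bar> \<partial>P) \<and>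
    vop M (\<lambda>n \<omega>. (\<Sum>i<n. \<bar>fhat n \<omega> (xN (Z i \<omega>)) - f0 (xN (Z i \<omega>))\<bar>) / real n)"
    by (rule estimator_L1[where F = F and fstar = fstar]) (use iid fmeas F fstar in blast)+
  then obtain f0 where f0 [measurable]: "f0 \<in> borel_measurable Xsp" and f0B: "\<And>x. \<bar>f0 x\<bar> \<le> B"
    and f0P: "vop M (\<lambda>n \<omega>. \<integral>z. \<bar>fhat n \<omega> (xN z) - f0 (xN z)\<bar> \<partial>P)"
    and f0n: "vop M (\<lambda>n \<omega>. (\<Sum>i<n. \<bar>fhat n \<omega> (xN (Z i \<omega>)) - f0 (xN (Z i \<omega>))\<bar>) / real n)" by blast
  have "\<exists>f0\<in>borel_measurable Xsp. (\<forall>x. \<bar>f0 x\<bar> \<le> C) \<and>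
    vop M (\<lambda>n \<omega>. \<integral>z. \<bar>ghat n \<omega> (xN z) - f0 (xN z)\<bar> \<partial>P) \<and>
    vop M (\<lambda>n \<omega>. (\<Sum>i<n. \<bar>ghat n \<omega> (xN (Z i \<omega>)) - f0 (xN (Z i \<omega>))\<bar>) / real n)"
    by (rule estimator_L1[where F = G and fstar = gstar]) (use iid gmeas G gstar in blast)+
  then obtain g0 where g0 [measurable]: "g0 \<in> borel_measurable Xsp" and g0B: "\<And>x. \<bar>g0 x\<bar> \<le> C"
    and g0P: "vop M (\<lambda>n \<omega>. \<integral>z. \<bar>ghat n \<omega> (xN z) - g0 (xN z)\<bar> \<partial>P)"
    and g0n: "vop M (\<lambda>n \<omega>. (\<Sum>i<n. \<bar>ghat n \<omega> (xN (Z i \<omega>)) - g0 (xN (Z i \<omega>))\<bar>) / real n)" by blast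
  define EF EG where "EF n \<omega> = (\<Sum>i<n. \<bar>fhat n \<omega> (xN (Z i \<omega>)) - f0 (xN (Z i \<omega>))\<bar>) / real n"
    and "EG n \<omega> = (\<Sum>i<n. \<bar>ghat n \<omega> (xN (Z i \<omega>)) - g0 (xN (Z i \<omega>))\<bar>) / real n" for n \<omega>
  define PF PG where "PF n \<omega> = (\<integral>z. \<bar>fhat n \<omega> (xN z) - f0 (xN z)\<bar> \<partial>P)"
    and "PG n \<omega> = (\<integral>z. \<bar>ghat n \<omega> (xN z) - g0 (xN z)\<bar> \<partial>P)" for n \<omega>
  define L where "L n \<omega> = (\<Sum>i<n. score f0 g0 (Z i \<omega>)) / real n - (\<integral>z. score f0 g0 z \<partial>P)" for n \<omega>
  define R where "R n \<omega> = (\<integral>z. \<bar>fhat n \<omega> (xN z) - odds (xN z)\<bar> * \<bar>ghat n \<omega> (xN z) - reg (xN z)\<bar> \<partial>P)" for n \<omega>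
  define \<mu> where "\<mu> = (\<integral>z. fst z v1 * mis z \<partial>P)"
  define A D where "A = Mb + C" and "D = 1 + B"
  have nonneg: "Mb \<ge> 0" "B \<ge> 0" "C \<ge> 0"
    using nuis_bounded(1)[of undefined] f0B[of undefined] g0B[of undefined] by linarith+
  have s0B: "AE z in P. \<bar>score f0 g0 z\<bar> \<le> Mb * B + C * (1 + B)"
    using X_bounded by eventually_elim (rule score_bounded[OF _ f0B g0B])
  have Lv: "vop M L"
    unfolding L_def by (rule iid.lln_bounded[OF _ s0B]) measurable
  have "vop M (\<lambda>n \<omega>. A * (EF n \<omega> + PF n \<omega>) + D * (EG n \<omega> + PG n \<omega>) + \<bar>L n \<omega>\<bar> + R n \<omega>)"
    using f0P f0n g0P g0n bias Lv
    unfolding EF_def[symmetric] EG_def[symmetric] PF_def[symmetric] PG_def[symmetric] R_def[symmetric]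
    by (intro iid.vop_add iid.vop_cmult) (auto simp: vop_def)
  then show ?thesis
  proof (rule iid.vop_dominated)
    \<comment> \<open>Countably many null sets are removed at once, so the Lipschitz bound applies
      to the whole sample path.\<close>
    have "AE \<omega> in M. \<bar>fst (Z i \<omega>) v1\<bar> \<le> Mb" for i
      by (rule AE_distrD[OF iid.Z_meas]) (subst iid.Z_distr, rule X_bounded)
    then have "AE \<omega> in M. \<forall>i. \<bar>fst (Z i \<omega>) v1\<bar> \<le> Mb" by (subst AE_all_countable) simp
    then show "AE \<omega> in M. \<forall>n>0. \<bar>(\<Sum>i<n. score (fhat n \<omega>) (ghat n \<omega>) (Z i \<omega>)) / real n - (\<integral>z. fst z v1 * mis z \<partial>P)\<bar>
       \<le> \<bar>A * (EF n \<omega> + PF n \<omega>) + D * (EG n \<omega> + PG n \<omega>) + \<bar>L n \<omega>\<bar> + R n \<omega>\<bar>"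
      using AE_space
    proof eventually_elim
      case (elim \<omega>)
      show ?case
      proof (intro allI impI)
        fix n :: nat assume n: "n > 0"
        define f g where "f = fhat n \<omega>" and "g = ghat n \<omega>"
        have [measurable]: "f \<in> borel_measurable Xsp" "g \<in> borel_measurable Xsp"
          using measurable_compose[OF measurable_Pair1'[OF elim(2)] fmeas[of n]]
            measurable_compose[OF measurable_Pair1'[OF elim(2)] gmeas[of n]] by (simp_all add: f_def g_def)
        have fB: "\<bar>f x\<bar> \<le> B" and gB: "\<bar>g x\<bar> \<le> C" for x
          unfolding f_def g_def using F(2,3) G(2,3) elim(2) by blast+
        have si: "integrable P (score u v)"
          if "u \<in> borel_measurable Xsp" "v \<in> borel_measurable Xsp" "\<And>x. \<bar>u x\<bar> \<le> B" "\<And>x. \<bar>v x\<bar> \<le> C" for u v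
        proof (rule integrable_const_bound)
          show "AE z in P. norm (score u v z) \<le> Mb * B + C * (1 + B)"
            unfolding real_norm_def using X_bounded by eventually_elim (rule score_bounded[OF _ that(3,4)])
        qed (rule score_measurable[OF that(1,2)])
        have df: "integrable P (\<lambda>z. \<bar>f (xN z) - f0 (xN z)\<bar>)"
          by (rule abs_diff_integrable[OF _ _ fB f0B]) measurable
        have dg: "integrable P (\<lambda>z. \<bar>g (xN z) - g0 (xN z)\<bar>)"
          by (rule abs_diff_integrable[OF _ _ gB g0B]) measurable
        have 1: "\<bar>(\<Sum>i<n. score f g (Z i \<omega>)) / real n - (\<Sum>i<n. score f0 g0 (Z i \<omega>)) / real n\<bar> \<le> A * EF n \<omega> + D * EG n \<omega>"
        proof -
          have "\<bar>(\<Sum>i<n. score f g (Z i \<omega>)) - (\<Sum>i<n. score f0 g0 (Z i \<omega>))\<bar>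
            \<le> (\<Sum>i<n. A * \<bar>f (xN (Z i \<omega>)) - f0 (xN (Z i \<omega>))\<bar> + D * \<bar>g (xN (Z i \<omega>)) - g0 (xN (Z i \<omega>))\<bar>)"
            unfolding sum_subtractf[symmetric] A_def D_def
            by (rule order_trans[OF sum_abs sum_mono]) (intro score_lipschitz fB g0B, use elim(1) in blast)
          also have "\<dots> = real n * (A * EF n \<omega> + D * EG n \<omega>)"
            using n by (simp add: EF_def EG_def f_def g_def sum.distrib sum_distrib_left[symmetric] distrib_left)
          finally show ?thesis
            using n by (simp add: diff_divide_distrib[symmetric] abs_divide pos_divide_le_eq mult.commute)
        qed
        have 2: "\<bar>(\<integral>z. score f0 g0 z \<partial>P) - (\<integral>z. score f g z \<partial>P)\<bar> \<le> A * PF n \<omega> + D * PG n \<omega>"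
        proof -
          have "(\<integral>z. score f0 g0 z \<partial>P) - (\<integral>z. score f g z \<partial>P) = - (\<integral>z. score f g z - score f0 g0 z \<partial>P)"
            using si[of f g] si[of f0 g0] fB gB f0B g0B by simp
          then have "\<bar>(\<integral>z. score f0 g0 z \<partial>P) - (\<integral>z. score f g z \<partial>P)\<bar> \<le> (\<integral>z. \<bar>score f g z - score f0 g0 z\<bar> \<partial>P)"
            using integral_abs_bound[of P "\<lambda>z. score f g z - score f0 g0 z"] by simp
          also have "\<dots> \<le> (\<integral>z. A * \<bar>f (xN z) - f0 (xN z)\<bar> + D * \<bar>g (xN z) - g0 (xN z)\<bar> \<partial>P)"
          proof (rule integral_mono_AE)
            show "AE z in P. \<bar>score f g z - score f0 g0 z\<bar> \<le> A * \<bar>f (xN z) - f0 (xN z)\<bar> + D * \<bar>g (xN z) - g0 (xN z)\<bar>"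
              unfolding A_def D_def using X_bounded by eventually_elim (intro score_lipschitz fB g0B)
            show "integrable P (\<lambda>z. A * \<bar>f (xN z) - f0 (xN z)\<bar> + D * \<bar>g (xN z) - g0 (xN z)\<bar>)"
              using df dg by simp
          qed (use si[of f g] si[of f0 g0] fB gB f0B g0B in \<open>auto intro!: integrable_abs\<close>)
          also have "\<dots> = A * PF n \<omega> + D * PG n \<omega>"
            using df dg by (simp add: PF_def PG_def f_def g_def)
          finally show ?thesis .
        qed
        \<comment> \<open>With the outcome \<omega> held fixed, the estimators are ordinary
          functions, and the integral ranges over an independent data point; the bias bound for
          deterministic functions applies.\<close>
        have 3: "\<bar>(\<integral>z. score f g z \<partial>P) - \<mu>\<bar> \<le> R n \<omega>"
          unfolding score_def \<mu>_def R_def f_def[symmetric] g_def[symmetric]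
          by (rule double_robust_bias[OF MP \<open>f \<in> borel_measurable Xsp\<close> fB \<open>g \<in> borel_measurable Xsp\<close> gB])
        have "\<bar>(\<Sum>i<n. score f g (Z i \<omega>)) / real n - \<mu>\<bar> \<le> A * EF n \<omega> + D * EG n \<omega> + (A * PF n \<omega> + D * PG n \<omega>) + \<bar>L n \<omega>\<bar> + R n \<omega>"
          using 1 2 3 unfolding L_def by linarith
        also have "\<dots> = A * (EF n \<omega> + PF n \<omega>) + D * (EG n \<omega> + PG n \<omega>) + \<bar>L n \<omega>\<bar> + R n \<omega>"
          by (simp add: algebra_simps)
        finally show "\<bar>(\<Sum>i<n. score (fhat n \<omega>) (ghat n \<omega>) (Z i \<omega>)) / real n - (\<integral>z. fst z v1 * mis z \<partial>P)\<bar>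
          \<le> \<bar>A * (EF n \<omega> + PF n \<omega>) + D * (EG n \<omega> + PG n \<omega>) + \<bar>L n \<omega>\<bar> + R n \<omega>\<bar>"
          unfolding f_def g_def \<mu>_def by linarith
      qed
    qed
  qed
qed

end

theorem theorem6:
  fixes M :: "'w measure"
    and Z :: "nat \<Rightarrow> 'w \<Rightarrow> ('d::finite \<Rightarrow> real) \<times> ('d \<Rightarrow> bool)"
    and P :: "(('d \<Rightarrow> real) \<times> ('d \<Rightarrow> bool)) measure"
    and adj :: "'d \<Rightarrow> 'd \<Rightarrow> bool" and v1 :: 'd
    and Ohat mhat :: "nat \<Rightarrow> 'd set \<Rightarrow> 'w \<Rightarrow> ('d \<Rightarrow> real) \<Rightarrow> real"
    and Fc Gc :: "'d set \<Rightarrow> (('d \<Rightarrow> real) \<Rightarrow> real) set"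
    and FcEnv GcEnv :: "'d set \<Rightarrow> ('d \<Rightarrow> real) \<Rightarrow> real"
    and Ostar mstar :: "'d set \<Rightarrow> ('d \<Rightarrow> real) \<Rightarrow> real"
    and p1 p2 q :: "'d set \<Rightarrow> ('d \<Rightarrow> real) \<Rightarrow> real"
    and Mb :: real
  assumes M_prob: "prob_space M"
    and adj_sym: "\<forall>a b. adj a b \<longrightarrow> adj b a"
    and adj_irrefl: "\<forall>a. \<not> adj a a"
    and Z_meas: "\<forall>i. Z i \<in> measurable M Dsp"
    and Z_indep: "prob_space.indep_vars M (\<lambda>_. Dsp) Z UNIV"
    and Z_distr: "\<forall>i. distr M Dsp (Z i) = P"
    and MMG_PAI: "\<exists>Kr. MMG P adj Kr \<and> PAI P adj Kr"
    and p1_ver: "\<forall>s\<in>Jset adj v1. cond_exp_fn P (\<lambda>z. ind (psi adj v1 (\<lambda>k. \<not> snd z k) = s))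
                   (\<lambda>z. restr (nbr adj s) (fst z)) Xsp (p1 s)"
    and p2_ver: "\<forall>s\<in>Jset adj v1. cond_exp_fn P (\<lambda>z. ind (allobs (cnbr adj s) (snd z)))
                   (\<lambda>z. restr (nbr adj s) (fst z)) Xsp (p2 s)"
    and q_ver: "\<forall>s\<in>Jset adj v1. cond_exp_fn P (\<lambda>z. fst z v1 * ind (allobs (cnbr adj s) (snd z)))
                   (\<lambda>z. restr (nbr adj s) (fst z)) Xsp (q s)"
    and p2_pos: "\<forall>s\<in>Jset adj v1. \<forall>x. p2 s x > 0"
    and est_meas: "\<forall>n. \<forall>s\<in>Jset adj v1.
        (\<lambda>(\<omega>, x). Ohat n s \<omega> x) \<in> borel_measurable (M \<Otimes>\<^sub>M Xsp) \<and>
        (\<lambda>(\<omega>, x). mhat n s \<omega> x) \<in> borel_measurable (M \<Otimes>\<^sub>M Xsp)"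
    and est_sample: "\<forall>n. \<forall>s\<in>Jset adj v1. \<forall>\<omega>\<in>space M. \<forall>\<omega>'\<in>space M.
        (\<forall>i<n. Z i \<omega> = Z i \<omega>') \<longrightarrow> Ohat n s \<omega> = Ohat n s \<omega>' \<and> mhat n s \<omega> = mhat n s \<omega>'"
    and A1_class: "\<forall>s\<in>Jset adj v1.
        unif_bounded (Fc s) \<and> donsker (distr P Xsp (\<lambda>z. restr (nbr adj s) (fst z))) (Fc s) \<and>
        unif_bounded (Gc s) \<and> donsker (distr P Xsp (\<lambda>z. restr (nbr adj s) (fst z))) (Gc s) \<and>
        (\<forall>n. \<forall>\<omega>\<in>space M. Ohat n s \<omega> \<in> Fc s \<and> mhat n s \<omega> \<in> Gc s)"
    and A1_limit: "\<forall>s\<in>Jset adj v1.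
        Ostar s \<in> borel_measurable Xsp \<and> mstar s \<in> borel_measurable Xsp \<and>
        oP1 M (\<lambda>n \<omega>. L2n P (\<lambda>z. Ohat n s \<omega> (restr (nbr adj s) (fst z)) - Ostar s (restr (nbr adj s) (fst z)))) \<and>
        oP1 M (\<lambda>n \<omega>. L2n P (\<lambda>z. mhat n s \<omega> (restr (nbr adj s) (fst z)) - mstar s (restr (nbr adj s) (fst z))))"
    and A2_pos: "Mb > 0"
    and A2_X: "AE z in P. \<bar>fst z v1\<bar> \<le> Mb"
    and A2_nuis: "\<forall>s\<in>Jset adj v1. \<forall>x. \<bar>p1 s x / p2 s x\<bar> \<le> Mb \<and> \<bar>q s x / p2 s x\<bar> \<le> Mb"
    and A3: "oP1 M (\<lambda>n \<omega>. \<Sum>s\<in>Jset adj v1.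
        L2n P (\<lambda>z. Ohat n s \<omega> (restr (nbr adj s) (fst z)) - p1 s (restr (nbr adj s) (fst z)) / p2 s (restr (nbr adj s) (fst z))) *
        L2n P (\<lambda>z. mhat n s \<omega> (restr (nbr adj s) (fst z)) - q s (restr (nbr adj s) (fst z)) / p2 s (restr (nbr adj s) (fst z))))"
    and A4: "\<forall>s\<in>Jset adj v1.
        unif_entropy (distr P Xsp (\<lambda>z. restr (nbr adj s) (fst z))) (Fc s) (FcEnv s) \<and>
        unif_entropy (distr P Xsp (\<lambda>z. restr (nbr adj s) (fst z))) (Gc s) (GcEnv s)"
  shows "\<forall>e>0. (\<lambda>n. measure M {\<omega>\<in>space M. \<bar>muhat adj v1 Z Ohat mhat n \<omega> - (\<integral>z. fst z v1 \<partial>P)\<bar> > e})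
                 \<longlonglongrightarrow> 0"
proof -
  interpret M: prob_space M by (rule M_prob)
  have sets_P: "sets P = sets Dsp" using Z_distr sets_distr by metis
  interpret iid: iid_seq M Z P
  proof unfold_locales
    show "Z i \<in> measurable M P" for i
      using Z_meas by (simp add: measurable_cong_sets[OF refl sets_P])
    show "M.indep_vars (\<lambda>_. P) Z UNIV"
      using Z_indep by (simp add: M.indep_vars_def sets_P measurable_cong_sets[OF refl sets_P])
    show "distr M P (Z i) = P" for i
      using Z_distr distr_cong[OF refl sets_P, of M "Z i" "Z i"] by simp
  qed
  interpret md: missing_data P adj v1 Mb
    by (intro missing_data.intro missing_data_axioms.intro iid.prob_space_law sets_P A2_X)
  obtain Kr where MP: "MMG P adj Kr" "PAI P adj Kr" using MMG_PAI by blast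
  let ?J = "Jset adj v1"
  let ?mis = "\<lambda>s z. ind (psi adj v1 (\<lambda>k. \<not> snd z k) = s)"
  have nuis: "nuisance P adj v1 Mb s (p1 s) (p2 s) (q s)" if "s \<in> ?J" for s
    using that p1_ver p2_ver q_ver p2_pos A2_nuis by unfold_locales auto
  define T where "T s n \<omega> = (\<Sum>i<n. nuisance.score adj v1 s (Ohat n s \<omega>) (mhat n s \<omega>) (Z i \<omega>)) / real n
      - (\<integral>z. fst z v1 * ?mis s z \<partial>P)" for s n \<omega>
  have T: "vop M (T s)" if s: "s \<in> ?J" for s
  proof -
    interpret N: nuisance P adj v1 Mb s "p1 s" "p2 s" "q s" by (rule nuis[OF s])
    have meas: "(\<lambda>(\<omega>, x). Ohat n s \<omega> x) \<in> borel_measurable (M \<Otimes>\<^sub>M Xsp)"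
      "(\<lambda>(\<omega>, x). mhat n s \<omega> x) \<in> borel_measurable (M \<Otimes>\<^sub>M Xsp)" for n
      using est_meas s by blast+
    have D: "donsker (distr P Xsp N.xN) (Fc s)" "donsker (distr P Xsp N.xN) (Gc s)"
      and mem: "\<And>n \<omega>. \<omega> \<in> space M \<Longrightarrow> Ohat n s \<omega> \<in> Fc s" "\<And>n \<omega>. \<omega> \<in> space M \<Longrightarrow> mhat n s \<omega> \<in> Gc s"
      using A1_class s by blast+
    obtain B C where B: "\<And>f x. f \<in> Fc s \<Longrightarrow> \<bar>f x\<bar> \<le> B" and C: "\<And>g x. g \<in> Gc s \<Longrightarrow> \<bar>g x\<bar> \<le> C"
      using A1_class s unfolding unif_bounded_def by metis
    let ?e = "\<lambda>n \<omega> z. Ohat n s \<omega> (N.xN z) - p1 s (N.xN z) / p2 s (N.xN z)"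
    let ?d = "\<lambda>n \<omega> z. mhat n s \<omega> (N.xN z) - q s (N.xN z) / p2 s (N.xN z)"
    \<comment> \<open>By Cauchy-Schwarz this is at most the summand for \<open>s\<close> in the rate
      condition. All summands are nonnegative, so the whole sum dominates it.\<close>
    have bias: "vop M (\<lambda>n \<omega>. \<integral>z. \<bar>?e n \<omega> z\<bar> * \<bar>?d n \<omega> z\<bar> \<partial>P)"
    proof (rule oP1_imp_vop[OF A3])
      fix n
      show "(\<lambda>\<omega>. \<Sum>s\<in>?J. L2n P (\<lambda>z. Ohat n s \<omega> (restr (nbr adj s) (fst z)) - p1 s (restr (nbr adj s) (fst z)) / p2 s (restr (nbr adj s) (fst z))) *
          L2n P (\<lambda>z. mhat n s \<omega> (restr (nbr adj s) (fst z)) - q s (restr (nbr adj s) (fst z)) / p2 s (restr (nbr adj s) (fst z)))) \<in> borel_measurable M"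
      proof (rule borel_measurable_sum)
        fix t assume t: "t \<in> ?J"
        interpret Nt: nuisance P adj v1 Mb t "p1 t" "p2 t" "q t" by (rule nuis[OF t])
        have m: "(\<lambda>(\<omega>, x). Ohat n t \<omega> x) \<in> borel_measurable (M \<Otimes>\<^sub>M Xsp)"
          "(\<lambda>(\<omega>, x). mhat n t \<omega> x) \<in> borel_measurable (M \<Otimes>\<^sub>M Xsp)"
          using est_meas t by blast+
        show "(\<lambda>\<omega>. L2n P (\<lambda>z. Ohat n t \<omega> (Nt.xN z) - p1 t (Nt.xN z) / p2 t (Nt.xN z)) *
          L2n P (\<lambda>z. mhat n t \<omega> (Nt.xN z) - q t (Nt.xN z) / p2 t (Nt.xN z))) \<in> borel_measurable M"
          by (intro borel_measurable_times_ennreal L2n_measurable[OF iid.prob_space_law]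
              Nt.joint_measurable[where h = "\<lambda>x. p1 t x / p2 t x", OF m(1)]
              Nt.joint_measurable[where h = "\<lambda>x. q t x / p2 t x", OF m(2)]) measurable
      qed
      fix \<omega> assume \<omega>: "\<omega> \<in> space M"
      have fm: "Ohat n s \<omega> \<in> borel_measurable Xsp" "mhat n s \<omega> \<in> borel_measurable Xsp"
        using measurable_compose[OF measurable_Pair1'[OF \<omega>] meas(1)[of n]]
          measurable_compose[OF measurable_Pair1'[OF \<omega>] meas(2)[of n]] by simp_all
      have "?e n \<omega> \<in> borel_measurable P" "?d n \<omega> \<in> borel_measurable P"
        by (intro borel_measurable_diff borel_measurable_divide measurable_compose[OF md.nb_measurable] fm N.nuis_measurable)+
      moreover have "\<bar>?e n \<omega> z\<bar> \<le> B + Mb" "\<bar>?d n \<omega> z\<bar> \<le> C + Mb" for z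
        by (rule order_trans[OF abs_triangle_ineq4] add_mono B C mem \<omega> N.nuis_bounded)+
      ultimately have "ennreal (\<integral>z. \<bar>?e n \<omega> z\<bar> * \<bar>?d n \<omega> z\<bar> \<partial>P) \<le> L2n P (?e n \<omega>) * L2n P (?d n \<omega>)"
        by (rule md.integral_mult_le_L2n)
      also have "\<dots> \<le> (\<Sum>s\<in>?J. L2n P (\<lambda>z. Ohat n s \<omega> (restr (nbr adj s) (fst z)) - p1 s (restr (nbr adj s) (fst z)) / p2 s (restr (nbr adj s) (fst z))) *
          L2n P (\<lambda>z. mhat n s \<omega> (restr (nbr adj s) (fst z)) - q s (restr (nbr adj s) (fst z)) / p2 s (restr (nbr adj s) (fst z))))"
        by (rule member_le_sum[OF s]) auto
      finally show "ennreal \<bar>\<integral>z. \<bar>?e n \<omega> z\<bar> * \<bar>?d n \<omega> z\<bar> \<partial>P\<bar> \<le> \<dots>"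
        by (simp only: abs_of_nonneg[OF integral_nonneg_AE[OF AE_I2[OF mult_nonneg_nonneg[OF abs_ge_zero abs_ge_zero]]]])
    qed
    show ?thesis
      unfolding T_def
    proof (rule N.component_consistent[where F = "Fc s" and G = "Gc s" and fstar = "Ostar s" and gstar = "mstar s"
          and fhat = "\<lambda>n. Ohat n s" and ghat = "\<lambda>n. mhat n s"])
      show "iid_seq M Z P" by (rule iid.iid_seq_axioms)
    qed (use MP meas D mem B C A1_limit s bias in blast)+
  qed
  define T0 where "T0 n \<omega> = (\<Sum>i<n. fst (Z i \<omega>) v1 * ind (snd (Z i \<omega>) v1)) / real n
      - (\<integral>z. fst z v1 * ind (snd z v1) \<partial>P)" for n \<omega>
  have T0: "vop M T0"
    unfolding T0_def
  proof (rule iid.lln_bounded)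
    show "AE z in P. \<bar>fst z v1 * ind (snd z v1)\<bar> \<le> Mb"
      using A2_X by eventually_elim (use A2_pos in \<open>auto simp: ind_def\<close>)
  qed measurable
  \<comment> \<open>If the first coordinate is missing, exactly one connected set is its component,
    so the missing part of the mean is distributed over the limits of the summands.\<close>
  have mean: "(\<integral>z. fst z v1 \<partial>P) = (\<integral>z. fst z v1 * ind (snd z v1) \<partial>P) + (\<Sum>s\<in>?J. \<integral>z. fst z v1 * ?mis s z \<partial>P)"
  proof -
    have i: "integrable P (\<lambda>z. fst z v1 * ind (h (snd z)))" for h :: "('d \<Rightarrow> bool) \<Rightarrow> bool"
      by (rule md.X_bounded_integrable[where B = 1]) auto
    have "(\<Sum>s\<in>?J. \<integral>z. fst z v1 * ?mis s z \<partial>P) = (\<integral>z. (\<Sum>s\<in>?J. fst z v1 * ?mis s z) \<partial>P)"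
      by (rule Bochner_Integration.integral_sum[symmetric]) (rule i)
    also have "\<dots> = (\<integral>z. fst z v1 * ind (\<not> snd z v1) \<partial>P)"
      by (simp only: sum_distrib_left[symmetric] sum_ind_psi[OF adj_sym])
    finally have "(\<integral>z. fst z v1 * ind (snd z v1) \<partial>P) + (\<Sum>s\<in>?J. \<integral>z. fst z v1 * ?mis s z \<partial>P)
      = (\<integral>z. fst z v1 * ind (snd z v1) + fst z v1 * ind (\<not> snd z v1) \<partial>P)"
      using i[of "\<lambda>r. r v1"] i[of "\<lambda>r. \<not> r v1"] by simp
    also have "\<dots> = (\<integral>z. fst z v1 \<partial>P)"
      by (rule Bochner_Integration.integral_cong) (auto simp: ind_def)
    finally show ?thesis by simp
  qed
  \<comment> \<open>With the mean split in the same way as the estimator, the error is a finite sum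
    of centred terms that can be treated separately.\<close>
  have dev: "muhat adj v1 Z Ohat mhat n \<omega> - (\<integral>z. fst z v1 \<partial>P) = T0 n \<omega> + (\<Sum>s\<in>?J. T s n \<omega>)" for n \<omega>
  proof -
    have "(\<Sum>i<n. let x = fst (Z i \<omega>); r = snd (Z i \<omega>); xn = restr (nbr adj s) x;
            a = ind (allobs (cnbr adj s) r); ob = Ohat n s \<omega> xn
        in x v1 * ob * a + mhat n s \<omega> xn * (ind (psi adj v1 (\<lambda>k. \<not> r k) = s) - a * ob))
      = (\<Sum>i<n. nuisance.score adj v1 s (Ohat n s \<omega>) (mhat n s \<omega>) (Z i \<omega>))" if "s \<in> ?J" for s
      by (simp add: Let_def nuisance.score_def[OF nuis[OF that]])
    then show ?thesis
      unfolding muhat_def mean T_def T0_def sum_subtractf by simp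
  qed
  have "vop M (\<lambda>n \<omega>. T0 n \<omega> + (\<Sum>s\<in>?J. T s n \<omega>))"
    by (intro M.vop_add T0 M.vop_sum T) auto
  then have "vop M (\<lambda>n \<omega>. muhat adj v1 Z Ohat mhat n \<omega> - (\<integral>z. fst z v1 \<partial>P))"
    by (simp only: dev)
  then have dev_small: "osmall M (\<lambda>n. {\<omega>. e < \<bar>muhat adj v1 Z Ohat mhat n \<omega> - (\<integral>z. fst z v1 \<partial>P)\<bar>})" if "e > 0" for e
    using that by (simp add: vop_def)
  show ?thesis
  proof (intro allI impI, rule M.osmall_measure_tendsto)
    fix e :: real assume "e > 0"
    show "osmall M (\<lambda>n. {\<omega>\<in>space M. e < \<bar>muhat adj v1 Z Ohat mhat n \<omega> - (\<integral>z. fst z v1 \<partial>P)\<bar>})"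
      by (rule osmall_mono[OF dev_small[OF \<open>e > 0\<close>] always_eventually]) blast
  qed blast
qed

end
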